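(* Let $g:\mathbb{R}^+\to\mathbb{R}^+$ be an increasing function with $g(0)=0$ and $\lim_{t\to+\infty}g(t)=+\infty$, and for $\delta>0$ let $I_\delta(g):=\int_0^{+\infty}e^{-\delta t}\,dg(t)$. Let $c_n:=\dfrac{4^{n}(n!)^2}{(2n-1)!}$. 1) For any closed complex Euclidean ball $\mathbb{B}\subset\mathbb{C}^n$ and any function $u\in\mathcal{L}(\mathbb{C}^n)$, $$\frac{1}{\lambda_{2n}(\mathbb{B})}\int_{\mathbb{B}}g\bigl(\max_{\mathbb{B}}u-u\bigr)\,d\lambda_{2n}\le c_n\,I_2(g),$$ provided that $I_2(g)<+\infty$. 2) Let $\mathbb{G}\subset\mathbb{C}^n$ be a generic real subspace of complex dimension $m$. Then for any real Euclidean closed ball $B\subset\mathbb{G}$ and any function $u\in\mathcal{L}(\mathbb{C}^n)$, $$\frac{1}{\lambda_{n+m}(B)}\int_{B}g\bigl(\max_{B}u-u\bigr)\,d\lambda_{n+m}\le 8(n+m)\,I_1(g),$$ provided that $I_1(g)<+\infty$.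
   Context: $\mathcal{L}(\mathbb{C}^n)$ is the Lelong class: the set of plurisubharmonic functions $u$ on $\mathbb{C}^n$ (not identically $-\infty$) with $\sup_{z\in\mathbb{C}^n}\{u(z)-\log^+|z|\}<+\infty$. The integral defining $I_\delta(g)$ is a Riemann–Stieltjes integral. A real linear subspace $\mathbb{G}\subset\mathbb{C}^n$ is generic if $\mathbb{G}+J\mathbb{G}=\mathbb{C}^n$, where $J$ is the complex structure (multiplication by $i$). Its complex dimension is $m:=\dim_{\mathbb{C}}(\mathbb{G}\cap J\mathbb{G})$, so $\dim_{\mathbb{R}}\mathbb{G}=n+m$. $\mathbb{G}$ carries the induced Euclidean structure with Lebesgue measure $\lambda_{n+m}$; $\lambda_{2n}$ is Lebesgue measure on $\mathbb{C}^n$. Balls have positive radius. *)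

theory Defs
  imports "HOL-Analysis.Analysis"
begin

section \<open>Plurisubharmonic functions and the Lelong class\<close>

definition upper_semicontinuous_on :: "'a::topological_space set \<Rightarrow> ('a \<Rightarrow> ereal) \<Rightarrow> bool" where
  "upper_semicontinuous_on S f \<longleftrightarrow> (\<forall>c. openin (top_of_set S) {x \<in> S. f x < c})"

text \<open>
  The circle mean is the extended Lebesgue integral, positive part minus negative part:
  \<open>e2ennreal x\<close> is \<open>max 0 x\<close>. For an upper semicontinuous \<open>v < \<infinity>\<close> the positive part has a finite
  integral, so the ill-defined difference of two infinities does not occur.
\<close>

definition circle_mean :: "(complex \<Rightarrow> ereal) \<Rightarrow> complex \<Rightarrow> real \<Rightarrow> ereal" where
  "circle_mean v \<zeta> r =
     (enn2ereal (\<integral>\<^sup>+\<theta>\<in>{0..2 * pi}. e2ennreal (v (\<zeta> + of_real r * cis \<theta>)) \<partial>lborel)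
      - enn2ereal (\<integral>\<^sup>+\<theta>\<in>{0..2 * pi}. e2ennreal (- v (\<zeta> + of_real r * cis \<theta>)) \<partial>lborel))
     / ereal (2 * pi)"

text \<open>The function that is identically \<open>-\<infinity>\<close> counts as (pluri)subharmonic here; the Lelong class
  excludes it explicitly.\<close>

definition subharmonic_on :: "complex set \<Rightarrow> (complex \<Rightarrow> ereal) \<Rightarrow> bool" where
  "subharmonic_on S v \<longleftrightarrow>
     upper_semicontinuous_on S v \<and> (\<forall>\<zeta>\<in>S. v \<zeta> < \<infinity>) \<and>
     (\<forall>\<zeta> r. 0 < r \<and> cball \<zeta> r \<subseteq> S \<longrightarrow> v \<zeta> \<le> circle_mean v \<zeta> r)"

definition plurisubharmonic_on :: "(complex ^ 'n) set \<Rightarrow> (complex ^ 'n \<Rightarrow> ereal) \<Rightarrow> bool" where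
  "plurisubharmonic_on \<Omega> u \<longleftrightarrow>
     upper_semicontinuous_on \<Omega> u \<and> (\<forall>z\<in>\<Omega>. u z < \<infinity>) \<and>
     (\<forall>a b. subharmonic_on {\<zeta>. a + \<zeta> *s b \<in> \<Omega>} (\<lambda>\<zeta>. u (a + \<zeta> *s b)))"

definition log_plus :: "real \<Rightarrow> real" where
  "log_plus x = ln (max 1 x)"

definition lelong_class :: "(complex ^ 'n \<Rightarrow> ereal) set" where
  "lelong_class =
     {u. plurisubharmonic_on UNIV u \<and> (\<exists>z. u z \<noteq> -\<infinity>) \<and>
         (SUP z. u z - ereal (log_plus (norm z))) < \<infinity>}"

section \<open>The Riemann--Stieltjes integral\<close>

text \<open>Tagged partitions \<open>a = p 0 \<le> \<dots> \<le> p N = b\<close> with tags \<open>\<xi> i\<close>, in the limit of vanishing mesh.\<close>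

definition has_RS_integral ::
    "(real \<Rightarrow> real) \<Rightarrow> (real \<Rightarrow> real) \<Rightarrow> real \<Rightarrow> real \<Rightarrow> real \<Rightarrow> bool" where
  "has_RS_integral f g a b I \<longleftrightarrow>
     (\<forall>\<epsilon>>0. \<exists>\<eta>>0. \<forall>N p \<xi>.
        p (0::nat) = a \<and> p N = b \<and>
        (\<forall>i<N. p i \<le> p (Suc i) \<and> p (Suc i) - p i < \<eta> \<and> \<xi> i \<in> {p i..p (Suc i)})
        \<longrightarrow> \<bar>(\<Sum>i<N. f (\<xi> i) * (g (p (Suc i)) - g (p i))) - I\<bar> < \<epsilon>)"

definition RS_integral :: "(real \<Rightarrow> real) \<Rightarrow> (real \<Rightarrow> real) \<Rightarrow> real \<Rightarrow> real \<Rightarrow> real" where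
  "RS_integral f g a b = (THE I. has_RS_integral f g a b I)"

text \<open>For \<open>g\<close> increasing on \<open>{0..}\<close> the integral over \<open>{0..T}\<close> exists, is nonnegative and increases
  with \<open>T\<close>, so the improper integral is a limit in \<open>{0..\<infinity>}\<close>. A jump of \<open>g\<close> at \<open>0\<close> contributes.\<close>

definition I_exp :: "real \<Rightarrow> (real \<Rightarrow> real) \<Rightarrow> ennreal" where
  "I_exp \<delta> g = Lim at_top (\<lambda>T. ennreal (RS_integral (\<lambda>t. exp (- \<delta> * t)) g 0 T))"

text \<open>Since \<open>g\<close> tends to \<open>\<infinity>\<close>, it is extended by \<open>g \<infinity> = \<infinity>\<close>; this value is taken where \<open>u = -\<infinity>\<close>.\<close>

definition extend_infty :: "(real \<Rightarrow> real) \<Rightarrow> ereal \<Rightarrow> ennreal" where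
  "extend_infty g x = (if x = \<infinity> then \<infinity> else ennreal (g (real_of_ereal x)))"

definition c_ball :: "nat \<Rightarrow> real" where
  "c_ball n = 4 ^ n * (fact n)\<^sup>2 / fact (2 * n - 1)"

section \<open>Real subspaces of complex space\<close>

definition J :: "complex ^ 'n \<Rightarrow> complex ^ 'n" where
  "J z = \<i> *s z"

definition generic_subspace :: "(complex ^ 'n) set \<Rightarrow> bool" where
  "generic_subspace G \<longleftrightarrow> subspace G \<and> {x + y | x y. x \<in> G \<and> y \<in> J ` G} = UNIV"

text \<open>\<^const>\<open>vec.dim\<close> is the dimension over the scalar field of the vectors, here the complex
  numbers; \<^const>\<open>dim\<close> would be the real dimension.\<close>

definition complex_dim :: "(complex ^ 'n) set \<Rightarrow> nat" where
  "complex_dim G = vec.dim (G \<inter> J ` G)"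

text \<open>
  Lebesgue measure of the induced Euclidean structure on a subspace, as a Borel measure on the
  ambient space that is concentrated on the subspace. The formula is that of \<^const>\<open>lborel\<close>, with an
  orthonormal basis of the subspace in place of \<^const>\<open>Basis\<close>; it does not depend on the basis.
\<close>

definition orthonormal_basis_of :: "'a::euclidean_space set \<Rightarrow> 'a set \<Rightarrow> bool" where
  "orthonormal_basis_of G E \<longleftrightarrow>
     pairwise orthogonal E \<and> (\<forall>e\<in>E. norm e = 1) \<and> span E = G"

definition subspace_lborel :: "'a::euclidean_space set \<Rightarrow> 'a measure" where
  "subspace_lborel G =
     (let E = (SOME E. orthonormal_basis_of G E)
      in distr (\<Pi>\<^sub>M e\<in>E. lborel) borel (\<lambda>x. \<Sum>e\<in>E. x e *\<^sub>R e))"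

end

theory Submission
  imports Defs "HOL-Complex_Analysis.Complex_Analysis"
begin

text \<open>
  Both estimates reduce to exponential decay of the measure of \<open>{z \<in> B. u z \<le> max\<^sub>B u - t}\<close>, which
  in turn reduces to lines through a maximum point of \<open>u\<close> on \<open>B\<close>. On a line, let \<open>E\<close> be a compact part
  of the sublevel set and \<open>F\<close> a function that is holomorphic off \<open>E\<close>, bounded by 1 and \<open>O(1/z)\<close> at infinity;
  then \<open>u + ln |F|\<close> is at most \<open>max\<^sub>B u - t\<close>, so \<open>|F|\<close> is at most \<open>exp (-t)\<close> at the maximum
  point. For complex lines \<open>F\<close> is the Cauchy transform of the area measure on \<open>E\<close>, normalised by the
  Ahlfors--Beurling inequality; for real lines it is \<open>tanh (f / 4)\<close> with \<open>f\<close> the Cauchy transform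
  of the length measure on \<open>E\<close>. In the complex case the maximum point lies on the sphere, where the
  moment \<open>\<integral> |\<zeta>|\<^bsup>2n - 2\<^esup>\<close> of the disc in each line yields the constant \<open>c\<^sub>n\<close>. In the real case
  the lines give \<open>4 dim G\<close>, and \<open>dim G \<le> 2n\<close>.
\<close>

section \<open>Subharmonic functions of one variable\<close>

text \<open>The base point sits at the edge of each piece of line so that its kernel does not
  cancel. On a disc with \<open>0\<close> on its boundary \<open>Re (c / w) \<ge> 1/2\<close>, and
  on a segment starting at \<open>0\<close> the kernel \<open>1 / x\<close> is positive, so the
  transform at \<open>0\<close> is bounded below in terms of the measure of \<open>E\<close>. Seen
  from an interior point of the disc, opposite directions would cancel; hence complex lines need a
  maximum point on the sphere, whereas a real ray from any maximum point is already one-sided. The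
  two rates reflect the two normalisations. The area transform is bounded by the square root of the
  area, so the decay \<open>exp (-t)\<close> of \<open>|F|\<close> becomes \<open>exp (-2t)\<close>
  for the area; on a line the length is comparable with \<open>|F|\<close> itself. The decay
  \<open>O(1/z)\<close> of \<open>F\<close> matches the logarithmic growth of \<open>u\<close>: it
  keeps \<open>u + ln |F|\<close> bounded above at infinity, and a slightly larger exponent on
  \<open>|F|\<close> sends the sum to \<open>-\<infinity>\<close>. Passing from a line to the ball
  costs the ratio between the largest value and the mean of the polar weight: \<open>d\<close> for
  \<open>\<tau> ^ (d - 1)\<close> on a segment, and for \<open>|\<zeta>| ^ (2n - 2)\<close> on a
  disc through \<open>0\<close> the factor that completes 4 to \<open>c_ball n\<close>.\<close>

lemma upper_semicontinuous_attains_sup: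
  fixes W :: "'a::t2_space \<Rightarrow> 'b::linorder"
  assumes "compact K" "K \<noteq> {}" "\<And>c. closed {z\<in>K. c \<le> W z}"
  shows "\<exists>z\<in>K. \<forall>y\<in>K. W y \<le> W z"
proof -
  \<comment> \<open>A point common to the superlevel sets at all values \<open>W y\<close> is a
    maximum point. Finitely many of these sets meet at the point of \<open>Y\<close> with the
    largest value.\<close>
  have "K \<inter> \<Inter>((\<lambda>y. {z\<in>K. W y \<le> W z}) ` K) \<noteq> {}"
  proof (rule compact_imp_fip[OF \<open>compact K\<close>])
    show "closed T" if "T \<in> (\<lambda>y. {z\<in>K. W y \<le> W z}) ` K" for T
      using that assms(3) by auto
    fix F' assume F': "finite F'" "F' \<subseteq> (\<lambda>y. {z\<in>K. W y \<le> W z}) ` K"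
    then obtain Y where Y: "Y \<subseteq> K" "finite Y" "F' = (\<lambda>y. {z\<in>K. W y \<le> W z}) ` Y"
      by (meson finite_subset_image)
    show "K \<inter> \<Inter>F' \<noteq> {}"
    proof (cases "Y = {}")
      case True then show ?thesis using Y assms by auto
    next
      case False
      then have "Max (W ` Y) \<in> W ` Y" using Y(2) by simp
      then obtain y where "y \<in> Y" "W y = Max (W ` Y)" by auto
      then have "y \<in> Y" "\<forall>x\<in>Y. W x \<le> W y"
        using Y(2) by auto
      then have "y \<in> K \<inter> \<Inter>F'" using Y by auto
      then show ?thesis by blast
    qed
  qed
  then show ?thesis by blast
qed

lemma mean_value_circle:
  fixes g :: "complex \<Rightarrow> complex"
  assumes "g holomorphic_on ball z0 R" "0 < r" "r < R"
  shows "((\<lambda>\<theta>. g (z0 + of_real r * cis \<theta>)) has_integral (2 * pi * g z0)) {0..2*pi}"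
proof -
  have "((\<lambda>w. g w / (w - z0)) has_contour_integral (2 * of_real pi * \<i> * g z0)) (circlepath z0 r)"
  proof (rule Cauchy_integral_circlepath_simple)
    show "g holomorphic_on cball z0 r"
      by (rule holomorphic_on_subset[OF assms(1)]) (use assms in auto)
  qed (use assms in auto)
  then have "((\<lambda>w. g w / (w - z0)) has_contour_integral (2 * of_real pi * \<i> * g z0)) (part_circlepath z0 r 0 (2*pi))"
    by (simp add: circlepath_def)
  then have "((\<lambda>t. g (z0 + r * cis t) / (z0 + r * cis t - z0) * r * \<i> * cis t) has_integral (2 * of_real pi * \<i> * g z0)) {0..2*pi}"
    by (subst (asm) has_contour_integral_part_circlepath_iff) (use assms in \<open>auto simp: cis_conv_exp mult_ac\<close>)
  then have "((\<lambda>t. \<i> * g (z0 + r * cis t)) has_integral (2 * of_real pi * \<i> * g z0)) {0..2*pi}"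
    by (rule has_integral_eq[rotated]) (use assms in \<open>auto simp: field_simps\<close>)
  from has_integral_mult_right[OF this, of "-\<i>"] show ?thesis
    by (simp add: mult_ac)
qed

lemma usc_borel_measurable:
  fixes v :: "'a::topological_space \<Rightarrow> ereal"
  assumes "upper_semicontinuous_on UNIV v"
  shows "v \<in> borel_measurable borel"
proof (rule borel_measurableI_less)
  fix y
  have "open {x. v x < y}"
    using assms by (auto simp: upper_semicontinuous_on_def)
  then show "{x \<in> space borel. v x < y} \<in> sets borel"
    by simp
qed

text \<open>The trivial identity for \<open>h - x\<close>, with every part moved to the side where
  it enters with a plus sign. In this form it can be integrated in \<open>ennreal\<close> even where
  \<open>x = -\<infinity>\<close>.\<close>

lemma e2ennreal_balance:
  fixes h :: real and x :: ereal
  assumes "x \<le> ereal h"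
  shows "e2ennreal (ereal h) + e2ennreal (- x) = e2ennreal x + e2ennreal (- ereal h) + e2ennreal (ereal h - x)"
proof (cases x)
  case (real r)
  have *: "e2ennreal (ereal y) = ennreal y" for y
    by (simp add: ennreal_def e2ennreal_def)
  have r: "r \<le> h" using assms real by simp
  show ?thesis
  proof (cases "0 \<le> r"; cases "0 \<le> h")
  qed (use r in \<open>simp_all add: real * ennreal_neg flip: ennreal_plus\<close>)
next
  case MInf
  then show ?thesis by (simp add: e2ennreal_neg)
next
  case PInf
  then show ?thesis using assms by simp
qed

text \<open>A strong maximum principle. The harmonic majorant \<open>Re g\<close> has exact circle
  means, so equality at the centre makes the deficit \<open>Re g - v\<close> integrate to zero over
  the circle, while upper semicontinuity would spread a positive deficit at one point to an arc.
  Only the point at angle 0 is recorded, because the applications move an extremal point in the real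
  direction.\<close>

lemma subharmonic_touching_eq:
  fixes g :: "complex \<Rightarrow> complex" and r R :: real
  assumes sub: "subharmonic_on UNIV v"
    and g: "g holomorphic_on ball z0 R" and r: "0 < r" "r < R"
    and le: "\<And>z. z \<in> ball z0 R \<Longrightarrow> v z \<le> ereal (Re (g z))"
    and eq: "v z0 = ereal (Re (g z0))"
  shows "v (z0 + of_real r) = ereal (Re (g (z0 + of_real r)))"
proof (rule ccontr)
  define z where "z \<theta> = z0 + of_real r * cis \<theta>" for \<theta>
  define h where "h \<theta> = Re (g (z \<theta>))" for \<theta>
  have zball: "z \<theta> \<in> ball z0 R" for \<theta>
    using r by (simp add: z_def dist_norm norm_mult)
  have usc: "upper_semicontinuous_on UNIV v" using sub by (simp add: subharmonic_on_def)
  have zc: "continuous_on UNIV z" unfolding z_def by (intro continuous_intros)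
  have hc: "continuous_on UNIV h" unfolding h_def
    using holomorphic_on_imp_continuous_on[OF g] zball
    by (intro continuous_intros continuous_on_compose2[OF _ zc]) auto
  have [measurable]: "h \<in> borel_measurable borel" "z \<in> borel_measurable borel"
    "v \<in> borel_measurable borel"
    using hc zc usc_borel_measurable[OF usc] by (auto intro: borel_measurable_continuous_onI)
  define P where "P = (\<integral>\<^sup>+\<theta>\<in>{0..2*pi}. e2ennreal (v (z \<theta>)) \<partial>lborel)"
  define N where "N = (\<integral>\<^sup>+\<theta>\<in>{0..2*pi}. e2ennreal (- v (z \<theta>)) \<partial>lborel)"
  define D where "D = (\<integral>\<^sup>+\<theta>\<in>{0..2*pi}. e2ennreal (ereal (h \<theta>) - v (z \<theta>)) \<partial>lborel)"
  define HP where "HP = (\<integral>\<^sup>+\<theta>\<in>{0..2*pi}. ennreal (h \<theta>) \<partial>lborel)"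
  define HN where "HN = (\<integral>\<^sup>+\<theta>\<in>{0..2*pi}. ennreal (- h \<theta>) \<partial>lborel)"
  have e2: "e2ennreal (ereal y) = ennreal y" for y
    by (simp add: ennreal_def e2ennreal_def)
  have lev: "v (z \<theta>) \<le> ereal (h \<theta>)" for \<theta>
    using le zball by (simp add: h_def)
  have bal: "HP + N = P + HN + D"
  proof -
    have "HP + N = (\<integral>\<^sup>+\<theta>. ennreal (h \<theta>) * indicator {0..2*pi} \<theta> + e2ennreal (- v (z \<theta>)) * indicator {0..2*pi} \<theta> \<partial>lborel)"
      unfolding HP_def N_def by (rule nn_integral_add[symmetric]) auto
    also have "\<dots> = (\<integral>\<^sup>+\<theta>. e2ennreal (v (z \<theta>)) * indicator {0..2*pi} \<theta> + ennreal (- h \<theta>) * indicator {0..2*pi} \<theta>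
        + e2ennreal (ereal (h \<theta>) - v (z \<theta>)) * indicator {0..2*pi} \<theta> \<partial>lborel)"
      using e2ennreal_balance[OF lev] by (intro nn_integral_cong) (auto simp: indicator_def e2)
    also have "\<dots> = P + HN + D"
      unfolding P_def HN_def D_def by (simp add: nn_integral_add)
    finally show ?thesis .
  qed
  have "continuous_on {0..2*pi} h" using hc continuous_on_subset by blast
  then have hint: "set_integrable lborel {0..2*pi} h"
    using borel_integrable_compact[of "{0..2*pi}" h] by (auto simp: set_integrable_def)
  then have hI: "integrable lborel (\<lambda>\<theta>. indicator {0..2*pi} \<theta> * h \<theta>)"
    by (simp add: set_integrable_def)
  have HPe: "HP = (\<integral>\<^sup>+\<theta>. ennreal (indicator {0..2*pi} \<theta> * h \<theta>) \<partial>lborel)"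
    unfolding HP_def by (intro nn_integral_cong) (auto simp: indicator_def)
  have HNe: "HN = (\<integral>\<^sup>+\<theta>. ennreal (- (indicator {0..2*pi} \<theta> * h \<theta>)) \<partial>lborel)"
    unfolding HN_def by (intro nn_integral_cong) (auto simp: indicator_def)
  have fin: "HP < \<infinity>" "HN < \<infinity>"
    using hI unfolding HPe HNe real_integrable_def by (auto simp: less_top)
  have "(h has_integral (2*pi * Re (g z0))) {0..2*pi}"
    using has_integral_Re[OF mean_value_circle[OF g r]] by (simp add: h_def[abs_def] z_def)
  moreover have "(h has_integral (LINT \<theta>:{0..2*pi}|lborel. h \<theta>)) {0..2*pi}"
    using set_borel_integral_eq_integral[OF hint] by (simp add: has_integral_iff)
  ultimately have "(LINT \<theta>:{0..2*pi}|lborel. h \<theta>) = 2*pi * Re (g z0)"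
    using has_integral_unique by blast
  then have mean: "(\<integral>\<theta>. indicator {0..2*pi} \<theta> * h \<theta> \<partial>lborel) = 2*pi * Re (g z0)"
    by (simp add: set_lebesgue_integral_def)
  have HH: "enn2real HP - enn2real HN = 2*pi * Re (g z0)"
    unfolding HPe HNe using real_lebesgue_integral_def[OF hI] mean by linarith
  have Ple: "P \<le> HP"
    unfolding P_def HP_def
  proof (rule nn_integral_mono)
    fix \<theta>
    have "e2ennreal (v (z \<theta>)) \<le> ennreal (h \<theta>)"
      using e2ennreal_mono[OF lev[of \<theta>]] by (simp add: e2)
    then show "e2ennreal (v (z \<theta>)) * indicator {0..2*pi} \<theta> \<le> ennreal (h \<theta>) * indicator {0..2*pi} \<theta>"
      by (rule mult_right_mono) simp
  qed
  then have Pfin: "P < \<infinity>" using fin by auto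
  have "v z0 \<le> circle_mean v z0 r"
    using sub r by (auto simp: subharmonic_on_def)
  then have "ereal (Re (g z0)) \<le> (enn2ereal P - enn2ereal N) / ereal (2*pi)"
    by (simp add: eq circle_mean_def P_def N_def z_def)
  then have sm: "ereal (2*pi * Re (g z0)) \<le> enn2ereal P - enn2ereal N"
    by (simp add: ereal_le_divide_pos mult.commute)
  obtain p where p: "P = ennreal p" "0 \<le> p" using Pfin by (cases P) auto
  \<comment> \<open>The submean inequality supplies integrability: with \<open>P\<close> finite, an
    infinite negative part would make the mean \<open>-\<infinity>\<close>, below the finite value
    \<open>v z0\<close>.\<close>
  have Nfin: "N < \<infinity>"
  proof (rule ccontr)
    assume "\<not> N < \<infinity>"
    then have "N = top" by (simp flip: less_top)
    then have "enn2ereal P - enn2ereal N = -\<infinity>"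
      by (simp add: p)
    then show False using sm by simp
  qed
  have "P + HN + D < \<infinity>" using bal fin Nfin by (simp add: less_top flip: bal)
  then have Dfin: "D < \<infinity>" by (simp add: less_top)
  obtain n where n: "N = ennreal n" "0 \<le> n" using Nfin by (cases N) auto
  obtain d where d: "D = ennreal d" "0 \<le> d" using Dfin by (cases D) auto
  obtain hp where hp: "HP = ennreal hp" "0 \<le> hp" using fin by (cases HP) auto
  obtain hn where hn: "HN = ennreal hn" "0 \<le> hn" using fin by (cases HN) auto
  have "hp + n = p + hn + d"
    using bal p n d hp hn by (simp flip: ennreal_plus)
  moreover have "2*pi * Re (g z0) \<le> p - n"
    using sm p n by simp
  moreover have "hp - hn = 2*pi * Re (g z0)"
    using HH hp hn by simp
  ultimately have "d \<le> 0" by linarith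
  then have "D = 0" using d by simp
  then have AE: "AE \<theta> in lborel. e2ennreal (ereal (h \<theta>) - v (z \<theta>)) * indicator {0..2*pi} \<theta> = 0"
    unfolding D_def by (subst (asm) nn_integral_0_iff_AE) auto
  assume "v (z0 + of_real r) \<noteq> ereal (Re (g (z0 + of_real r)))"
  then have "v (z 0) < ereal (h 0)"
    using lev[of 0] by (simp add: z_def h_def)
  then obtain c where c: "v (z 0) < ereal c" "ereal c < ereal (h 0)"
    using ereal_dense2 by blast
  have "open {x. v x < ereal c}"
    using usc by (auto simp: upper_semicontinuous_on_def)
  then have o1: "open (z -` {x. v x < ereal c})"
    using zc continuous_on_open_vimage[of UNIV z] by auto
  have o2: "open (h -` {c<..})"
    using hc continuous_on_open_vimage[of UNIV h] by auto
  have "open (z -` {x. v x < ereal c} \<inter> h -` {c<..})" (is "open ?O") using o1 o2 by auto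
  moreover have "0 \<in> ?O" using c by auto
  ultimately obtain e where e: "0 < e" "ball 0 e \<subseteq> ?O"
    by (meson open_contains_ball)
  define e' where "e' = min (e/2) pi"
  have e': "0 < e'" "e' \<le> 2*pi" "{0..e'} \<subseteq> ?O"
  proof -
    show "0 < e'" "e' \<le> 2*pi" using e pi_gt_zero by (auto simp: e'_def min_le_iff_disj)
    have "{0..e'} \<subseteq> ball 0 e" using e by (auto simp: e'_def dist_real_def)
    then show "{0..e'} \<subseteq> ?O" using e by blast
  qed
  have "AE \<theta> in lborel. \<theta> \<notin> {0..e'}"
    using AE
  proof eventually_elim
    case (elim \<theta>)
    show ?case
    proof
      assume "\<theta> \<in> {0..e'}"
      then have a: "v (z \<theta>) < ereal c" "c < h \<theta>" "\<theta> \<in> {0..2*pi}" using e' by auto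
      then have "v (z \<theta>) < ereal (h \<theta>)" by (meson ereal_less(3) less_ereal.simps(1) less_trans)
      then have "0 < ereal (h \<theta>) - v (z \<theta>)"
        using ereal_minus_less_iff by (cases "v (z \<theta>)") auto
      then have "e2ennreal (ereal (h \<theta>) - v (z \<theta>)) > 0"
        by (metis enn2ereal_e2ennreal less_imp_le less_irrefl not_gr_zero zero_ennreal.rep_eq)
      then show False using elim a by simp
    qed
  qed
  then have "emeasure lborel {0..e'} = 0"
    by (subst (asm) AE_iff_measurable[of "{0..e'}"]) auto
  then show False using e' by simp
qed

text \<open>If \<open>v z < h z\<close>, a real \<open>q\<close> lies strictly between; so the set
  is an intersection over \<open>q\<close> of unions of two closed sets. No difference with infinite
  values has to be formed.\<close>

lemma closed_Collect_le_usc: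
  fixes v :: "'a::topological_space \<Rightarrow> ereal" and h :: "'a \<Rightarrow> real"
  assumes v: "upper_semicontinuous_on UNIV v" and K: "closed K" "continuous_on K h"
  shows "closed {z\<in>K. ereal (h z) \<le> v z}"
proof -
  have "{z\<in>K. ereal (h z) \<le> v z} = K \<inter> (\<Inter>q. {z\<in>K. h z \<le> q} \<union> {z. ereal q \<le> v z})" (is "?A = ?B")
  proof
    show "?A \<subseteq> ?B"
    proof
      fix z assume z: "z \<in> ?A"
      have "h z \<le> q \<or> ereal q \<le> v z" for q
      proof (cases "h z \<le> q")
        case False
        then have "ereal q \<le> ereal (h z)" by simp
        also have "\<dots> \<le> v z" using z by simp
        finally show ?thesis ..
      qed simp
      then show "z \<in> ?B" using z by blast
    qed
    show "?B \<subseteq> ?A"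
    proof
      fix z assume z: "z \<in> ?B"
      show "z \<in> ?A"
      proof (rule ccontr)
        assume "z \<notin> ?A"
        then have "v z < ereal (h z)" using z by auto
        then obtain q where "v z < ereal q" "ereal q < ereal (h z)"
          using ereal_dense2 by blast
        moreover have "z \<in> {z\<in>K. h z \<le> q} \<union> {z. ereal q \<le> v z}" using z by blast
        ultimately show False by auto
      qed
    qed
  qed
  moreover have "closed {z. ereal q \<le> v z}" for q
  proof -
    have "open {z. v z < ereal q}" using v by (auto simp: upper_semicontinuous_on_def)
    moreover have "- {z. v z < ereal q} = {z. ereal q \<le> v z}" by auto
    ultimately show ?thesis by (metis closed_Compl)
  qed
  moreover have "closed {z\<in>K. h z \<le> q}" for q
    using K by (intro continuous_on_closed_Collect_le continuous_intros) auto
  ultimately show ?thesis using K by (auto intro!: closed_Int closed_INT closed_Un)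
qed

text \<open>Two-constant principle: the subharmonic function \<open>v + (1 + \<eta>) ln |F|\<close> tends to \<open>-\<infinity>\<close> at
  infinity, so it has a maximum point of largest real part off a neighbourhood of \<open>E\<close>; the mean
  value inequality on a small circle around that point produces one further to the right.\<close>

lemma subharmonic_two_constants:
  fixes v :: "complex \<Rightarrow> ereal" and F :: "complex \<Rightarrow> complex"
  assumes sub: "subharmonic_on UNIV v"
    and bd: "\<And>z. v z \<le> ereal (C + log_plus (norm z))"
    and E: "compact E" "\<And>z. z \<in> E \<Longrightarrow> v z \<le> ereal s"
    and F: "F holomorphic_on - E" "\<And>z. z \<notin> E \<Longrightarrow> norm (F z) \<le> 1"
    and Finf: "\<And>z. z \<notin> E \<Longrightarrow> R0 \<le> norm z \<Longrightarrow> norm z * norm (F z) \<le> K0"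
    and z1: "z1 \<notin> E" "F z1 \<noteq> 0"
  shows "v z1 \<le> ereal (s - ln (norm (F z1)))"
proof (rule ccontr)
  assume neg: "\<not> ?thesis"
  have usc: "upper_semicontinuous_on UNIV v" using sub by (simp add: subharmonic_on_def)
  have "v z1 < \<infinity>" using sub by (simp add: subharmonic_on_def)
  then obtain v1 where v1: "v z1 = ereal v1" using neg by (cases "v z1") auto
  define L1 where "L1 = ln (norm (F z1))"
  have L1: "L1 \<le> 0" using F(2)[OF z1(1)] z1(2) by (simp add: L1_def)
  define \<epsilon> where "\<epsilon> = (v1 + L1 - s) / 3"
  have \<epsilon>: "0 < \<epsilon>" using neg by (simp add: v1 \<epsilon>_def L1_def)
  \<comment> \<open>The exponent \<open>1 + \<eta>\<close> lets \<open>ln |F|\<close> outweigh the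
    logarithmic growth of \<open>v\<close>. This choice costs at most \<open>\<epsilon>\<close> at
    \<open>z1\<close>, and as \<open>\<epsilon>\<close> is a third of the assumed violation,
    \<open>c0 > s + \<epsilon>\<close> survives.\<close>
  define \<eta> where "\<eta> = \<epsilon> / (1 - L1)"
  have \<eta>: "0 < \<eta>" using \<epsilon> L1 by (simp add: \<eta>_def)
  have "\<eta> * (- L1) \<le> \<epsilon>" using \<epsilon> L1 by (simp add: \<eta>_def field_simps)
  define c0 where "c0 = v1 + (1 + \<eta>) * L1"
  have c0: "c0 > s + \<epsilon>"
    using \<open>\<eta> * (- L1) \<le> \<epsilon>\<close> \<epsilon> by (simp add: c0_def \<epsilon>_def algebra_simps) argo
  define L where "L z = (1 + \<eta>) * ln (norm (F z))" for z
  have Lle: "L z \<le> 0" if "z \<notin> E" "F z \<noteq> 0" for z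
    using F(2)[OF that(1)] that(2) \<eta> by (simp add: L_def mult_nonneg_nonpos)
  define W where "W z = v z + ereal (L z)" for z
  have Wz1: "W z1 = ereal c0" by (simp add: W_def v1 L_def c0_def L1_def)
  \<comment> \<open>Since \<open>L \<le> 0\<close>, \<open>W \<ge> c0\<close> forces
    \<open>v\<close> above \<open>s + \<epsilon>\<close>, that is, into this closed set disjoint
    from \<open>E\<close>. The boundary behaviour of \<open>F\<close> at \<open>E\<close> therefore
    never enters.\<close>
  define A where "A = {z. ereal (s + \<epsilon>) \<le> v z}"
  have "closed A"
    using closed_Collect_le_usc[OF usc closed_UNIV, of "\<lambda>_. s + \<epsilon>"] by (simp add: A_def)
  have AE: "z \<notin> E" if "z \<in> A" for z
    using that E(2)[of z] \<epsilon> by (auto simp: A_def dest: order_trans)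
  define K' where "K' = max K0 1"
  \<comment> \<open>Solved from \<open>C + (1 + \<eta>) * ln K' - \<eta> * ln |z| < c0\<close>, the
    upper bound for \<open>W\<close> far out; beyond radius 1 \<open>log_plus\<close> is the plain
    logarithm.\<close>
  define R where "R = max (max 1 R0) (exp ((C + (1 + \<eta>) * ln K' - c0) / \<eta>) + 1)"
  have R: "R \<ge> 1" "R \<ge> R0" "R > exp ((C + (1 + \<eta>) * ln K' - c0) / \<eta>)"
    by (auto simp: R_def less_max_iff_disj)
  have far: "W z < ereal c0" if "z \<notin> E" "F z \<noteq> 0" "R < norm z" for z
  proof -
    have nz: "norm z > 1" "norm z \<ge> R0" using that R by auto
    have "norm (F z) \<le> K' / norm z"
    proof -
      have "norm z * norm (F z) \<le> K'" using Finf[OF that(1) nz(2)] by (simp add: K'_def)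
      moreover have "0 < norm z" using nz by linarith
      ultimately show ?thesis by (simp only: pos_le_divide_eq mult.commute)
    qed
    then have "ln (norm (F z)) \<le> ln (K' / norm z)"
      using that(2) by (intro ln_mono) auto
    also have "\<dots> = ln K' - ln (norm z)"
    proof -
      have "norm z > 0" using nz by linarith
      moreover have "K' > 0" by (simp add: K'_def less_max_iff_disj)
      ultimately show ?thesis by (simp add: ln_divide_pos)
    qed
    finally have 1: "L z \<le> (1 + \<eta>) * (ln K' - ln (norm z))"
      unfolding L_def using \<eta> by (intro mult_left_mono) auto
    have 2: "v z \<le> ereal (C + ln (norm z))" using bd[of z] nz by (simp add: log_plus_def max_def)
    have "exp ((C + (1 + \<eta>) * ln K' - c0) / \<eta>) < norm z" using R that by simp
    then have "(C + (1 + \<eta>) * ln K' - c0) / \<eta> < ln (norm z)"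
      using nz by (metis exp_less_cancel_iff exp_ln less_trans zero_less_one)
    then have 3: "C + (1 + \<eta>) * ln K' - c0 < \<eta> * ln (norm z)"
      using \<eta> by (simp add: field_simps)
    have "W z \<le> ereal (C + ln (norm z)) + ereal ((1 + \<eta>) * (ln K' - ln (norm z)))"
      unfolding W_def using 1 2 by (intro add_mono) auto
    also have "\<dots> < ereal c0" using 3 by (simp add: algebra_simps)
    finally show ?thesis .
  qed
  \<comment> \<open>Within radius \<open>R\<close> the function \<open>v\<close> is at most
    \<open>C + ln R\<close>, so \<open>W \<ge> c0\<close> keeps \<open>|F|\<close> above this
    positive constant. The zeros of \<open>F\<close> are thus kept out of \<open>K\<close>, and
    \<open>L\<close> is continuous there.\<close>
  define \<kappa> where "\<kappa> = exp ((c0 - (C + ln R)) / (1 + \<eta>))"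
  have near: "\<kappa> \<le> norm (F z)" if "F z \<noteq> 0" "norm z \<le> R" "ereal c0 \<le> W z" for z
  proof -
    have "log_plus (norm z) \<le> ln R"
      unfolding log_plus_def using that R by (intro ln_mono) auto
    then have "v z \<le> ereal (C + ln R)" using bd[of z] by (auto intro: order_trans)
    then have "W z \<le> ereal (C + ln R) + ereal (L z)"
      unfolding W_def by (intro add_mono) auto
    then have "ereal c0 \<le> ereal (C + ln R + L z)" using order_trans[OF that(3)] by (simp only: plus_ereal.simps)
    then have "(c0 - (C + ln R)) / (1 + \<eta>) \<le> ln (norm (F z))"
      using \<eta> by (simp add: L_def field_simps)
    then show ?thesis
      unfolding \<kappa>_def using that(1) by (metis exp_le_cancel_iff exp_ln zero_less_norm_iff)
  qed
  define K where "K = {z\<in>A \<inter> cball 0 R. \<kappa> \<le> norm (F z)}"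
  have Fc: "continuous_on (- E) F" using F(1) by (rule holomorphic_on_imp_continuous_on)
  have "closed K" unfolding K_def
    using \<open>closed A\<close> AE by (intro continuous_on_closed_Collect_le continuous_intros continuous_on_subset[OF Fc]) auto
  have "compact K"
  proof -
    have "K = cball 0 R \<inter> K" by (auto simp: K_def)
    then show ?thesis using \<open>closed K\<close> by (metis compact_Int_closed compact_cball)
  qed
  have "\<kappa> > 0" by (simp add: \<kappa>_def)
  have KE: "z \<notin> E" "F z \<noteq> 0" if "z \<in> K" for z
    using that AE \<open>\<kappa> > 0\<close> by (auto simp: K_def)
  \<comment> \<open>All competitors for the maximum of \<open>W\<close> off \<open>E\<close> and off
    the zeros of \<open>F\<close> lie in the compact set \<open>K\<close>, so the maximum over
    \<open>K\<close> is global there.\<close>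
  have inK: "z \<in> K" if "z \<notin> E" "F z \<noteq> 0" "ereal c0 \<le> W z" for z
  proof -
    have zR: "norm z \<le> R" using far[OF that(1,2)] that(3) by (meson leD not_le_imp_less)
    have "W z \<le> v z + ereal 0"
      unfolding W_def using Lle[OF that(1,2)] by (intro add_mono) auto
    then have "ereal c0 \<le> v z" using that(3) by (auto intro: order_trans)
    then have "z \<in> A" unfolding A_def using c0 by (auto intro: order_trans[rotated])
    then show ?thesis using zR near[OF that(2) zR that(3)] by (simp add: K_def)
  qed
  have Lc: "continuous_on K L"
    unfolding L_def using KE by (intro continuous_intros continuous_on_subset[OF Fc]) auto
  have clW: "closed {z\<in>K. c \<le> W z}" for c
  proof (cases c)
    case (real r)
    have "c \<le> W z \<longleftrightarrow> ereal (r - L z) \<le> v z" for z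
      unfolding W_def real by (cases "v z") auto
    then show ?thesis
      using closed_Collect_le_usc[OF usc \<open>closed K\<close> continuous_on_diff[OF continuous_on_const Lc], of r] by simp
  next
    case PInf
    have "v z \<noteq> \<infinity>" for z using sub by (auto simp: subharmonic_on_def)
    then have "{z\<in>K. c \<le> W z} = {}" by (auto simp: W_def PInf)
    then show ?thesis by (simp only: closed_empty)
  next
    case MInf
    then show ?thesis using \<open>closed K\<close> by simp
  qed
  have z1K: "z1 \<in> K" using inK[OF z1] Wz1 by simp
  obtain zm where zm: "zm \<in> K" "\<And>y. y \<in> K \<Longrightarrow> W y \<le> W zm"
    using upper_semicontinuous_attains_sup[OF \<open>compact K\<close> _ clW] z1K by blast
  define Km where "Km = {z\<in>K. W zm \<le> W z}"
  have "compact Km"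
  proof -
    have "Km = K \<inter> Km" by (auto simp: Km_def)
    then show ?thesis using clW[of "W zm"] \<open>compact K\<close> unfolding Km_def by (metis compact_Int_closed)
  qed
  moreover have "Km \<noteq> {}" using zm by (auto simp: Km_def)
  moreover have "continuous_on Km Re" by (intro continuous_intros)
  ultimately obtain z0 where z0: "z0 \<in> Km" "\<And>y. y \<in> Km \<Longrightarrow> Re y \<le> Re z0"
    using continuous_attains_sup[of Km Re] by blast
  have z0K: "z0 \<in> K" and Wz0: "W z0 = W zm" using z0(1) zm(2)[of z0] by (auto simp: Km_def)
  have c0W: "ereal c0 \<le> W z0" using zm(2)[OF z1K] Wz0 Wz1 by simp
  have "v z0 \<noteq> \<infinity>" using sub by (auto simp: subharmonic_on_def)
  then obtain M where M: "W z0 = ereal M" using c0W unfolding W_def by (cases "v z0") auto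
  have Wle: "W z \<le> ereal M" if "z \<notin> E" "F z \<noteq> 0" for z
  proof (cases "ereal c0 \<le> W z")
    case True
    then show ?thesis using inK[OF that] zm(2) Wz0 M by auto
  next
    case False
    then have "W z \<le> ereal c0" by simp
    also have "\<dots> \<le> ereal M" using c0W M by simp
    finally show ?thesis .
  qed
  have "open (- E)" using E(1) by (simp add: compact_imp_closed open_Compl)
  then have "open (- E \<inter> F -` (- {0}))"
    by (intro continuous_open_preimage[OF Fc]) auto
  moreover have "- E \<inter> F -` (- {0}) = {z\<in>- E. F z \<noteq> 0}" by auto
  ultimately have "open {z\<in>- E. F z \<noteq> 0}" by simp
  moreover have "z0 \<in> {z\<in>- E. F z \<noteq> 0}" using KE[OF z0K] by simp
  ultimately obtain R' where R': "0 < R'" "ball z0 R' \<subseteq> {z\<in>- E. F z \<noteq> 0}"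
    by (meson open_contains_ball)
  have "F holomorphic_on ball z0 R'" using F(1) R'(2) by (auto intro: holomorphic_on_subset)
  moreover have "contractible (ball z0 R')" by (intro convex_imp_contractible convex_ball)
  moreover have "\<And>z. z \<in> ball z0 R' \<Longrightarrow> F z \<noteq> 0" using R'(2) by auto
  ultimately obtain l where l: "l holomorphic_on ball z0 R'" "\<And>z. z \<in> ball z0 R' \<Longrightarrow> F z = exp (l z)"
    using contractible_imp_holomorphic_log by metis
  \<comment> \<open>With \<open>l\<close> a local logarithm of \<open>F\<close>,
    \<open>M - (1 + \<eta>) * ln |F|\<close> is the real part of a holomorphic function; maximality
    of \<open>W\<close> at \<open>z0\<close> says that \<open>v\<close> touches it from below
    there.\<close>
  define g where "g z = of_real M - of_real (1 + \<eta>) * l z" for z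
  have ReL: "Re (g z) = M - L z" if "z \<in> ball z0 R'" for z
    using l(2)[OF that] by (simp add: g_def L_def)
  have vle: "v z \<le> ereal (Re (g z))" if "z \<in> ball z0 R'" for z
    using Wle[of z] R'(2) that ReL[OF that] unfolding W_def by (cases "v z") auto
  have veq: "v z0 = ereal (Re (g z0))"
    using M ReL[of z0] R'(1) unfolding W_def by (cases "v z0") auto
  have "g holomorphic_on ball z0 R'" unfolding g_def by (intro holomorphic_intros l)
  note * = subharmonic_touching_eq[OF sub this, of "R'/2", OF _ _ vle veq]
  define z2 where "z2 = z0 + of_real (R'/2)"
  have z2b: "z2 \<in> ball z0 R'" using R' by (simp add: z2_def dist_norm)
  have "v z2 = ereal (Re (g z2))" unfolding z2_def using * R'(1) by simp
  then have Wz2: "W z2 = ereal M" using ReL[OF z2b] by (simp add: W_def)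
  have "z2 \<in> K" using inK[of z2] z2b R'(2) Wz2 c0W M by auto
  then have "z2 \<in> Km" using Wz2 Wz0 M by (simp add: Km_def)
  then have "Re z2 \<le> Re z0" by (rule z0(2))
  then show False using R'(1) by (simp add: z2_def)
qed

section \<open>Lebesgue measure and the plane\<close>

lemma nn_integral_lborel_shift:
  fixes f :: "'a::euclidean_space \<Rightarrow> ennreal"
  assumes [measurable]: "f \<in> borel_measurable borel"
  shows "(\<integral>\<^sup>+x. f (c + x) \<partial>lborel) = (\<integral>\<^sup>+x. f x \<partial>lborel)"
proof -
  have "(\<integral>\<^sup>+x. f x \<partial>lborel) = (\<integral>\<^sup>+x. f x \<partial>distr lborel borel ((+) c))"
    by (simp add: lborel_distr_plus)
  then show ?thesis by (simp add: nn_integral_distr)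
qed

text \<open>Uniqueness of Haar measure: integrate \<open>f (T x + y)\<close> over all \<open>y\<close> and all \<open>x\<close> with \<open>T x\<close> in
  the unit ball, in both orders.\<close>

lemma nn_integral_lborel_similarity:
  fixes T :: "'a::euclidean_space \<Rightarrow> 'a"
  assumes T: "linear T" "\<And>x. norm (T x) = k * norm x" and k: "k > 0"
    and f[measurable]: "f \<in> borel_measurable borel"
  shows "(\<integral>\<^sup>+x. f x \<partial>lborel) = ennreal (k ^ DIM('a)) * (\<integral>\<^sup>+x. f (T x) \<partial>lborel)"
proof -
  define B where "B = (ball 0 1 :: 'a set)"
  have "inj T"
  proof (rule injI)
    fix x y assume "T x = T y"
    then have "k * norm (x - y) = 0" using T(2)[of "x - y"] by (simp add: linear_diff[OF T(1)])
    then show "x = y" using k by simp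
  qed
  then have "surj T" using T(1) linear_injective_imp_surjective by blast
  then have S: "T (inv T y) = y" for y by (simp add: surj_f_inv_f)
  have [measurable]: "T \<in> borel_measurable borel"
    using T(1) by (intro borel_measurable_continuous_onI linear_continuous_on linear_conv_bounded_linear[THEN iffD1])
  have [measurable]: "B \<in> sets borel" by (simp add: B_def)
  define b where "b = unit_ball_vol (real DIM('a))"
  have b: "emeasure lborel B = ennreal b" "b > 0"
    by (simp_all add: B_def b_def emeasure_ball)
  have TB: "T x \<in> B \<longleftrightarrow> x \<in> ball 0 (1/k)" for x
    using k by (simp add: B_def T field_simps)
  have bk: "emeasure lborel (ball (0::'a) (1/k)) = ennreal (b / k ^ DIM('a))"
    using k by (simp add: emeasure_ball b_def field_simps)
  have "(\<integral>\<^sup>+x. (\<integral>\<^sup>+y. f (T x + y) * indicator B (T x) \<partial>lborel) \<partial>lborel)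
      = (\<integral>\<^sup>+x. (\<integral>\<^sup>+y. f y \<partial>lborel) * indicator (ball (0::'a) (1/k)) x \<partial>lborel)"
    by (intro nn_integral_cong) (simp add: nn_integral_multc nn_integral_lborel_shift indicator_def TB)
  also have "\<dots> = (\<integral>\<^sup>+y. f y \<partial>lborel) * ennreal (b / k ^ DIM('a))"
    by (simp add: nn_integral_cmult_indicator bk)
  finally have 1: "(\<integral>\<^sup>+x. (\<integral>\<^sup>+y. f (T x + y) * indicator B (T x) \<partial>lborel) \<partial>lborel)
      = (\<integral>\<^sup>+y. f y \<partial>lborel) * ennreal (b / k ^ DIM('a))" .
  have "(\<integral>\<^sup>+x. (\<integral>\<^sup>+y. f (T x + y) * indicator B (T x) \<partial>lborel) \<partial>lborel)
      = (\<integral>\<^sup>+y. (\<integral>\<^sup>+x. f (T x + y) * indicator B (T x) \<partial>lborel) \<partial>lborel)"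
    by (rule lborel_pair.Fubini'[symmetric]) simp
  also have "\<dots> = (\<integral>\<^sup>+y. (\<integral>\<^sup>+x. f (T x) * indicator B (T x - y) \<partial>lborel) \<partial>lborel)"
  proof (rule nn_integral_cong)
    fix y
    \<comment> \<open>Translating \<open>x\<close> by a preimage of \<open>y\<close> moves
      \<open>y\<close> from the argument of \<open>f\<close> into the indicator.\<close>
    have "(\<integral>\<^sup>+x. f (T x) * indicator B (T x - y) \<partial>lborel)
        = (\<integral>\<^sup>+x. f (T (inv T y + x)) * indicator B (T (inv T y + x) - y) \<partial>lborel)"
      by (rule nn_integral_lborel_shift[symmetric]) simp
    then show "(\<integral>\<^sup>+x. f (T x + y) * indicator B (T x) \<partial>lborel)
        = (\<integral>\<^sup>+x. f (T x) * indicator B (T x - y) \<partial>lborel)"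
      by (simp add: linear_add[OF T(1)] S add.commute)
  qed
  also have "\<dots> = (\<integral>\<^sup>+x. (\<integral>\<^sup>+y. f (T x) * indicator B (T x - y) \<partial>lborel) \<partial>lborel)"
    by (rule lborel_pair.Fubini') simp
  also have "\<dots> = (\<integral>\<^sup>+x. f (T x) * ennreal b \<partial>lborel)"
  proof (rule nn_integral_cong)
    fix x
    have "(\<integral>\<^sup>+y. indicator B (T x - y) \<partial>lborel) = (\<integral>\<^sup>+y. indicator B (- T x + y) \<partial>lborel)"
      by (intro nn_integral_cong) (simp add: B_def indicator_def dist_norm norm_minus_commute)
    also have "\<dots> = (\<integral>\<^sup>+y. indicator B y \<partial>lborel)" by (rule nn_integral_lborel_shift) simp
    also have "\<dots> = ennreal b" by (simp add: b)
    finally show "(\<integral>\<^sup>+y. f (T x) * indicator B (T x - y) \<partial>lborel) = f (T x) * ennreal b"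
      by (simp add: nn_integral_cmult)
  qed
  also have "\<dots> = (\<integral>\<^sup>+x. f (T x) \<partial>lborel) * ennreal b" by (simp add: nn_integral_multc)
  finally have "(\<integral>\<^sup>+y. f y \<partial>lborel) * ennreal (b / k ^ DIM('a)) = (\<integral>\<^sup>+x. f (T x) \<partial>lborel) * ennreal b"
    using 1 by simp
  then have "(\<integral>\<^sup>+y. f y \<partial>lborel) * (ennreal (b / k ^ DIM('a)) * ennreal (k ^ DIM('a) / b))
      = (\<integral>\<^sup>+x. f (T x) \<partial>lborel) * (ennreal b * ennreal (k ^ DIM('a) / b))"
    by (simp flip: mult.assoc)
  moreover have "ennreal (b / k ^ DIM('a)) * ennreal (k ^ DIM('a) / b) = 1"
    using b k by (simp flip: ennreal_mult)
  moreover have "ennreal b * ennreal (k ^ DIM('a) / b) = ennreal (k ^ DIM('a))"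
    using b k by (simp flip: ennreal_mult)
  ultimately show ?thesis by (simp add: mult.commute)
qed

text \<open>Gives access to Fubini in real and imaginary parts; it is enough to compare the two
  measures on boxes.\<close>

lemma lborel_complex_eq:
  "(lborel :: complex measure) = distr (lborel \<Otimes>\<^sub>M lborel) borel (\<lambda>(x, y). Complex x y)"
proof (rule lborel_eqI)
  have [measurable]: "(\<lambda>(x, y). Complex x y) \<in> borel_measurable (borel :: (real \<times> real) measure)"
    unfolding Complex_eq case_prod_beta by (intro borel_measurable_continuous_onI continuous_intros)
  then have [measurable]: "(\<lambda>(x, y). Complex x y) \<in> borel_measurable (lborel \<Otimes>\<^sub>M lborel)"
    by (simp add: lborel_prod)
  fix l u :: complex
  assume lu: "\<And>b. b \<in> Basis \<Longrightarrow> l \<bullet> b \<le> u \<bullet> b"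
  then have le: "Re l \<le> Re u" "Im l \<le> Im u"
    using lu[of 1] lu[of \<i>] by (simp_all add: Basis_complex_def)
  have pre: "(\<lambda>(x, y). Complex x y) -` box l u = box (Re l) (Re u) \<times> box (Im l) (Im u)"
    by (auto simp: box_def Basis_complex_def)
  have "emeasure (distr (lborel \<Otimes>\<^sub>M lborel) borel (\<lambda>(x, y). Complex x y)) (box l u)
      = emeasure (lborel \<Otimes>\<^sub>M lborel) ((\<lambda>(x, y). Complex x y) -` box l u \<inter> space (lborel \<Otimes>\<^sub>M lborel))"
    by (rule emeasure_distr) auto
  also have "\<dots> = emeasure (lborel \<Otimes>\<^sub>M lborel) (box (Re l) (Re u) \<times> box (Im l) (Im u))"
    by (simp add: pre space_pair_measure)
  also have "\<dots> = ennreal ((Re u - Re l) * (Im u - Im l))"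
    using le by (simp add: lborel.emeasure_pair_measure_Times ennreal_mult)
  also have "\<dots> = (\<Prod>b\<in>Basis. (u - l) \<bullet> b)"
    by (simp add: Basis_complex_def)
  finally show "emeasure (distr (lborel \<Otimes>\<^sub>M lborel) borel (\<lambda>(x, y). Complex x y)) (box l u)
      = (\<Prod>b\<in>Basis. (u - l) \<bullet> b)" .
qed simp

text \<open>The half plane in the coordinates \<open>w = x (1 + \<i> s)\<close>.\<close>

lemma nn_integral_half_plane:
  fixes \<phi> :: "complex \<Rightarrow> ennreal"
  assumes [measurable]: "\<phi> \<in> borel_measurable borel"
  shows "(\<integral>\<^sup>+w\<in>{w. 0 < Re w}. \<phi> w \<partial>lborel)
       = (\<integral>\<^sup>+s. (\<integral>\<^sup>+x\<in>{0<..}. ennreal x * \<phi> (Complex x (x * s)) \<partial>lborel) \<partial>lborel)"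
proof -
  have [measurable]: "(\<lambda>p::real\<times>real. Complex (fst p) (snd p)) \<in> borel_measurable borel"
    unfolding Complex_eq by (intro borel_measurable_continuous_onI continuous_intros)
  have mC[measurable]: "(\<lambda>p. Complex (f p) (h p)) \<in> borel_measurable M"
    if "f \<in> borel_measurable M" "h \<in> borel_measurable M" for f h and M :: "'z measure"
    using measurable_compose[OF borel_measurable_Pair[OF that], of "\<lambda>p::real\<times>real. Complex (fst p) (snd p)" borel]
    by simp
  have [measurable]: "{w. 0 < Re w} \<in> sets borel" by simp
  have "(\<integral>\<^sup>+w\<in>{w. 0 < Re w}. \<phi> w \<partial>lborel)
      = (\<integral>\<^sup>+p. \<phi> (Complex (fst p) (snd p)) * indicator {0<..} (fst p) \<partial>(lborel \<Otimes>\<^sub>M lborel))"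
    by (subst lborel_complex_eq, subst nn_integral_distr)
       (auto simp: case_prod_beta lborel_prod indicator_def intro!: nn_integral_cong)
  also have "\<dots> = (\<integral>\<^sup>+x. (\<integral>\<^sup>+y. \<phi> (Complex x y) * indicator {0<..} x \<partial>lborel) \<partial>lborel)"
    by (subst lborel.nn_integral_fst[symmetric]) auto
  also have "\<dots> = (\<integral>\<^sup>+x. (\<integral>\<^sup>+s. ennreal x * \<phi> (Complex x (x * s)) * indicator {0<..} x \<partial>lborel) \<partial>lborel)"
  proof (rule nn_integral_cong)
    fix x :: real
    show "(\<integral>\<^sup>+y. \<phi> (Complex x y) * indicator {0<..} x \<partial>lborel)
        = (\<integral>\<^sup>+s. ennreal x * \<phi> (Complex x (x * s)) * indicator {0<..} x \<partial>lborel)"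
    proof (cases "x > 0")
      case True
      then show ?thesis
        by (subst nn_integral_real_affine[where c=x and t=0]) (auto simp: nn_integral_cmult)
    qed simp
  qed
  also have "\<dots> = (\<integral>\<^sup>+s. (\<integral>\<^sup>+x. ennreal x * \<phi> (Complex x (x * s)) * indicator {0<..} x \<partial>lborel) \<partial>lborel)"
    by (rule lborel_pair.Fubini'[symmetric]) simp
  finally show ?thesis .
qed

text \<open>The antiderivative of \<open>1 / (1 + s\<^sup>2) ^ (n + 1)\<close> that vanishes at 0;
  the recursion is the reduction formula from integration by parts.\<close>

fun rational_primitive :: "nat \<Rightarrow> real \<Rightarrow> real" where
  "rational_primitive 0 s = arctan s"
| "rational_primitive (Suc n) s =
     s / ((2 * real n + 2) * (1 + s\<^sup>2) ^ Suc n) + (2 * real n + 1) / (2 * real n + 2) * rational_primitive n s"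

lemma DERIV_rational_primitive: "(rational_primitive n has_real_derivative 1 / (1 + s\<^sup>2) ^ Suc n) (at s)"
proof (induction n)
  case 0
  have "rational_primitive 0 = arctan" by auto
  then show ?case using DERIV_arctan[of s] by (simp add: field_simps)
next
  case (Suc n)
  have p: "1 + s\<^sup>2 > 0" by (simp add: add_pos_nonneg)
  have eq: "rational_primitive (Suc n) = (\<lambda>s. 1 / (2 * real n + 2) * (s / (1 + s\<^sup>2) ^ Suc n) + (2 * real n + 1) / (2 * real n + 2) * rational_primitive n s)"
    by (auto simp: fun_eq_iff)
  have "((\<lambda>s. s / (1 + s\<^sup>2) ^ Suc n) has_real_derivative
      (1 * (1 + s\<^sup>2) ^ Suc n - s * (real (Suc n) * (1 + s\<^sup>2) ^ n * (2 * s))) / ((1 + s\<^sup>2) ^ Suc n * (1 + s\<^sup>2) ^ Suc n)) (at s)"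
  proof (rule DERIV_divide)
    have "((\<lambda>s. 1 + s\<^sup>2) has_real_derivative 2 * s) (at s)" by (auto intro!: derivative_eq_intros)
    from DERIV_power[OF this, of "Suc n"]
    show "((\<lambda>s. (1 + s\<^sup>2) ^ Suc n) has_real_derivative real (Suc n) * (1 + s\<^sup>2) ^ n * (2 * s)) (at s)"
      by (simp add: mult_ac)
    show "(1 + s\<^sup>2) ^ Suc n \<noteq> 0" using p by simp
  qed (rule DERIV_ident)
  from DERIV_add[OF DERIV_cmult[OF this, of "1 / (2 * real n + 2)"] DERIV_cmult[OF Suc, of "(2 * real n + 1) / (2 * real n + 2)"]]
  have 1: "(rational_primitive (Suc n) has_real_derivative
      1 / (2 * real n + 2) * ((1 * (1 + s\<^sup>2) ^ Suc n - s * (real (Suc n) * (1 + s\<^sup>2) ^ n * (2 * s))) / ((1 + s\<^sup>2) ^ Suc n * (1 + s\<^sup>2) ^ Suc n))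
      + (2 * real n + 1) / (2 * real n + 2) * (1 / (1 + s\<^sup>2) ^ Suc n)) (at s)"
    unfolding eq by simp
  define q where "q = 1 + s\<^sup>2"
  have q: "q > 0" and s2: "s * s = q - 1" using p by (simp_all add: q_def power2_eq_square)
  have *: "1 / (2 * real n + 2) * ((1 * q ^ Suc n - s * (real (Suc n) * q ^ n * (2 * s))) / (q ^ Suc n * q ^ Suc n))
      + (2 * real n + 1) / (2 * real n + 2) * (1 / q ^ Suc n) = 1 / q ^ Suc (Suc n)"
  proof -
    have "1 * q ^ Suc n - s * (real (Suc n) * q ^ n * (2 * s)) = q ^ n * (q - 2 * (real n + 1) * (s * s))"
      by (simp add: algebra_simps)
    also have "\<dots> = q ^ n * (2 * (real n + 1) - (2 * real n + 1) * q)"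
      unfolding s2 by (simp add: algebra_simps)
    finally have e: "1 * q ^ Suc n - s * (real (Suc n) * q ^ n * (2 * s)) = q ^ n * (2 * (real n + 1) - (2 * real n + 1) * q)" .
    have "q ^ n * (2 * (real n + 1) - (2 * real n + 1) * q) / (q ^ Suc n * q ^ Suc n)
        = (2 * (real n + 1) - (2 * real n + 1) * q) / q ^ Suc (Suc n)"
      using q by (simp add: field_simps)
    moreover have "1 / a * ((a - b * q) / (q * (q * P))) + b / a * (1 / (q * P)) = 1 / (q * (q * P))"
      if "a > 0" "P > 0" for a b P :: real
      using that q by (simp add: field_simps)
    from this[of "2 * (real n + 1)" "q ^ n" "2 * real n + 1"]
    have "1 / (2 * (real n + 1)) * ((2 * (real n + 1) - (2 * real n + 1) * q) / q ^ Suc (Suc n))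
      + (2 * real n + 1) / (2 * (real n + 1)) * (1 / q ^ Suc n) = 1 / q ^ Suc (Suc n)"
      using q by simp
    ultimately show ?thesis unfolding e by simp
  qed
  show ?case using 1 unfolding *[unfolded q_def] .
qed

text \<open>The boundary term of the recursion dies at infinity, and the factors
  \<open>(2n + 1) / (2n + 2)\<close> multiply up, as in the Wallis product, to the central binomial
  coefficient over \<open>4 ^ n\<close>.\<close>

lemma tendsto_rational_primitive:
  "(rational_primitive n \<longlongrightarrow> pi / 2 * (fact (2 * n) / ((fact n)\<^sup>2 * 4 ^ n))) at_top"
proof (induction n)
  case 0
  have "rational_primitive 0 = arctan" by auto
  then show ?case using tendsto_arctan_at_top by simp
next
  case (Suc n)
  have "((\<lambda>s::real. s / (1 + s\<^sup>2) ^ Suc n) \<longlongrightarrow> 0) at_top"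
  proof (rule Lim_null_comparison)
    show "((\<lambda>s::real. 1 / s) \<longlongrightarrow> 0) at_top"
      by (rule tendsto_divide_0[OF tendsto_const filterlim_at_top_imp_at_infinity[OF filterlim_ident]])
    have "norm (s / (1 + s\<^sup>2) ^ Suc n) \<le> 1 / s" if "s \<ge> 1" for s :: real
    proof -
      have "1 \<le> (1 + s\<^sup>2) ^ n" by (simp add: one_le_power)
      then have "s * s \<le> (1 + s\<^sup>2) ^ Suc n"
        using mult_mono[of "s * s" "1 + s\<^sup>2" 1 "(1 + s\<^sup>2) ^ n"] by (simp add: power2_eq_square)
      then have "1 / s * (s * s) \<le> 1 / s * (1 + s\<^sup>2) ^ Suc n" using that by (intro mult_left_mono) auto
      then have "s \<le> 1 / s * (1 + s\<^sup>2) ^ Suc n" using that by simp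
      moreover have P: "0 < (1 + s\<^sup>2) ^ Suc n" by (intro zero_less_power) (simp add: add_pos_nonneg)
      ultimately have "s / (1 + s\<^sup>2) ^ Suc n \<le> 1 / s" by (intro mult_imp_div_pos_le)
      then show ?thesis using that P by (simp only: norm_divide real_norm_def abs_of_pos) simp
    qed
    then show "\<forall>\<^sub>F s in at_top. norm (s / (1 + s\<^sup>2) ^ Suc n) \<le> 1 / (s::real)"
      using eventually_ge_at_top[of "1::real"] by (rule eventually_mono[rotated])
  qed
  from tendsto_add[OF tendsto_mult[OF tendsto_const[of "1 / (2 * real n + 2)"] this] tendsto_mult[OF tendsto_const[of "(2 * real n + 1) / (2 * real n + 2)"] Suc]]
  have "((\<lambda>s. 1 / (2 * real n + 2) * (s / (1 + s\<^sup>2) ^ Suc n) + (2 * real n + 1) / (2 * real n + 2) * rational_primitive n s) \<longlongrightarrow>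
      (2 * real n + 1) / (2 * real n + 2) * (pi / 2 * (fact (2 * n) / ((fact n)\<^sup>2 * 4 ^ n)))) at_top"
    by simp
  moreover have "(\<lambda>s. 1 / (2 * real n + 2) * (s / (1 + s\<^sup>2) ^ Suc n) + (2 * real n + 1) / (2 * real n + 2) * rational_primitive n s)
      = rational_primitive (Suc n)" by (auto simp: fun_eq_iff)
  moreover have "(2 * real n + 1) / (2 * real n + 2) * (pi / 2 * (fact (2 * n) / ((fact n)\<^sup>2 * 4 ^ n)))
      = pi / 2 * (fact (2 * Suc n) / ((fact (Suc n))\<^sup>2 * 4 ^ Suc n))"
  proof -
    have "(fact (2 * Suc n) :: real) = (2 * (real n + 1)) * ((2 * real n + 1) * fact (2 * n))"
      by (simp add: algebra_simps)
    moreover have "((fact (Suc n))\<^sup>2 :: real) = (real n + 1)\<^sup>2 * (fact n)\<^sup>2"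
      by (simp add: power2_eq_square algebra_simps)
    moreover have "b / (2 * M) * (pi / 2 * (A / (B * P))) = pi / 2 * ((2 * M) * (b * A) / (M\<^sup>2 * B * (4 * P)))"
      if "M > 0" "B > 0" "P > 0" for A b M B P :: real
      using that by (simp add: field_simps power2_eq_square)
    from this[of "real n + 1" "(fact n)\<^sup>2" "4 ^ n" "2 * real n + 1" "fact (2 * n)"]
    have "(2 * real n + 1) / (2 * real n + 2) * (pi / 2 * (fact (2 * n) / ((fact n)\<^sup>2 * 4 ^ n))) =
      pi / 2 * ((2 * (real n + 1)) * ((2 * real n + 1) * fact (2 * n)) / ((real n + 1)\<^sup>2 * (fact n)\<^sup>2 * (4 * 4 ^ n)))"
      by simp
    ultimately show ?thesis by simp
  qed
  ultimately show ?case by simp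
qed

text \<open>The integral over the slope \<open>s\<close> that remains after radial integration:
  \<open>n = 1\<close> for the excess of the kernel, \<open>n = k + 1\<close> for the moments of a
  disc. The case \<open>n = 0\<close> also gives the mass of the Poisson kernel.\<close>

lemma nn_integral_rational:
  "(\<integral>\<^sup>+s. ennreal (1 / (1 + s\<^sup>2) ^ Suc n) \<partial>lborel) = ennreal (pi * (fact (2 * n) / ((fact n)\<^sup>2 * 4 ^ n)))"
proof -
  let ?f = "\<lambda>s::real. 1 / (1 + s\<^sup>2) ^ Suc n"
  let ?w = "pi / 2 * (fact (2 * n) / ((fact n)\<^sup>2 * 4 ^ n))"
  have "rational_primitive n 0 = 0" by (induction n) auto
  have h: "(\<integral>\<^sup>+s. ennreal (?f s) * indicator {0..} s \<partial>lborel) = ennreal ?w"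
    using nn_integral_FTC_atLeast[of ?f 0 "rational_primitive n", OF _ DERIV_rational_primitive _ tendsto_rational_primitive]
    by (simp add: \<open>rational_primitive n 0 = 0\<close> add_nonneg_nonneg del: power_Suc)
  have "(\<integral>\<^sup>+s. ennreal (?f s) * indicator {..0} s \<partial>lborel) = (\<integral>\<^sup>+s. ennreal (?f s) * indicator {0..} s \<partial>lborel)"
    by (subst nn_integral_real_affine[where c="-1" and t=0]) (auto simp: indicator_def intro!: nn_integral_cong)
  have "(\<integral>\<^sup>+s. ennreal (?f s) \<partial>lborel) = (\<integral>\<^sup>+s. ennreal (?f s) * indicator {0..} s + ennreal (?f s) * indicator {..0} s \<partial>lborel)"
  proof (rule nn_integral_cong_AE)
    have "AE s in lborel. s \<noteq> (0::real)" by (rule AE_lborel_singleton)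
    then show "AE s in lborel. ennreal (?f s) = ennreal (?f s) * indicator {0..} s + ennreal (?f s) * indicator {..0} s"
      by eventually_elim (auto simp: indicator_def)
  qed
  also have "\<dots> = ennreal ?w + ennreal ?w"
    using h \<open>(\<integral>\<^sup>+s. ennreal (?f s) * indicator {..0} s \<partial>lborel) = _\<close> by (subst nn_integral_add) auto
  also have "\<dots> = ennreal (pi * (fact (2 * n) / ((fact n)\<^sup>2 * 4 ^ n)))"
    by (subst ennreal_plus[symmetric]) (auto simp: field_simps)
  finally show ?thesis .
qed

text \<open>The disc \<open>\<bar>w - R\<bar> \<le> R\<close> is \<open>x \<le> 2 R / (1 + s\<^sup>2)\<close> in these coordinates.\<close>

lemma nn_integral_power_disc:
  fixes R :: real
  assumes R: "R > 0"
  shows "(\<integral>\<^sup>+w\<in>{w. 0 < Re w \<and> (norm w)\<^sup>2 \<le> 2 * R * Re w}. ennreal (norm w ^ (2 * k)) \<partial>lborel)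
    = ennreal ((2 * R) ^ (2 * k + 2) / (2 * k + 2) * (pi * (fact (2 * Suc k) / ((fact (Suc k))\<^sup>2 * 4 ^ Suc k))))"
proof -
  let ?D = "{w. (norm w)\<^sup>2 \<le> 2 * R * Re w}"
  have [measurable]: "?D \<in> sets borel" by simp
  have "(\<integral>\<^sup>+w\<in>{w. 0 < Re w \<and> (norm w)\<^sup>2 \<le> 2 * R * Re w}. ennreal (norm w ^ (2 * k)) \<partial>lborel)
      = (\<integral>\<^sup>+w\<in>{w. 0 < Re w}. (ennreal (norm w ^ (2 * k)) * indicator ?D w) \<partial>lborel)"
    by (intro nn_integral_cong) (auto simp: indicator_def)
  also have "\<dots> = (\<integral>\<^sup>+s. (\<integral>\<^sup>+x\<in>{0<..}. ennreal x * (ennreal (norm (Complex x (x * s)) ^ (2 * k)) * indicator ?D (Complex x (x * s))) \<partial>lborel) \<partial>lborel)"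
    by (rule nn_integral_half_plane) simp
  also have "\<dots> = (\<integral>\<^sup>+s. ennreal ((2 * R) ^ (2 * k + 2) / (2 * k + 2)) * ennreal (1 / (1 + s\<^sup>2) ^ Suc (Suc k)) \<partial>lborel)"
  proof (rule nn_integral_cong)
    fix s :: real
    define q where "q = 1 + s\<^sup>2"
    have q: "q > 0" by (simp add: q_def add_pos_nonneg)
    have n2: "(norm (Complex x (x * s)))\<^sup>2 = x\<^sup>2 * q" for x
      by (simp add: cmod_power2 q_def power_mult_distrib algebra_simps)
    have inD: "Complex x (x * s) \<in> ?D \<longleftrightarrow> x \<le> 2 * R / q" if "x > 0" for x
      using that q unfolding mem_Collect_eq n2 by (simp add: field_simps power2_eq_square)
    have nk: "norm (Complex x (x * s)) ^ (2 * k) = x ^ (2 * k) * q ^ k" for x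
      unfolding power_mult n2 by (simp add: power_mult_distrib)
    let ?F = "\<lambda>x::real. q ^ k / (2 * k + 2) * x ^ (2 * k + 2)"
    have X: "0 \<le> 2 * R / q" using R q by simp
    have "(\<integral>\<^sup>+x\<in>{0<..}. ennreal x * (ennreal (norm (Complex x (x * s)) ^ (2 * k)) * indicator ?D (Complex x (x * s))) \<partial>lborel)
        = (\<integral>\<^sup>+x. ennreal (x * (x ^ (2 * k) * q ^ k)) * indicator {0..2 * R / q} x \<partial>lborel)"
      unfolding nk using inD q
      by (intro nn_integral_cong) (auto simp: indicator_def ennreal_mult[symmetric])
    also have "\<dots> = ennreal (?F (2 * R / q) - ?F 0)"
    proof (rule nn_integral_FTC_Icc[OF _ _ _ X])
      show "(\<lambda>x. x * (x ^ (2 * k) * q ^ k)) \<in> borel_measurable borel" by simp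
      show "(?F has_real_derivative x * (x ^ (2 * k) * q ^ k)) (at x)" for x
      proof -
        have "((\<lambda>x. x ^ (2 * k + 2)) has_real_derivative real (2 * k + 2) * x ^ (2 * k + 1)) (at x)"
          using DERIV_pow[of "2 * k + 2" x] by simp
        from DERIV_cmult[OF this, of "q ^ k / (2 * real k + 2)"] show ?thesis
          by (simp add: ac_simps divide_simps)
      qed
      show "0 \<le> x * (x ^ (2 * k) * q ^ k)" if "x \<in> {0..2 * R / q}" for x using that q by simp
    qed
    also have "?F (2 * R / q) - ?F 0 = (2 * R) ^ (2 * k + 2) / (2 * k + 2) * (1 / q ^ Suc (Suc k))"
    proof -
      have "q ^ (2 * k + 2) = q ^ k * q ^ Suc (Suc k)" by (simp flip: power_add add: mult_2)
      then show ?thesis using q by (simp add: power_divide)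
    qed
    also have "ennreal \<dots> = ennreal ((2 * R) ^ (2 * k + 2) / (2 * k + 2)) * ennreal (1 / q ^ Suc (Suc k))"
      using R q by (intro ennreal_mult) auto
    finally show "(\<integral>\<^sup>+x\<in>{0<..}. ennreal x * (ennreal (norm (Complex x (x * s)) ^ (2 * k)) * indicator ?D (Complex x (x * s))) \<partial>lborel)
        = ennreal ((2 * R) ^ (2 * k + 2) / (2 * k + 2)) * ennreal (1 / (1 + s\<^sup>2) ^ Suc (Suc k))"
      unfolding q_def .
  qed
  also have "\<dots> = ennreal ((2 * R) ^ (2 * k + 2) / (2 * k + 2)) * ennreal (pi * (fact (2 * Suc k) / ((fact (Suc k))\<^sup>2 * 4 ^ Suc k)))"
    by (subst nn_integral_cmult) (simp_all only: nn_integral_rational, simp)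
  also have "\<dots> = ennreal ((2 * R) ^ (2 * k + 2) / (2 * k + 2) * (pi * (fact (2 * Suc k) / ((fact (Suc k))\<^sup>2 * 4 ^ Suc k))))"
    using R by (intro ennreal_mult[symmetric]) auto
  finally show ?thesis .
qed

text \<open>\<open>Re (1 / w)\<close> exceeds the level \<open>1 / (2 * R)\<close> exactly in the
  disc of radius \<open>R\<close> about \<open>R\<close>, and \<open>ennreal\<close> cuts off the
  rest. The value bounds the gain of \<open>Re (1 / w)\<close> over this level on any measurable
  set.\<close>

lemma nn_integral_inverse_excess:
  fixes R :: real
  assumes R: "R > 0"
  shows "(\<integral>\<^sup>+w. ennreal (Re (1 / w) - 1 / (2 * R)) \<partial>lborel) = ennreal (pi * R / 2)"
proof -
  have [measurable]: "(\<lambda>w::complex. ennreal (Re (1 / w) - 1 / (2 * R))) \<in> borel_measurable borel" by simp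
  have "(\<integral>\<^sup>+w. ennreal (Re (1 / w) - 1 / (2 * R)) \<partial>lborel)
      = (\<integral>\<^sup>+w\<in>{w. 0 < Re w}. ennreal (Re (1 / w) - 1 / (2 * R)) \<partial>lborel)"
  proof (intro nn_integral_cong)
    fix w :: complex
    show "ennreal (Re (1 / w) - 1 / (2 * R)) = ennreal (Re (1 / w) - 1 / (2 * R)) * indicator {w. 0 < Re w} w"
    proof (cases "0 < Re w")
      case False
      then have "Re (1 / w) \<le> 0" by (simp add: Re_divide divide_nonpos_nonneg)
      moreover have "0 \<le> 1 / (2 * R)" using R by simp
      ultimately have "Re (1 / w) - 1 / (2 * R) \<le> 0" by linarith
      then show ?thesis using False by (simp only: ennreal_neg) simp
    qed simp
  qed
  also have "\<dots> = (\<integral>\<^sup>+s. (\<integral>\<^sup>+x\<in>{0<..}. ennreal x * ennreal (Re (1 / Complex x (x * s)) - 1 / (2 * R)) \<partial>lborel) \<partial>lborel)"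
    by (rule nn_integral_half_plane) simp
  also have "\<dots> = (\<integral>\<^sup>+s. ennreal R * ennreal (1 / (1 + s\<^sup>2) ^ Suc 1) \<partial>lborel)"
  proof (rule nn_integral_cong)
    fix s :: real
    define q where "q = 1 + s\<^sup>2"
    have q: "q > 0" by (simp add: q_def add_pos_nonneg)
    have X: "0 \<le> 2 * R / q" using R q by simp
    have re: "Re (1 / Complex x (x * s)) = 1 / (x * q)" if "x > 0" for x
    proof -
      have "Re (1 / Complex x (x * s)) = x / (x\<^sup>2 + (x * s)\<^sup>2)" by (simp add: Re_divide)
      also have "x\<^sup>2 + (x * s)\<^sup>2 = x * (x * q)" by (simp add: q_def algebra_simps power2_eq_square)
      finally show ?thesis using that by simp
    qed
    let ?F = "\<lambda>x::real. x / q - x\<^sup>2 / (4 * R)"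
    \<comment> \<open>At \<open>x = 0\<close> the open and the closed range disagree; this null
      point is left out.\<close>
    have pt: "ennreal x * ennreal (Re (1 / Complex x (x * s)) - 1 / (2 * R)) * indicator {0<..} x
        = ennreal (1 / q - x / (2 * R)) * indicator {0..2 * R / q} x" if "x \<noteq> 0" for x
    proof (cases "x > 0")
      case True
      have "ennreal x * ennreal (1 / (x * q) - 1 / (2 * R)) = ennreal (x * (1 / (x * q) - 1 / (2 * R)))"
        using True by (simp add: ennreal_mult')
      also have "x * (1 / (x * q) - 1 / (2 * R)) = 1 / q - x / (2 * R)"
        using True by (simp add: right_diff_distrib)
      finally have "ennreal x * ennreal (1 / (x * q) - 1 / (2 * R)) = ennreal (1 / q - x / (2 * R))" .
      moreover have "1 / q - x / (2 * R) \<le> 0" if "\<not> x \<le> 2 * R / q"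
        using that q R by (simp add: field_simps)
      ultimately show ?thesis using True re[OF True] by (auto simp: indicator_def ennreal_neg)
    qed (use that in \<open>auto simp: indicator_def\<close>)
    have "(\<integral>\<^sup>+x\<in>{0<..}. ennreal x * ennreal (Re (1 / Complex x (x * s)) - 1 / (2 * R)) \<partial>lborel)
        = (\<integral>\<^sup>+x. ennreal (1 / q - x / (2 * R)) * indicator {0..2 * R / q} x \<partial>lborel)"
    proof (rule nn_integral_cong_AE)
      have "AE x in lborel. x \<noteq> (0::real)" by (rule AE_lborel_singleton)
      then show "AE x in lborel. ennreal x * ennreal (Re (1 / Complex x (x * s)) - 1 / (2 * R)) * indicator {0<..} x
        = ennreal (1 / q - x / (2 * R)) * indicator {0..2 * R / q} x"
        by eventually_elim (rule pt)
    qed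
    also have "\<dots> = ennreal (?F (2 * R / q) - ?F 0)"
    proof (rule nn_integral_FTC_Icc[OF _ _ _ X])
      show "(\<lambda>x. 1 / q - x / (2 * R)) \<in> borel_measurable borel" by simp
      show "(?F has_real_derivative 1 / q - x / (2 * R)) (at x)" for x
        using q R by (auto intro!: derivative_eq_intros simp: field_simps)
      show "0 \<le> 1 / q - x / (2 * R)" if "x \<in> {0..2 * R / q}" for x using that q R by (simp add: field_simps)
    qed
    also have "?F (2 * R / q) - ?F 0 = R * (1 / q ^ Suc 1)"
    proof -
      have "q \<noteq> 0" "R \<noteq> 0" using q R by auto
      then show ?thesis by (simp add: field_simps power2_eq_square)
    qed
    also have "ennreal \<dots> = ennreal R * ennreal (1 / q ^ Suc 1)"
      using R q by (intro ennreal_mult) auto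
    finally show "(\<integral>\<^sup>+x\<in>{0<..}. ennreal x * ennreal (Re (1 / Complex x (x * s)) - 1 / (2 * R)) \<partial>lborel)
        = ennreal R * ennreal (1 / (1 + s\<^sup>2) ^ Suc 1)" unfolding q_def .
  qed
  also have "\<dots> = ennreal R * ennreal (pi * (fact (2 * 1) / ((fact 1)\<^sup>2 * 4 ^ 1)))"
    by (subst nn_integral_cmult) (simp_all only: nn_integral_rational, simp)
  also have "\<dots> = ennreal (pi * R / 2)"
    using R by (subst ennreal_mult[symmetric]) (auto simp: field_simps)
  finally show ?thesis .
qed

section \<open>Cauchy transforms and sublevel sets in discs\<close>

text \<open>Inner regularity. Cauchy transforms are formed for compact sets, but a sublevel set of
  an upper semicontinuous function is in general only Borel.\<close>

lemma emeasure_lborel_le_if_compact: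
  fixes S :: "'a::euclidean_space set"
  assumes S: "S \<in> sets borel" "bounded S"
    and le: "\<And>T. compact T \<Longrightarrow> T \<subseteq> S \<Longrightarrow> emeasure lborel T \<le> c"
  shows "emeasure lborel S \<le> c"
proof (rule ennreal_le_epsilon)
  fix e :: real assume "0 < e"
  have "S \<in> sets lebesgue" using S by simp
  then obtain T where T: "closed T" "T \<subseteq> S" "emeasure lebesgue (S - T) < ennreal e"
    using sets_lebesgue_inner_closed[OF _ \<open>0 < e\<close>] by metis
  have "bounded T" using T S(2) bounded_subset by blast
  then have "compact T" using T(1) by (simp add: compact_eq_bounded_closed)
  have Tb: "T \<in> sets borel" using T(1) by simp
  have "emeasure lborel S \<le> emeasure lborel (T \<union> (S - T))"
    using S(1) T(2) Tb by (intro emeasure_mono) auto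
  also have "\<dots> \<le> emeasure lborel T + emeasure lborel (S - T)"
    using S(1) Tb by (intro emeasure_subadditive) auto
  also have "\<dots> \<le> c + ennreal e"
  proof (rule add_mono)
    show "emeasure lborel T \<le> c" by (rule le[OF \<open>compact T\<close> T(2)])
    have "emeasure lborel (S - T) = emeasure lebesgue (S - T)"
      using S(1) Tb by simp
    then show "emeasure lborel (S - T) \<le> ennreal e" using T(3) by simp
  qed
  finally show "emeasure lborel S \<le> c + ennreal e" .
qed

text \<open>A measure together with a map into the plane, so that area on a planar set and length on
  a real set carried by \<open>complex_of_real\<close> are one case. The sign of the kernel makes
  the value at \<open>0\<close> positive for sets of positive length on the positive axis.\<close>

definition cauchy_transform :: "'a measure \<Rightarrow> ('a \<Rightarrow> complex) \<Rightarrow> complex \<Rightarrow> complex" where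
  "cauchy_transform M h z = (\<integral>x. 1 / (h x - z) \<partial>M)"

locale cauchy_measure = finite_measure M for M :: "'a::euclidean_space measure" +
  fixes h :: "'a \<Rightarrow> complex" and E :: "complex set"
  assumes h_measurable[measurable]: "h \<in> borel_measurable M"
    and compact_E: "compact E"
    and h_in: "x \<in> space M \<Longrightarrow> h x \<in> E"
begin

lemma separation:
  assumes "z \<notin> E"
  obtains \<delta> where "\<delta> > 0" "\<And>x. x \<in> space M \<Longrightarrow> \<delta> \<le> norm (h x - z)"
proof -
  have "open (- E)" using compact_E by (simp add: compact_imp_closed open_Compl)
  then obtain \<delta> where \<delta>: "\<delta> > 0" "ball z \<delta> \<subseteq> - E" using assms by (meson ComplI open_contains_ball)
  have "\<delta> \<le> norm (h x - z)" if "x \<in> space M" for x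
  proof (rule ccontr)
    assume "\<not> \<delta> \<le> norm (h x - z)"
    then have "h x \<in> ball z \<delta>" by (simp add: dist_norm norm_minus_commute)
    then show False using h_in[OF that] \<delta>(2) by auto
  qed
  then show ?thesis using that \<delta>(1) by blast
qed

lemma norm_inverse_kernel_le:
  assumes "0 < \<delta>" "\<delta> \<le> norm (h x - z)"
  shows "norm (1 / (h x - z)) \<le> 1 / \<delta>"
proof -
  have "1 / norm (h x - z) \<le> 1 / \<delta>"
    using assms by (intro divide_left_mono mult_pos_pos) auto
  then show ?thesis by (simp add: norm_divide)
qed

lemma integrable_kernel:
  assumes "z \<notin> E"
  shows "integrable M (\<lambda>x. 1 / (h x - z))"
proof -
  obtain \<delta> where \<delta>: "\<delta> > 0" "\<And>x. x \<in> space M \<Longrightarrow> \<delta> \<le> norm (h x - z)"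
    using separation[OF assms] by blast
  show ?thesis
  proof (rule integrable_const_bound)
    show "AE x in M. norm (1 / (h x - z)) \<le> 1 / \<delta>"
      using \<delta> norm_inverse_kernel_le by (intro AE_I2) blast
  qed measurable
qed

text \<open>The difference quotient minus the expected derivative is the integral of
  \<open>(w - z) / ((h x - w) * (h x - z)\<^sup>2)\<close>, which is \<open>O(|w - z|)\<close> as
  long as \<open>w\<close> keeps half the distance of \<open>z\<close> from
  \<open>E\<close>.\<close>

lemma holomorphic_cauchy_transform: "cauchy_transform M h holomorphic_on - E"
proof -
  have "\<exists>D. (cauchy_transform M h has_field_derivative D) (at z)" if zE: "z \<notin> E" for z
  proof -
    obtain \<delta> where \<delta>: "\<delta> > 0" "\<And>x. x \<in> space M \<Longrightarrow> \<delta> \<le> norm (h x - z)"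
      using separation[OF zE] by blast
    define D where "D = (\<integral>x. 1 / (h x - z)\<^sup>2 \<partial>M)"
    have iD: "integrable M (\<lambda>x. 1 / (h x - z)\<^sup>2)"
    proof (rule integrable_const_bound)
      show "AE x in M. norm (1 / (h x - z)\<^sup>2) \<le> (1 / \<delta>)\<^sup>2"
      proof (rule AE_I2)
        fix x assume "x \<in> space M"
        then have "(norm (1 / (h x - z)))\<^sup>2 \<le> (1 / \<delta>)\<^sup>2"
          using \<delta> by (intro power_mono norm_inverse_kernel_le) auto
        then show "norm (1 / (h x - z)\<^sup>2) \<le> (1 / \<delta>)\<^sup>2" by (simp add: norm_divide norm_power power_divide)
      qed
    qed measurable
    \<comment> \<open>The distances \<open>\<delta> / 2\<close> from \<open>w\<close> and
      \<open>\<delta>\<close> from \<open>z\<close>, the latter squared, combine to the factor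
      \<open>2 / \<delta> ^ 3\<close>.\<close>
    define K where "K = 2 / \<delta> ^ 3 * measure M (space M)"
    have bound: "norm ((cauchy_transform M h w - cauchy_transform M h z) / (w - z) - D) \<le> K * norm (w - z)"
      if w: "w \<noteq> z" "norm (w - z) < \<delta> / 2" for w
    proof -
      have \<delta>w: "\<delta> / 2 \<le> norm (h x - w)" if "x \<in> space M" for x
      proof -
        have "norm (h x - z) \<le> norm (h x - w) + norm (w - z)"
          using norm_triangle_ineq[of "h x - w" "w - z"] by simp
        then show ?thesis using \<delta>(2)[OF that] w(2) by linarith
      qed
      have iw: "integrable M (\<lambda>x. 1 / (h x - w))"
      proof (rule integrable_const_bound)
        show "AE x in M. norm (1 / (h x - w)) \<le> 1 / (\<delta> / 2)"
          using \<delta>w \<delta>(1) norm_inverse_kernel_le[of "\<delta> / 2"] by (intro AE_I2) auto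
      qed measurable
      have iz: "integrable M (\<lambda>x. 1 / (h x - z))" by (rule integrable_kernel[OF zE])
      have "(cauchy_transform M h w - cauchy_transform M h z) / (w - z) - D
          = (\<integral>x. (1 / (h x - w) - 1 / (h x - z)) / (w - z) - 1 / (h x - z)\<^sup>2 \<partial>M)"
        unfolding cauchy_transform_def D_def using iw iz iD by simp
      also have "\<dots> = (\<integral>x. (w - z) / ((h x - w) * (h x - z)\<^sup>2) \<partial>M)"
      proof (rule Bochner_Integration.integral_cong[OF refl])
        fix x assume x: "x \<in> space M"
        have nz: "h x - w \<noteq> 0" "h x - z \<noteq> 0" using \<delta>w[OF x] \<delta>(2)[OF x] \<delta>(1) by auto
        have gen: "(1 / a - 1 / b) / (b - a) - 1 / b\<^sup>2 = (b - a) / (a * b\<^sup>2)"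
          if "a \<noteq> 0" "b \<noteq> 0" "b - a \<noteq> 0" for a b :: complex
        proof -
          have "1 / a - 1 / b = (b - a) / (a * b)" using that by (simp add: field_simps)
          then have "(1 / a - 1 / b) / (b - a) = 1 / (a * b)" using that by simp
          then show ?thesis using that by (simp add: field_simps power2_eq_square)
        qed
        show "(1 / (h x - w) - 1 / (h x - z)) / (w - z) - 1 / (h x - z)\<^sup>2
            = (w - z) / ((h x - w) * (h x - z)\<^sup>2)"
          using gen[OF nz] w(1) by simp
      qed
      also have "norm \<dots> \<le> (\<integral>x. 2 / \<delta> ^ 3 * norm (w - z) \<partial>M)"
      proof (rule Bochner_Integration.integral_norm_bound_integral)
        have pt: "norm ((w - z) / ((h x - w) * (h x - z)\<^sup>2)) \<le> 2 / \<delta> ^ 3 * norm (w - z)" if x: "x \<in> space M" for x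
        proof -
          have le: "\<delta> / 2 * \<delta>\<^sup>2 \<le> norm (h x - w) * (norm (h x - z))\<^sup>2"
            using \<delta>w[OF x] \<delta>(2)[OF x] \<delta>(1) by (intro mult_mono power_mono) auto
          have pos: "0 < \<delta> / 2 * \<delta>\<^sup>2" using \<delta>(1) by simp
          have "norm (w - z) / (norm (h x - w) * (norm (h x - z))\<^sup>2) \<le> norm (w - z) / (\<delta> / 2 * \<delta>\<^sup>2)"
            by (rule divide_left_mono[OF le norm_ge_zero mult_pos_pos[OF less_le_trans[OF pos le] pos]])
          also have "\<dots> = 2 / \<delta> ^ 3 * norm (w - z)"
            using \<delta>(1) by (simp add: power2_eq_square power3_eq_cube mult_ac)
          finally show ?thesis by (simp add: norm_divide norm_mult norm_power)
        qed
        show "integrable M (\<lambda>x. (w - z) / ((h x - w) * (h x - z)\<^sup>2))"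
          by (rule integrable_const_bound[OF AE_I2[OF pt]]) measurable
        show "integrable M (\<lambda>x. 2 / \<delta> ^ 3 * norm (w - z))" by simp
        show "\<And>x. x \<in> space M \<Longrightarrow> norm ((w - z) / ((h x - w) * (h x - z)\<^sup>2)) \<le> 2 / \<delta> ^ 3 * norm (w - z)" by (rule pt)
      qed
      also have "\<dots> = K * norm (w - z)" by (simp add: K_def)
      finally show ?thesis .
    qed
    have "((\<lambda>w. (cauchy_transform M h w - cauchy_transform M h z) / (w - z) - D) \<longlongrightarrow> 0) (at z)"
    proof (rule Lim_null_comparison)
      have "((\<lambda>w. K * norm (w - z)) \<longlongrightarrow> K * norm (z - z)) (at z)"
        by (intro tendsto_intros)
      then show "((\<lambda>w. K * norm (w - z)) \<longlongrightarrow> 0) (at z)" by simp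
      show "\<forall>\<^sub>F w in at z. norm ((cauchy_transform M h w - cauchy_transform M h z) / (w - z) - D) \<le> K * norm (w - z)"
        unfolding eventually_at using bound \<delta>(1)
        by (intro exI[of _ "\<delta> / 2"]) (auto simp: dist_norm)
    qed
    then have "(cauchy_transform M h has_field_derivative D) (at z)"
      unfolding has_field_derivative_iff by (rule LIM_zero_cancel)
    then show ?thesis ..
  qed
  then have "\<exists>D. (cauchy_transform M h has_field_derivative D) (at z within - E)" if "z \<in> - E" for z
    using that has_field_derivative_at_within by blast
  then show ?thesis
    unfolding holomorphic_on_def field_differentiable_def by blast
qed

text \<open>Outside twice the radius of \<open>E\<close> every point of \<open>E\<close> is at
  distance at least \<open>norm z / 2\<close>. This is the decay that the two-constant principle
  asks of \<open>F\<close>.\<close>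

lemma cauchy_transform_decay:
  assumes "E \<subseteq> cball 0 \<rho>" "2 * \<rho> \<le> norm z" "z \<notin> E"
  shows "norm z * norm (cauchy_transform M h z) \<le> 2 * measure M (space M)"
proof (cases "z = 0")
  case False
  have "norm (cauchy_transform M h z) \<le> (\<integral>x. 1 / (norm z / 2) \<partial>M)"
    unfolding cauchy_transform_def
  proof (rule Bochner_Integration.integral_norm_bound_integral)
    show "integrable M (\<lambda>x. 1 / (h x - z))" by (rule integrable_kernel[OF assms(3)])
    fix x assume "x \<in> space M"
    then have "h x \<in> cball 0 \<rho>" using h_in[of x] assms(1) by blast
    then have "norm (h x) \<le> \<rho>" by simp
    moreover have "norm z \<le> norm (h x - z) + norm (h x)"
      using norm_triangle_ineq[of "z - h x" "h x"] by (simp add: norm_minus_commute)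
    ultimately have "norm z / 2 \<le> norm (h x - z)" using assms(2) by linarith
    then show "norm (1 / (h x - z)) \<le> 1 / (norm z / 2)"
      using False by (intro norm_inverse_kernel_le) auto
  qed simp
  also have "\<dots> = 2 / norm z * measure M (space M)" by simp
  finally show ?thesis using False by (simp add: field_simps)
qed simp

lemma Re_mult_cauchy_transform:
  assumes "z \<notin> E"
  shows "Re (\<alpha> * cauchy_transform M h z) = (\<integral>x. Re (\<alpha> / (h x - z)) \<partial>M)"
    and "integrable M (\<lambda>x. Re (\<alpha> / (h x - z)))"
proof -
  have i: "integrable M (\<lambda>x. \<alpha> * (1 / (h x - z)))"
    using integrable_kernel[OF assms] by (rule integrable_mult_right)
  have "\<alpha> * cauchy_transform M h z = (\<integral>x. \<alpha> * (1 / (h x - z)) \<partial>M)"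
    unfolding cauchy_transform_def by (rule integral_mult_right_zero[symmetric])
  then show "Re (\<alpha> * cauchy_transform M h z) = (\<integral>x. Re (\<alpha> / (h x - z)) \<partial>M)"
    using integral_Re[OF i] by simp
  show "integrable M (\<lambda>x. Re (\<alpha> / (h x - z)))" using integrable_Re[OF i] by simp
qed

end

section \<open>Area measure, and sublevel sets in a disc with the base point on its boundary\<close>

lemma cauchy_measure_plane:
  assumes "compact E"
  shows "cauchy_measure (restrict_space lborel E) (\<lambda>w. w) E"
proof -
  have E: "E \<in> sets borel" using assms by (simp add: compact_imp_closed)
  have fin: "emeasure lborel E < \<infinity>" using assms by (rule emeasure_compact_finite)
  have "finite_measure (restrict_space lborel E)"
    using E fin by (intro finite_measureI) (simp add: space_restrict_space emeasure_restrict_space)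
  moreover have "(\<lambda>w. w) \<in> borel_measurable (restrict_space lborel E)"
    by (intro measurable_restrict_space1) simp
  ultimately show ?thesis
    using assms by (auto simp: cauchy_measure_def cauchy_measure_axioms_def space_restrict_space)
qed

text \<open>Ahlfors--Beurling: rotate the value to be positive and compare \<open>E\<close> with the disc
  \<open>{Re (1/w) > 1/(2R)}\<close> of the same area.\<close>

lemma norm_cauchy_transform_plane:
  assumes E: "compact E" and z: "z \<notin> E" and m: "measure lborel E > 0"
  shows "norm (cauchy_transform (restrict_space lborel E) (\<lambda>w. w) z) \<le> sqrt (pi * measure lborel E)"
proof -
  let ?M = "restrict_space lborel E"
  let ?f = "cauchy_transform ?M (\<lambda>w. w) z"
  interpret cauchy_measure ?M "\<lambda>w. w" E by (rule cauchy_measure_plane[OF E])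
  have Eb: "E \<in> sets borel" using E by (simp add: compact_imp_closed)
  have mM: "measure ?M (space ?M) = measure lborel E"
    using Eb by (simp add: measure_restrict_space space_restrict_space)
  \<comment> \<open>The radius of the disc with the area of \<open>E\<close>; \<open>c\<close> is
    then the value of \<open>Re (1 / w)\<close> on its boundary circle when that disc is centred at
    \<open>R\<close>.\<close>
  define R where "R = sqrt (measure lborel E / pi)"
  have R: "R > 0" "measure lborel E = pi * R\<^sup>2" using m by (simp_all add: R_def)
  define c where "c = 1 / (2 * R)"
  show ?thesis
  proof (cases "?f = 0")
    case False
    define \<alpha> where "\<alpha> = cnj (sgn ?f)"
    have \<alpha>: "norm \<alpha> = 1" using False by (simp add: \<alpha>_def norm_sgn)
    have \<alpha>0: "\<alpha> \<noteq> 0" using \<alpha> by auto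
    have "\<alpha> * ?f = of_real (norm ?f)"
      using False complex_norm_square[of ?f] by (simp add: \<alpha>_def sgn_eq field_simps power2_eq_square)
    then have "norm ?f = Re (\<alpha> * ?f)" by simp
    also have "\<dots> = (\<integral>x. Re (\<alpha> / (x - z)) \<partial>?M)" by (rule Re_mult_cauchy_transform(1)[OF z])
    \<comment> \<open>Bathtub principle: what exceeds the level \<open>c\<close> on \<open>E\<close>
      is at most the excess over the whole plane, \<open>pi * R / 2\<close>, and the level itself
      contributes \<open>c * pi * R\<^sup>2 = pi * R / 2\<close>.\<close>
    also have "\<dots> = (\<integral>x. Re (\<alpha> / (x - z)) - c \<partial>?M) + c * measure lborel E"
      using Re_mult_cauchy_transform(2)[OF z, of \<alpha>] mM by simp
    also have "(\<integral>x. Re (\<alpha> / (x - z)) - c \<partial>?M) \<le> pi * R / 2"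
    proof (rule integral_real_bounded)
      have "(\<integral>\<^sup>+x. ennreal (Re (\<alpha> / (x - z)) - c) \<partial>?M) \<le> (\<integral>\<^sup>+x. ennreal (Re (\<alpha> / (x - z)) - c) \<partial>lborel)"
        using Eb by (subst nn_integral_restrict_space) (auto intro!: nn_integral_mono simp: indicator_def)
      also have "\<dots> = (\<integral>\<^sup>+x. ennreal (Re (\<alpha> / (z + x - z)) - c) \<partial>lborel)"
        by (rule nn_integral_lborel_shift[symmetric]) simp
      also have "\<dots> = (\<integral>\<^sup>+x. ennreal (Re (\<alpha> / x) - c) \<partial>lborel)" by simp
      \<comment> \<open>Multiplication by the unimodular \<open>\<alpha>\<close> is a similarity
        with factor 1, so the phase is absorbed by a rotation of the plane.\<close>
      also have "\<dots> = ennreal (1 ^ DIM(complex)) * (\<integral>\<^sup>+x. ennreal (Re (\<alpha> / (\<alpha> * x)) - c) \<partial>lborel)"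
      proof (rule nn_integral_lborel_similarity)
        show "linear ((*) \<alpha>)" by (rule bounded_linear.linear[OF bounded_linear_mult_right])
      qed (simp_all add: norm_mult \<alpha>)
      also have "\<dots> = (\<integral>\<^sup>+x. ennreal (Re (1 / x) - 1 / (2 * R)) \<partial>lborel)"
        using \<alpha>0 by (simp add: c_def)
      also have "\<dots> = ennreal (pi * R / 2)" by (rule nn_integral_inverse_excess[OF R(1)])
      finally show "(\<integral>\<^sup>+x. ennreal (Re (\<alpha> / (x - z)) - c) \<partial>?M) \<le> ennreal (pi * R / 2)" .
    qed (use R in simp)
    finally have "norm ?f \<le> pi * R / 2 + c * measure lborel E" by simp
    also have "\<dots> = pi * R" using R(1) unfolding R(2) by (simp add: c_def power2_eq_square)
    also have "\<dots> = sqrt ((pi * R)\<^sup>2)" using R(1) by simp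
    also have "(pi * R)\<^sup>2 = pi * measure lborel E" unfolding R(2) by (simp add: power2_eq_square)
    finally show ?thesis .
  qed (use m in simp)
qed

text \<open>Because \<open>0\<close> lies on the boundary of the disc,
  \<open>Re (c / w) \<ge> 1/2\<close> on \<open>E\<close>, hence
  \<open>m / 2 \<le> |c| * |f 0|\<close> for its area \<open>m\<close>. The normalised transform has
  modulus at most \<open>exp (-t)\<close> at \<open>0\<close>; squaring
  \<open>m / 2 \<le> |c| * sqrt (pi * m) * exp (-t)\<close> and cancelling \<open>m\<close> gives
  the claim, which is \<open>4 * exp (-2 * t)\<close> relative to the area of the disc.\<close>

lemma subharmonic_disc_sublevel_compact:
  fixes v :: "complex \<Rightarrow> ereal"
  assumes sub: "subharmonic_on UNIV v" and bd: "\<And>z. v z \<le> ereal (C + log_plus (norm z))"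
    and v0: "v 0 = ereal m0" and t: "t > 0"
    and E: "compact E" "E \<subseteq> {\<zeta>\<in>cball c (norm c). v \<zeta> \<le> ereal (m0 - t)}"
  shows "measure lborel E \<le> 4 * pi * (norm c)\<^sup>2 * exp (- 2 * t)"
proof (cases "measure lborel E > 0")
  case m: True
  let ?M = "restrict_space lborel E"
  let ?f = "cauchy_transform ?M (\<lambda>w. w)"
  interpret cauchy_measure ?M "\<lambda>w. w" E by (rule cauchy_measure_plane[OF E(1)])
  have Eb: "E \<in> sets borel" using E by (simp add: compact_imp_closed)
  define m where "m = measure lborel E"
  have m0: "m > 0" using m by (simp add: m_def)
  have mM: "measure ?M (space ?M) = m" using Eb by (simp add: m_def measure_restrict_space space_restrict_space)
  have z0: "0 \<notin> E" using E(2) t by (auto simp: v0)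
  have low: "m / 2 \<le> norm c * norm (?f 0)"
  proof -
    have "m / 2 = (\<integral>x. 1/2 \<partial>?M)" by (simp add: mM)
    also have "\<dots> \<le> (\<integral>x. Re (c / (x - 0)) \<partial>?M)"
    proof (rule integral_mono)
      show "integrable ?M (\<lambda>x. Re (c / (x - 0)))" by (rule Re_mult_cauchy_transform(2)[OF z0])
      fix x assume "x \<in> space ?M"
      then have x: "x \<in> E" by (simp add: space_restrict_space)
      then have "x \<noteq> 0" "norm (c - x) \<le> norm c" using z0 E(2) by (auto simp: dist_norm)
      \<comment> \<open>Expanded, this is \<open>|x|\<^sup>2 \<le> 2 * Re (c * cnj x)\<close>;
        division by \<open>|x|\<^sup>2\<close> gives \<open>Re (c / x) \<ge> 1/2\<close>.\<close>
      then have "(norm (c - x))\<^sup>2 \<le> (norm c)\<^sup>2" by (intro power_mono) auto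
      then have "(norm x)\<^sup>2 \<le> 2 * (Re c * Re x + Im c * Im x)"
        by (simp add: cmod_power2 power2_diff)
      moreover have "(norm x)\<^sup>2 > 0" using \<open>x \<noteq> 0\<close> by simp
      ultimately have "1 / 2 \<le> (Re c * Re x + Im c * Im x) / (norm x)\<^sup>2"
        by (simp only: pos_le_divide_eq) simp
      then show "1 / 2 \<le> Re (c / (x - 0))"
        by (simp add: Re_divide cmod_power2)
    qed simp
    also have "\<dots> = Re (c * ?f 0)" by (rule Re_mult_cauchy_transform(1)[OF z0, symmetric])
    also have "\<dots> \<le> norm (c * ?f 0)" by (rule complex_Re_le_cmod)
    finally show ?thesis by (simp add: norm_mult)
  qed
  then have f0: "?f 0 \<noteq> 0" using m0 by auto
  define k where "k = sqrt (pi * m)"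
  have k: "k > 0" using m0 by (simp add: k_def)
  define F where "F z = ?f z / of_real k" for z
  have F0: "F 0 \<noteq> 0" using f0 k by (auto simp: F_def)
  obtain \<rho> where \<rho>: "E \<subseteq> cball 0 \<rho>"
    using compact_imp_bounded[OF E(1)] by (auto simp: bounded_iff subset_iff)
  have "v 0 \<le> ereal (m0 - t - ln (norm (F 0)))"
  proof (rule subharmonic_two_constants[OF sub bd E(1)])
    show "v z \<le> ereal (m0 - t)" if "z \<in> E" for z using that E(2) by auto
    show "F holomorphic_on - E" unfolding F_def using k
      by (intro holomorphic_intros holomorphic_cauchy_transform) auto
    show "norm (F z) \<le> 1" if "z \<notin> E" for z
      using norm_cauchy_transform_plane[OF E(1) that m] k by (simp add: F_def norm_divide k_def m_def)
    show "norm z * norm (F z) \<le> 2 * m / k" if "z \<notin> E" "2 * \<rho> \<le> norm z" for z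
      using cauchy_transform_decay[OF \<rho> that(2,1)] k mM by (simp add: F_def norm_divide divide_right_mono)
  qed (use z0 F0 in auto)
  then have "ln (norm (F 0)) \<le> - t" by (simp add: v0)
  moreover have "norm (F 0) > 0" using F0 by simp
  ultimately have "norm (F 0) \<le> exp (- t)" by (metis exp_le_cancel_iff exp_ln)
  then have "norm (?f 0) \<le> k * exp (- t)" using k by (simp add: F_def norm_divide field_simps)
  then have "norm c * norm (?f 0) \<le> norm c * (k * exp (- t))" by (rule mult_left_mono) simp
  then have "m / 2 \<le> norm c * (k * exp (- t))" using low by linarith
  then have "(m / 2)\<^sup>2 \<le> (norm c * (k * exp (- t)))\<^sup>2" using m0 by (intro power_mono) auto
  also have "\<dots> = (norm c)\<^sup>2 * (k\<^sup>2 * (exp (- t))\<^sup>2)" by (simp add: power_mult_distrib)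
  also have "k\<^sup>2 = pi * m" using m0 by (simp add: k_def)
  also have "(exp (- t))\<^sup>2 = exp (- 2 * t)" by (simp add: power2_eq_square flip: exp_add)
  finally have "m * m \<le> m * (4 * pi * (norm c)\<^sup>2 * exp (- 2 * t))" by (simp add: power2_eq_square field_simps)
  then show ?thesis using m0 by (simp add: m_def)
next
  case False
  then have "measure lborel E = 0" using measure_nonneg[of lborel E] by linarith
  then show ?thesis by simp
qed

lemma subharmonic_disc_sublevel:
  fixes v :: "complex \<Rightarrow> ereal"
  assumes sub: "subharmonic_on UNIV v" and bd: "\<And>z. v z \<le> ereal (C + log_plus (norm z))"
    and v0: "v 0 = ereal m0" and t: "t > 0"
  shows "emeasure lborel {\<zeta>\<in>cball c (norm c). v \<zeta> \<le> ereal (m0 - t)}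
    \<le> ennreal (4 * pi * (norm c)\<^sup>2 * exp (- 2 * t))"
proof (rule emeasure_lborel_le_if_compact)
  have [measurable]: "v \<in> borel_measurable borel"
    using sub by (auto simp: subharmonic_on_def intro: usc_borel_measurable)
  show "{\<zeta>\<in>cball c (norm c). v \<zeta> \<le> ereal (m0 - t)} \<in> sets borel" by measurable
  show "bounded {\<zeta>\<in>cball c (norm c). v \<zeta> \<le> ereal (m0 - t)}"
    by (rule bounded_subset[OF bounded_cball]) auto
  fix E assume E: "compact E" "E \<subseteq> {\<zeta>\<in>cball c (norm c). v \<zeta> \<le> ereal (m0 - t)}"
  have "emeasure lborel E = ennreal (measure lborel E)"
    using emeasure_compact_finite[OF E(1)] by (intro emeasure_eq_ennreal_measure) auto
  then show "emeasure lborel E \<le> ennreal (4 * pi * (norm c)\<^sup>2 * exp (- 2 * t))"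
    using subharmonic_disc_sublevel_compact[OF sub bd v0 t E] by (simp add: ennreal_leI)
qed

section \<open>Sublevel sets in segments\<close>

lemma measure_space_restrict_lborel:
  "E \<in> sets borel \<Longrightarrow> measure (restrict_space lborel E) (space (restrict_space lborel E)) = measure lborel E"
  by (simp add: measure_restrict_space space_restrict_space)

lemma cauchy_measure_line:
  fixes E :: "real set"
  assumes "compact E"
  shows "cauchy_measure (restrict_space lborel E) complex_of_real (complex_of_real ` E)"
proof -
  have E: "E \<in> sets borel" using assms by (simp add: compact_imp_closed)
  have fin: "emeasure lborel E < \<infinity>" using assms by (rule emeasure_compact_finite)
  have "finite_measure (restrict_space lborel E)"
    using E fin by (intro finite_measureI) (simp add: space_restrict_space emeasure_restrict_space)
  moreover have "complex_of_real \<in> borel_measurable (restrict_space lborel E)"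
    by (intro measurable_restrict_space1) simp
  moreover have "compact (complex_of_real ` E)"
    using assms by (intro compact_continuous_image continuous_intros)
  ultimately show ?thesis
    by (auto simp: cauchy_measure_def cauchy_measure_axioms_def space_restrict_space)
qed

lemma nn_integral_poisson_kernel:
  assumes "b \<noteq> 0"
  shows "(\<integral>\<^sup>+x. ennreal \<bar>b / ((x - a)\<^sup>2 + b\<^sup>2)\<bar> \<partial>lborel) = ennreal pi"
proof -
  have "(\<integral>\<^sup>+x. ennreal \<bar>b / ((x - a)\<^sup>2 + b\<^sup>2)\<bar> \<partial>lborel)
      = ennreal \<bar>b\<bar> * (\<integral>\<^sup>+s. ennreal \<bar>b / ((a + b * s - a)\<^sup>2 + b\<^sup>2)\<bar> \<partial>lborel)"
    by (rule nn_integral_real_affine) (use assms in simp_all)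
  also have "\<dots> = (\<integral>\<^sup>+s. ennreal \<bar>b\<bar> * ennreal \<bar>b / ((a + b * s - a)\<^sup>2 + b\<^sup>2)\<bar> \<partial>lborel)"
    by (rule nn_integral_cmult[symmetric]) simp
  also have "\<dots> = (\<integral>\<^sup>+s. ennreal (1 / (1 + s\<^sup>2) ^ Suc 0) \<partial>lborel)"
  proof (rule nn_integral_cong)
    fix s :: real
    have "(a + b * s - a)\<^sup>2 + b\<^sup>2 = b\<^sup>2 * (1 + s\<^sup>2)" by (simp add: power2_eq_square algebra_simps)
    then have "\<bar>b\<bar> * \<bar>b / ((a + b * s - a)\<^sup>2 + b\<^sup>2)\<bar> = \<bar>b * b / (b\<^sup>2 * (1 + s\<^sup>2))\<bar>"
      by (simp add: abs_mult)
    also have "b * b / (b\<^sup>2 * (1 + s\<^sup>2)) = 1 / (1 + s\<^sup>2)"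
      using assms by (simp add: power2_eq_square)
    also have "\<bar>1 / (1 + s\<^sup>2)\<bar> = 1 / (1 + s\<^sup>2) ^ Suc 0" by (simp add: add_nonneg_nonneg)
    finally show "ennreal \<bar>b\<bar> * ennreal \<bar>b / ((a + b * s - a)\<^sup>2 + b\<^sup>2)\<bar> = ennreal (1 / (1 + s\<^sup>2) ^ Suc 0)"
      by (simp flip: ennreal_mult)
  qed
  also have "\<dots> = ennreal pi" unfolding nn_integral_rational by simp
  finally show ?thesis .
qed

text \<open>Up to the factor \<open>1 / pi\<close>, the Poisson kernel of the half plane. Rotation
  by \<open>- \<i>\<close> turns the imaginary part into a real part, the form in which
  \<open>Re_mult_cauchy_transform\<close> is available.\<close>

lemma Im_inverse_kernel: "Re (- \<i> / (complex_of_real x - z)) = Im z / ((x - Re z)\<^sup>2 + (Im z)\<^sup>2)"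
  unfolding Re_divide by (simp add: power2_commute)

text \<open>Off the real axis the imaginary part is an integral of the Poisson kernel over
  \<open>E\<close>, and the whole line gives only \<open>pi\<close> in absolute value; on the axis
  the kernel vanishes. So the transform takes values in the strip on which \<open>strip_map\<close>
  is bounded by 1.\<close>

lemma Im_cauchy_transform_line:
  fixes E :: "real set"
  assumes E: "compact E" and z: "z \<notin> complex_of_real ` E"
  shows "\<bar>Im (cauchy_transform (restrict_space lborel E) complex_of_real z)\<bar> \<le> pi"
proof -
  let ?M = "restrict_space lborel E"
  interpret cauchy_measure ?M complex_of_real "complex_of_real ` E" by (rule cauchy_measure_line[OF E])
  have Eb: "E \<in> sets borel" using E by (simp add: compact_imp_closed)
  have "Im (cauchy_transform ?M complex_of_real z) = (\<integral>x. Im z / ((x - Re z)\<^sup>2 + (Im z)\<^sup>2) \<partial>?M)"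
    using Re_mult_cauchy_transform(1)[OF z, of "- \<i>"] unfolding Im_inverse_kernel by simp
  then have "\<bar>Im (cauchy_transform ?M complex_of_real z)\<bar> \<le> (\<integral>x. \<bar>Im z / ((x - Re z)\<^sup>2 + (Im z)\<^sup>2)\<bar> \<partial>?M)"
    by (simp only: integral_abs_bound)
  also have "\<dots> \<le> pi"
  proof (rule integral_real_bounded)
    show "(\<integral>\<^sup>+x. ennreal \<bar>Im z / ((x - Re z)\<^sup>2 + (Im z)\<^sup>2)\<bar> \<partial>?M) \<le> ennreal pi"
    proof (cases "Im z = 0")
      case False
      have "(\<integral>\<^sup>+x. ennreal \<bar>Im z / ((x - Re z)\<^sup>2 + (Im z)\<^sup>2)\<bar> \<partial>?M)
          \<le> (\<integral>\<^sup>+x. ennreal \<bar>Im z / ((x - Re z)\<^sup>2 + (Im z)\<^sup>2)\<bar> \<partial>lborel)"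
        using Eb by (subst nn_integral_restrict_space) (auto intro!: nn_integral_mono simp: indicator_def)
      also have "\<dots> = ennreal pi" by (rule nn_integral_poisson_kernel[OF False])
      finally show ?thesis .
    qed simp
  qed simp
  finally show ?thesis .
qed

text \<open>\<open>tanh (w / 4)\<close>, which maps the strip \<open>\<bar>Im w\<bar> \<le> \<pi>\<close> into the closed unit disc.\<close>

definition strip_map :: "complex \<Rightarrow> complex" where
  "strip_map w = (exp (w / 2) - 1) / (exp (w / 2) + 1)"

text \<open>On the strip \<open>e = exp (w / 2)\<close> lies in the closed right half plane, where
  \<open>|e - 1| \<le> |e + 1|\<close> and \<open>|e + 1| \<ge> 1\<close>. The third bound carries
  decay at infinity over from the transform to its image.\<close>

lemma strip_map_bounds:
  assumes "\<bar>Im w\<bar> \<le> pi"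
  shows "exp (w / 2) + 1 \<noteq> 0" "norm (strip_map w) \<le> 1" "norm (strip_map w) \<le> norm (exp (w / 2) - 1)"
proof -
  define e where "e = exp (w / 2)"
  have "0 \<le> cos (Im (w / 2))" using assms by (intro cos_ge_zero) auto
  then have re: "0 \<le> Re e" unfolding e_def Re_exp by simp
  have n1: "1 \<le> norm (e + 1)" using complex_Re_le_cmod[of "e + 1"] re by simp
  then show "exp (w / 2) + 1 \<noteq> 0" unfolding e_def by auto
  have "(norm (e - 1))\<^sup>2 \<le> (norm (e + 1))\<^sup>2"
    unfolding cmod_power2 using re by (simp add: power2_eq_square algebra_simps)
  then have "norm (e - 1) \<le> norm (e + 1)" by (rule power2_le_imp_le) simp
  then show "norm (strip_map w) \<le> 1"
    unfolding strip_map_def e_def[symmetric] norm_divide using n1 by (simp add: divide_le_eq_1)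
  have "norm (e - 1) / norm (e + 1) \<le> norm (e - 1) / 1"
    using n1 by (intro divide_left_mono) auto
  then show "norm (strip_map w) \<le> norm (exp (w / 2) - 1)"
    unfolding strip_map_def e_def[symmetric] norm_divide by simp
qed

text \<open>The two-constant principle with \<open>F = tanh (f / 4)\<close>. It is kept for a
  general point because it serves at \<open>0\<close> to bound lengths and at \<open>\<i>\<close> to
  leave the real line.\<close>

lemma subharmonic_le_of_line_set:
  fixes v :: "complex \<Rightarrow> ereal" and E :: "real set"
  assumes sub: "subharmonic_on UNIV v" and bd: "\<And>z. v z \<le> ereal (C + log_plus (norm z))"
    and E: "compact E" and s: "\<And>x. x \<in> E \<Longrightarrow> v (of_real x) \<le> ereal s"
    and z: "z \<notin> complex_of_real ` E"
    and nz: "strip_map (cauchy_transform (restrict_space lborel E) complex_of_real z) \<noteq> 0"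
  shows "v z \<le> ereal (s - ln (norm (strip_map (cauchy_transform (restrict_space lborel E) complex_of_real z))))"
proof -
  let ?M = "restrict_space lborel E"
  let ?E = "complex_of_real ` E"
  let ?f = "cauchy_transform ?M complex_of_real"
  interpret cauchy_measure ?M complex_of_real ?E by (rule cauchy_measure_line[OF E])
  define m where "m = measure ?M (space ?M)"
  have m: "m \<ge> 0" by (simp add: m_def)
  obtain \<rho> where "\<forall>w\<in>?E. norm w \<le> \<rho>"
    using compact_imp_bounded[OF compact_E] unfolding bounded_iff by blast
  then have \<rho>: "?E \<subseteq> cball 0 \<rho>" by auto
  note Im = Im_cauchy_transform_line[OF E]
  define F where "F w = strip_map (?f w)" for w
  have "v z \<le> ereal (s - ln (norm (F z)))"
  proof (rule subharmonic_two_constants[OF sub bd compact_E])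
    show "v w \<le> ereal s" if "w \<in> ?E" for w using s that by auto
    show "F holomorphic_on - ?E"
      unfolding F_def strip_map_def using strip_map_bounds(1)[OF Im]
      by (intro holomorphic_intros holomorphic_cauchy_transform) auto
    show "norm (F w) \<le> 1" if "w \<notin> ?E" for w
      unfolding F_def by (rule strip_map_bounds(2)[OF Im[OF that]])
    \<comment> \<open>\<open>2 * \<rho>\<close> gives the decay of the transform;
      \<open>2 * m + 1\<close> makes it at most 1 in modulus, the range where
      \<open>exp (f / 2) - 1\<close> is controlled linearly by \<open>f\<close>.\<close>
    show "norm w * norm (F w) \<le> 2 * m" if w: "w \<notin> ?E" "max (2 * \<rho>) (2 * m + 1) \<le> norm w" for w
    proof -
      have dec: "norm w * norm (?f w) \<le> 2 * m"
        unfolding m_def by (rule cauchy_transform_decay[OF \<rho> _ w(1)]) (use w(2) in simp)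
      have w1: "norm w \<ge> 2 * m + 1" "norm w > 0" using w(2) m by auto
      have "norm w * norm (?f w) \<le> norm w * 1" using dec w1 by linarith
      then have "norm (?f w) \<le> 1" using mult_le_cancel_left_pos[OF w1(2), of "norm (?f w)" 1] by blast
      then have "norm (?f w / 2) \<le> 1 / 2" by (simp add: norm_divide)
      then have "norm (exp (?f w / 2) - 1) \<le> 3 / 2 * norm (?f w / 2)" by (rule norm_exp_bounds(2))
      also have "\<dots> \<le> norm (?f w)" by (simp add: norm_divide)
      finally have "norm (strip_map (?f w)) \<le> norm (?f w)"
        using strip_map_bounds(3)[OF Im[OF w(1)]] by linarith
      then have "norm w * norm (strip_map (?f w)) \<le> norm w * norm (?f w)" by (rule mult_left_mono) simp
      then show ?thesis using dec unfolding F_def by linarith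
    qed
  qed (use z nz in \<open>simp_all add: F_def\<close>)
  then show ?thesis unfolding F_def .
qed

text \<open>The sharp Remez constant \<open>4\<close> survives because \<open>\<integral>\<^sub>E dx/x\<close> is smallest when \<open>E\<close> is pushed
  to the far end of the segment.\<close>

lemma ln_le_integral_inverse:
  fixes E :: "real set"
  assumes E: "compact E" "E \<subseteq> {0<..len}" and q: "q = len - measure lborel E" "0 < q"
  shows "ln (len / q) \<le> (\<integral>x. 1 / x \<partial>restrict_space lborel E)"
proof -
  let ?M = "restrict_space lborel E"
  have Eb: "E \<in> sets borel" using E by (simp add: compact_imp_closed)
  have E0: "0 \<notin> complex_of_real ` E" using E(2) by auto
  interpret cauchy_measure ?M complex_of_real "complex_of_real ` E" by (rule cauchy_measure_line[OF E(1)])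
  have qlen: "q \<le> len" using q(1) by simp
  have "integrable ?M (\<lambda>x. Re (1 / (complex_of_real x - 0)))"
    by (rule Re_mult_cauchy_transform(2)[OF E0])
  then have i1: "integrable ?M (\<lambda>x. 1 / x)" by simp
  have mM: "measure ?M (space ?M) = measure lborel E"
    using Eb by (simp add: measure_restrict_space space_restrict_space)
  have "has_bochner_integral lborel (\<lambda>x. indicator {q..len} x *\<^sub>R (1 / x - 1 / q)) ((ln len - len / q) - (ln q - q / q))"
  proof (rule has_bochner_integral_FTC_Icc[OF qlen])
    fix x assume "q \<le> x" "x \<le> len"
    then show "((\<lambda>x. ln x - x / q) has_vector_derivative 1 / x - 1 / q) (at x within {q..len})"
      unfolding has_real_derivative_iff_has_vector_derivative[symmetric]
      using q(2) by (auto intro!: derivative_eq_intros)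
  next
    show "continuous_on {q..len} (\<lambda>x. 1 / x - 1 / q)"
      using q(2) by (intro continuous_intros) auto
  qed
  then have hb: "integrable lborel (\<lambda>x. indicator {q..len} x *\<^sub>R (1 / x - 1 / q))"
    "(\<integral>x. indicator {q..len} x *\<^sub>R (1 / x - 1 / q) \<partial>lborel) = (ln len - len / q) - (ln q - q / q)"
    by (auto simp: has_bochner_integral_iff)
  \<comment> \<open>\<open>1 / x - 1 / q\<close> is nonnegative to the left of \<open>q\<close> and
    nonpositive to the right, so among subsets of \<open>{0<..len}\<close> its integral is least
    over \<open>{q..len}\<close>, which has the length of \<open>E\<close>.\<close>
  have "(ln len - len / q) - (ln q - q / q) \<le> (\<integral>x. indicator E x *\<^sub>R (1 / x - 1 / q) \<partial>lborel)"
    unfolding hb(2)[symmetric]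
  proof (rule integral_mono[OF hb(1)])
    have "integrable ?M (\<lambda>x. 1 / x - 1 / q)" using i1 by simp
    then show "integrable lborel (\<lambda>x. indicator E x *\<^sub>R (1 / x - 1 / q))"
      using Eb by (subst (asm) integrable_restrict_space) auto
    fix x :: real
    show "indicator {q..len} x *\<^sub>R (1 / x - 1 / q) \<le> indicator E x *\<^sub>R (1 / x - 1 / q)"
    proof (cases "x \<in> E")
      case True
      then have x: "0 < x" "x \<le> len" using E(2) by auto
      show ?thesis
      proof (cases "q \<le> x")
        case False
        then have "1 / q \<le> 1 / x" using x by (intro divide_left_mono) (use q in auto)
        then show ?thesis using True False by simp
      qed (use True x in simp)
    next
      case False
      have "1 / x \<le> 1 / q" if "q \<le> x" using that q(2) by (intro divide_left_mono) auto
      then show ?thesis using False by (simp add: indicator_def)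
    qed
  qed
  also have "\<dots> = (\<integral>x. 1 / x - 1 / q \<partial>?M)"
    using Eb by (intro integral_restrict_space[symmetric]) auto
  also have "\<dots> = (\<integral>x. 1 / x \<partial>?M) - measure lborel E / q"
    using i1 mM by simp
  finally have "(ln len - len / q) - (ln q - q / q) \<le> (\<integral>x. 1 / x \<partial>?M) - measure lborel E / q" .
  moreover have "measure lborel E = len - q" using q(1) by simp
  then have "measure lborel E / q = len / q - q / q" by (simp only: diff_divide_distrib)
  moreover have "ln (len / q) = ln len - ln q" using q(2) qlen by (intro ln_divide_pos) auto
  ultimately show ?thesis by linarith
qed

text \<open>With \<open>\<kappa> = exp (f0 / 2)\<close>,
  \<open>tanh (f0 / 4) = (\<kappa> - 1) / (\<kappa> + 1)\<close> is at most \<open>exp (-t)\<close>,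
  while \<open>f0 \<ge> ln (len / q)\<close> becomes
  \<open>m / len \<le> 1 - 1 / \<kappa>\<^sup>2\<close>. The second quantity is at most 4 times the
  first because \<open>\<kappa> + 1 \<le> 2 * \<kappa>\<close>.\<close>

lemma subharmonic_segment_sublevel_compact:
  fixes v :: "complex \<Rightarrow> ereal" and E :: "real set"
  assumes sub: "subharmonic_on UNIV v" and bd: "\<And>z. v z \<le> ereal (C + log_plus (norm z))"
    and v0: "v 0 = ereal m0" and t: "t > 0" and len: "len > 0"
    and E: "compact E" "E \<subseteq> {x\<in>{0..len}. v (of_real x) \<le> ereal (m0 - t)}"
  shows "measure lborel E \<le> 4 * len * exp (- t)"
proof (cases "measure lborel E > 0")
  case m: True
  let ?M = "restrict_space lborel E"
  let ?f = "cauchy_transform ?M complex_of_real"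
  define m where "m = measure lborel E"
  have m0: "m > 0" using m by (simp add: m_def)
  have E0: "0 \<notin> E" using E(2) t by (auto simp: v0)
  have El: "E \<subseteq> {0<..len}"
  proof
    fix x assume "x \<in> E"
    then have "0 \<le> x" "x \<le> len" "x \<noteq> 0" using E E0 by auto
    then show "x \<in> {0<..len}" by simp
  qed
  define q where "q = len - m"
  \<comment> \<open>The closed set \<open>E\<close> omits \<open>0\<close>, hence a neighbourhood of
    it, and cannot fill the segment.\<close>
  have q: "q > 0"
  proof -
    have "open (- E)" using E(1) by (simp add: compact_imp_closed open_Compl)
    then obtain e where e: "e > 0" "ball 0 e \<subseteq> - E" using E0 by (meson ComplI open_contains_ball)
    define a where "a = min e len"
    have a: "0 < a" "a \<le> len" using e len by (auto simp: a_def)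
    have "E \<subseteq> {a..len}"
    proof
      fix x assume x: "x \<in> E"
      then have "x \<notin> ball 0 e" using e by auto
      then show "x \<in> {a..len}" using El x by (auto simp: a_def dist_real_def)
    qed
    then have "emeasure lborel E \<le> emeasure lborel {a..len}" by (intro emeasure_mono) auto
    then have "emeasure lborel E \<le> ennreal (len - a)" using a by simp
    then have "m \<le> len - a" unfolding m_def measure_def using a by (intro enn2real_leI) auto
    then show ?thesis using a by (simp add: q_def)
  qed
  define f0 where "f0 = (\<integral>x. 1 / x \<partial>?M)"
  have f0: "?f 0 = of_real f0"
    unfolding cauchy_transform_def f0_def integral_complex_of_real[symmetric] by simp
  have "ln (len / q) \<le> f0"
    unfolding f0_def by (rule ln_le_integral_inverse[OF E(1) El]) (use q in \<open>auto simp: q_def m_def\<close>)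
  then have ef: "len / q \<le> exp f0" using q len by (simp add: ln_le_cancel_iff[symmetric] ln_ge_iff[symmetric] del: ln_le_cancel_iff)
  define \<kappa> where "\<kappa> = exp (f0 / 2)"
  have \<kappa>2: "\<kappa> * \<kappa> = exp f0" by (simp add: \<kappa>_def flip: exp_add)
  have \<kappa>0: "\<kappa> > 0" by (simp add: \<kappa>_def)
  have "1 < len / q" using q m0 by (simp add: q_def)
  then have "1 * 1 < \<kappa> * \<kappa>" unfolding \<kappa>2 using ef by linarith
  then have \<kappa>1: "\<kappa> > 1" using \<kappa>0 by (metis linorder_not_le mult_mono less_imp_le zero_le_one)
  have "exp (complex_of_real f0 / 2) = exp (complex_of_real (f0 / 2))" by simp
  also have "\<dots> = of_real \<kappa>" by (simp only: exp_of_real \<kappa>_def)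
  finally have "strip_map (?f 0) = of_real ((\<kappa> - 1) / (\<kappa> + 1))"
    by (simp add: strip_map_def f0)
  then have ns: "norm (strip_map (?f 0)) = (\<kappa> - 1) / (\<kappa> + 1)"
    using \<kappa>1 by (simp only: norm_of_real) simp
  have pos: "(\<kappa> - 1) / (\<kappa> + 1) > 0" using \<kappa>1 by simp
  have "q / len \<ge> 1 / (\<kappa> * \<kappa>)"
  proof -
    have "1 / (\<kappa> * \<kappa>) \<le> 1 / (len / q)"
      unfolding \<kappa>2 using ef q len by (intro divide_left_mono) auto
    then show ?thesis by simp
  qed
  then have "m / len \<le> 1 - 1 / (\<kappa> * \<kappa>)" using len by (simp add: q_def diff_divide_distrib)
  also have "\<dots> = (\<kappa> - 1) * ((\<kappa> + 1) / (\<kappa> * \<kappa>))" using \<kappa>0 by (simp add: field_simps)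
  also have "\<dots> \<le> (\<kappa> - 1) * (4 / (\<kappa> + 1))"
  proof (rule mult_left_mono)
    \<comment> \<open>The constant 4 is the supremum of
      \<open>(\<kappa> + 1)\<^sup>2 / \<kappa>\<^sup>2\<close> over \<open>\<kappa> \<ge> 1\<close>,
      taken at \<open>\<kappa> = 1\<close>.\<close>
    have "(\<kappa> + 1) * (\<kappa> + 1) \<le> (2 * \<kappa>) * (2 * \<kappa>)" using \<kappa>1 by (intro mult_mono) auto
    then show "(\<kappa> + 1) / (\<kappa> * \<kappa>) \<le> 4 / (\<kappa> + 1)"
      using \<kappa>0 by (simp add: divide_simps)
  qed (use \<kappa>1 in simp)
  also have "\<dots> = 4 * ((\<kappa> - 1) / (\<kappa> + 1))" by (simp only: times_divide_eq_right mult.commute)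
  finally have low: "m / len \<le> 4 * ((\<kappa> - 1) / (\<kappa> + 1))" .
  have "v 0 \<le> ereal (m0 - t - ln (norm (strip_map (?f 0))))"
  proof (rule subharmonic_le_of_line_set[OF sub bd E(1)])
    show "v (of_real x) \<le> ereal (m0 - t)" if "x \<in> E" for x using that E(2) by auto
    show "0 \<notin> complex_of_real ` E" using E0 by auto
    show "strip_map (?f 0) \<noteq> 0" using ns pos by auto
  qed
  then have "ln ((\<kappa> - 1) / (\<kappa> + 1)) \<le> - t" by (simp add: v0 ns)
  then have "(\<kappa> - 1) / (\<kappa> + 1) \<le> exp (- t)" using pos by (metis exp_le_cancel_iff exp_ln)
  then have "m / len \<le> 4 * exp (- t)" using low by linarith
  then show ?thesis using len by (simp add: m_def field_simps)
next
  case False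
  then have "measure lborel E = 0" using measure_nonneg[of lborel E] by linarith
  then show ?thesis using len by simp
qed

lemma subharmonic_segment_sublevel:
  fixes v :: "complex \<Rightarrow> ereal"
  assumes sub: "subharmonic_on UNIV v" and bd: "\<And>z. v z \<le> ereal (C + log_plus (norm z))"
    and v0: "v 0 = ereal m0" and t: "t > 0" and len: "len > 0"
  shows "emeasure lborel {x\<in>{0..len}. v (of_real x) \<le> ereal (m0 - t)} \<le> ennreal (4 * len * exp (- t))"
proof (rule emeasure_lborel_le_if_compact)
  have [measurable]: "v \<in> borel_measurable borel"
    using sub by (auto simp: subharmonic_on_def intro: usc_borel_measurable)
  show "{x\<in>{0..len}. v (of_real x) \<le> ereal (m0 - t)} \<in> sets borel" by measurable
  show "bounded {x\<in>{0..len}. v (of_real x) \<le> ereal (m0 - t)}"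
    by (rule bounded_subset[OF bounded_closed_interval]) auto
  fix E assume E: "compact E" "E \<subseteq> {x\<in>{0..len}. v (of_real x) \<le> ereal (m0 - t)}"
  have "emeasure lborel E = ennreal (measure lborel E)"
    using emeasure_compact_finite[OF E(1)] by (intro emeasure_eq_ennreal_measure) auto
  then show "emeasure lborel E \<le> ennreal (4 * len * exp (- t))"
    using subharmonic_segment_sublevel_compact[OF sub bd v0 t len E] by (simp add: ennreal_leI)
qed

section \<open>Propagation of the value \<open>-\<infinity>\<close> along real and complex
  lines\<close>

lemma subharmonic_MInf_segment:
  fixes v :: "complex \<Rightarrow> ereal"
  assumes sub: "subharmonic_on UNIV v" and bd: "\<And>z. v z \<le> ereal (C + log_plus (norm z))"
    and a: "0 \<le> a" "a < b" and inf: "\<And>x. x \<in> {a..b} \<Longrightarrow> v (of_real x) = - \<infinity>"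
  shows "v 0 = - \<infinity>"
proof (rule ccontr)
  assume "v 0 \<noteq> - \<infinity>"
  moreover have "v 0 \<noteq> \<infinity>" using sub by (auto simp: subharmonic_on_def)
  ultimately obtain m0 where v0: "v 0 = ereal m0" by (cases "v 0") auto
  have [measurable]: "v \<in> borel_measurable borel"
    using sub by (auto simp: subharmonic_on_def intro: usc_borel_measurable)
  \<comment> \<open>An interval with value \<open>-\<infinity>\<close> lies in every sublevel set,
    but their lengths decay exponentially if \<open>v 0\<close> is finite.\<close>
  have le: "b - a \<le> 4 * b * exp (- t)" if "t > 0" for t
  proof -
    have "emeasure lborel {a..b} \<le> emeasure lborel {x\<in>{0..b}. v (of_real x) \<le> ereal (m0 - t)}"
      using inf a by (intro emeasure_mono) (auto simp: inf, measurable)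
    also have "\<dots> \<le> ennreal (4 * b * exp (- t))"
      using subharmonic_segment_sublevel[OF sub bd v0 that, of b] a by simp
    finally show ?thesis using a by (simp add: ennreal_le_iff)
  qed
  \<comment> \<open>Chosen so that the bound \<open>4 * b * exp (- t)\<close> is half of
    \<open>b - a\<close>.\<close>
  define t where "t = ln (8 * b / (b - a))"
  have "8 * b / (b - a) > 1" using a by simp
  then have "t > 0" "exp (- t) = (b - a) / (8 * b)"
    by (simp_all add: t_def exp_minus)
  with le[of t] have "b - a \<le> (b - a) / 2" using a by simp
  then show False using a by simp
qed

text \<open>On \<open>{-1..1}\<close> the level \<open>s\<close> is arbitrary, so it suffices that
  \<open>F\<close> does not vanish at \<open>\<i>\<close>. There the kernel
  \<open>1 / (x\<^sup>2 + 1)\<close> is at least \<open>1/2\<close>, so \<open>Im f\<close> lies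
  between 1 and \<open>pi\<close>, and \<open>exp (f / 2)\<close> has positive imaginary part, hence
  is not 1.\<close>

lemma subharmonic_MInf_imaginary:
  fixes v :: "complex \<Rightarrow> ereal"
  assumes sub: "subharmonic_on UNIV v" and bd: "\<And>z. v z \<le> ereal (C + log_plus (norm z))"
    and inf: "\<And>x. v (of_real x) = - \<infinity>"
  shows "v \<i> = - \<infinity>"
proof -
  let ?E = "{-1..1::real}"
  let ?M = "restrict_space lborel ?E"
  let ?f = "cauchy_transform ?M complex_of_real"
  have E: "compact ?E" by simp
  have iE: "\<i> \<notin> complex_of_real ` ?E" by (auto simp: complex_eq_iff)
  interpret cauchy_measure ?M complex_of_real "complex_of_real ` ?E" by (rule cauchy_measure_line[OF E])
  have "measure ?M (space ?M) = measure lborel ?E"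
    by (rule measure_space_restrict_lborel) simp
  also have "\<dots> = 2" by simp
  finally have mM: "measure ?M (space ?M) = 2" .
  have "(1::real) = (\<integral>x. 1 / 2 \<partial>?M)" by (simp only: lebesgue_integral_const mM) simp
  also have "\<dots> \<le> (\<integral>x. Re (- \<i> / (complex_of_real x - \<i>)) \<partial>?M)"
  proof (rule integral_mono)
    show "integrable ?M (\<lambda>x. Re (- \<i> / (complex_of_real x - \<i>)))"
      by (rule Re_mult_cauchy_transform(2)[OF iE])
    fix x assume "x \<in> space ?M"
    then have "\<bar>x\<bar> \<le> 1" by (auto simp: space_restrict_space)
    then have "x\<^sup>2 \<le> 1" by (simp add: abs_square_le_1)
    then show "1 / 2 \<le> Re (- \<i> / (complex_of_real x - \<i>))"
      unfolding Im_inverse_kernel by (simp add: field_simps add_pos_nonneg)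
  qed simp
  also have "\<dots> = Re (- \<i> * ?f \<i>)" by (rule Re_mult_cauchy_transform(1)[OF iE, symmetric])
  finally have Im1: "1 \<le> Im (?f \<i>)" by simp
  have Im2: "\<bar>Im (?f \<i>)\<bar> \<le> pi" by (rule Im_cauchy_transform_line[OF E iE])
  have "exp (?f \<i> / 2) \<noteq> 1"
  proof
    assume "exp (?f \<i> / 2) = 1"
    then have "Im (exp (?f \<i> / 2)) = 0" by simp
    then have "sin (Im (?f \<i>) / 2) = 0" by (simp add: Im_exp)
    moreover have "sin (Im (?f \<i>) / 2) > 0" using Im1 Im2 by (intro sin_gt_zero) auto
    ultimately show False by simp
  qed
  then have nz: "strip_map (?f \<i>) \<noteq> 0"
    using strip_map_bounds(1)[OF Im2] by (simp add: strip_map_def)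
  have "v \<i> \<le> ereal (s - ln (norm (strip_map (?f \<i>))))" for s
    by (rule subharmonic_le_of_line_set[OF sub bd E _ iE nz]) (simp add: inf)
  from this[of "_ + ln (norm (strip_map (?f \<i>)))"] have "v \<i> \<le> ereal s" for s by simp
  then show ?thesis by (rule ereal_bot)
qed

section \<open>The Riemann--Stieltjes integral\<close>

text \<open>Integration by parts: the Stieltjes integral of \<open>exp (- \<delta> * t)\<close>
  against \<open>g\<close> becomes an increment of this function, in which \<open>g\<close> is only
  integrated.\<close>

definition parts_primitive :: "real \<Rightarrow> (real \<Rightarrow> real) \<Rightarrow> real \<Rightarrow> real" where
  "parts_primitive \<delta> g t = exp (- \<delta> * t) * g t + \<delta> * integral {0..t} (\<lambda>x. exp (- \<delta> * x) * g x)"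

lemma exp_times_mono_integrable:
  fixes g :: "real \<Rightarrow> real"
  assumes g: "mono_on {0..} g" and "0 \<le> p"
  shows "(\<lambda>x. exp (- \<delta> * x) * g x) integrable_on {p..q}"
proof (rule measurable_bounded_by_integrable_imp_integrable)
  have gm: "mono_on {p..q} g" using g \<open>0 \<le> p\<close> by (auto simp: monotone_on_def)
  then have "g \<in> borel_measurable (lebesgue_on {p..q})"
    using integrable_mono_on borel_measurable_integrable by blast
  moreover have "(\<lambda>x. exp (- \<delta> * x)) \<in> borel_measurable (lebesgue_on {p..q})"
    by (intro continuous_imp_measurable_on_sets_lebesgue continuous_intros) simp
  ultimately show "(\<lambda>x. exp (- \<delta> * x) * g x) \<in> borel_measurable (lebesgue_on {p..q})"
    by (rule borel_measurable_times[rotated])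
  define K where "K = exp (\<bar>\<delta>\<bar> * (\<bar>p\<bar> + \<bar>q\<bar>)) * (\<bar>g p\<bar> + \<bar>g q\<bar>)"
  show "(\<lambda>x. K) integrable_on {p..q}" by (rule integrable_const_ivl)
  show "norm (exp (- \<delta> * x) * g x) \<le> K" if x: "x \<in> {p..q}" for x
  proof -
    have "g p \<le> g x" "g x \<le> g q" using monotone_onD[OF gm] x by auto
    then have "\<bar>g x\<bar> \<le> \<bar>g p\<bar> + \<bar>g q\<bar>" by linarith
    moreover have "\<bar>\<delta>\<bar> * \<bar>x\<bar> \<le> \<bar>\<delta>\<bar> * (\<bar>p\<bar> + \<bar>q\<bar>)" using x by (intro mult_left_mono) auto
    then have "- \<delta> * x \<le> \<bar>\<delta>\<bar> * (\<bar>p\<bar> + \<bar>q\<bar>)"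
      using abs_ge_self[of "- \<delta> * x"] by (simp add: abs_mult)
    ultimately have "exp (- \<delta> * x) * \<bar>g x\<bar> \<le> K"
      unfolding K_def by (intro mult_mono) auto
    then show ?thesis by (simp add: abs_mult)
  qed
qed simp

text \<open>Bound \<open>g\<close> by its end values in the integral over \<open>{p..q}\<close>. The
  outer terms are the smallest and largest Riemann--Stieltjes terms of the interval, so the lemma
  serves both for existence of the integral and for comparison with grid sums.\<close>

lemma parts_primitive_increment:
  fixes g :: "real \<Rightarrow> real"
  assumes g: "mono_on {0..} g" and pq: "0 \<le> p" "p \<le> q" and \<delta>: "\<delta> > 0"
  shows "exp (- \<delta> * q) * (g q - g p) \<le> parts_primitive \<delta> g q - parts_primitive \<delta> g p"
    and "parts_primitive \<delta> g q - parts_primitive \<delta> g p \<le> exp (- \<delta> * p) * (g q - g p)"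
proof -
  let ?f = "\<lambda>x. exp (- \<delta> * x) * g x"
  have i0: "?f integrable_on {0..q}" by (rule exp_times_mono_integrable[OF g]) simp
  have ip: "?f integrable_on {p..q}" by (rule exp_times_mono_integrable[OF g pq(1)])
  have comb: "integral {0..p} ?f + integral {p..q} ?f = integral {0..q} ?f"
    using pq i0 by (intro Henstock_Kurzweil_Integration.integral_combine) auto
  have "((\<lambda>x. exp (- \<delta> * x)) has_integral (- exp (- \<delta> * q) / \<delta> - - exp (- \<delta> * p) / \<delta>)) {p..q}"
    using \<delta> by (intro fundamental_theorem_of_calculus pq)
      (auto intro!: derivative_eq_intros simp: has_real_derivative_iff_has_vector_derivative[symmetric])
  then have he: "((\<lambda>x. exp (- \<delta> * x)) has_integral ((exp (- \<delta> * p) - exp (- \<delta> * q)) / \<delta>)) {p..q}"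
    by (simp add: diff_divide_distrib)
  have gx: "g p \<le> g x" "g x \<le> g q" if "x \<in> {p..q}" for x
    using monotone_onD[OF g] that pq by auto
  have lo: "(exp (- \<delta> * p) - exp (- \<delta> * q)) / \<delta> * g p \<le> integral {p..q} ?f"
  proof (rule has_integral_le[OF has_integral_mult_left[OF he] integrable_integral[OF ip]])
    show "exp (- \<delta> * x) * g p \<le> ?f x" if "x \<in> {p..q}" for x
      using gx[OF that] by (intro mult_left_mono) auto
  qed
  have hi: "integral {p..q} ?f \<le> (exp (- \<delta> * p) - exp (- \<delta> * q)) / \<delta> * g q"
  proof (rule has_integral_le[OF integrable_integral[OF ip] has_integral_mult_left[OF he]])
    show "?f x \<le> exp (- \<delta> * x) * g q" if "x \<in> {p..q}" for x
      using gx[OF that] by (intro mult_left_mono) auto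
  qed
  have eq: "parts_primitive \<delta> g q - parts_primitive \<delta> g p
      = exp (- \<delta> * q) * g q - exp (- \<delta> * p) * g p + \<delta> * integral {p..q} ?f"
    unfolding parts_primitive_def comb[symmetric] by (simp add: algebra_simps)
  have "(exp (- \<delta> * p) - exp (- \<delta> * q)) * g p \<le> \<delta> * integral {p..q} ?f"
    using mult_left_mono[OF lo, of \<delta>] \<delta> by simp
  then show "exp (- \<delta> * q) * (g q - g p) \<le> parts_primitive \<delta> g q - parts_primitive \<delta> g p"
    unfolding eq by (simp add: algebra_simps)
  have "\<delta> * integral {p..q} ?f \<le> (exp (- \<delta> * p) - exp (- \<delta> * q)) * g q"
    using mult_left_mono[OF hi, of \<delta>] \<delta> by simp
  then show "parts_primitive \<delta> g q - parts_primitive \<delta> g p \<le> exp (- \<delta> * p) * (g q - g p)"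
    unfolding eq by (simp add: algebra_simps)
qed

text \<open>A tagged term and the matching increment of \<open>parts_primitive\<close> lie between
  the same two bounds, which differ by at most \<open>\<delta> * \<eta>\<close> times the increment
  of \<open>g\<close>; these increments telescope. Jumps of \<open>g\<close> are harmless, since the
  integrand is Lipschitz on \<open>{0..}\<close>.\<close>

lemma has_RS_integral_exp:
  fixes g :: "real \<Rightarrow> real"
  assumes g: "mono_on {0..} g" and \<delta>: "\<delta> > 0"
  shows "has_RS_integral (\<lambda>t. exp (- \<delta> * t)) g 0 T (parts_primitive \<delta> g T - parts_primitive \<delta> g 0)"
  unfolding has_RS_integral_def
proof (intro allI impI)
  fix \<epsilon> :: real assume "\<epsilon> > 0"
  \<comment> \<open>The summand 1 keeps the denominator positive when \<open>g T = g 0\<close> and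
    makes the final inequality strict.\<close>
  define \<eta> where "\<eta> = \<epsilon> / (\<delta> * \<bar>g T - g 0\<bar> + 1)"
  have den: "\<delta> * \<bar>g T - g 0\<bar> + 1 > 0" using \<delta> by (simp add: add_nonneg_pos)
  have \<eta>: "\<eta> > 0" using \<open>\<epsilon> > 0\<close> den by (simp add: \<eta>_def)
  have \<eta>\<epsilon>: "\<delta> * \<eta> * \<bar>g T - g 0\<bar> < \<epsilon>"
  proof -
    have "\<delta> * \<eta> * \<bar>g T - g 0\<bar> < \<eta> * (\<delta> * \<bar>g T - g 0\<bar> + 1)" using \<eta> by (simp add: algebra_simps)
    also have "\<dots> = \<epsilon>" using den by (simp add: \<eta>_def)
    finally show ?thesis .
  qed
  have main: "\<bar>(\<Sum>i<N. exp (- \<delta> * \<xi> i) * (g (p (Suc i)) - g (p i))) - (parts_primitive \<delta> g T - parts_primitive \<delta> g 0)\<bar> < \<epsilon>"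
    if p0: "p 0 = 0" and pN: "p N = T"
      and st: "\<And>i. i < N \<Longrightarrow> p i \<le> p (Suc i) \<and> p (Suc i) - p i < \<eta> \<and> \<xi> i \<in> {p i..p (Suc i)}"
    for N :: nat and p \<xi> :: "nat \<Rightarrow> real"
  proof -
    have pos: "0 \<le> p i" if "i \<le> N" for i
      using that
    proof (induction i)
      case (Suc i)
      then show ?case using st[of i] by simp
    qed (simp add: p0)
    define S where "S i = parts_primitive \<delta> g (p (Suc i)) - parts_primitive \<delta> g (p i)" for i
    define \<Delta> where "\<Delta> i = g (p (Suc i)) - g (p i)" for i
    have S: "(\<Sum>i<N. S i) = parts_primitive \<delta> g T - parts_primitive \<delta> g 0"
      unfolding S_def using sum_lessThan_telescope[of "\<lambda>i. parts_primitive \<delta> g (p i)" N] by (simp add: p0 pN)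
    have D: "(\<Sum>i<N. \<Delta> i) = g T - g 0"
      unfolding \<Delta>_def using sum_lessThan_telescope[of "\<lambda>i. g (p i)" N] by (simp add: p0 pN)
    have step: "\<bar>exp (- \<delta> * \<xi> i) * \<Delta> i - S i\<bar> \<le> \<delta> * \<eta> * \<Delta> i" if i: "i < N" for i
    proof -
      have pi: "0 \<le> p i" "p i \<le> p (Suc i)" "p (Suc i) - p i < \<eta>" "p i \<le> \<xi> i" "\<xi> i \<le> p (Suc i)"
        using pos[of i] st[OF i] i by auto
      have \<Delta>0: "0 \<le> \<Delta> i" using monotone_onD[OF g, of "p i" "p (Suc i)"] pi by (simp add: \<Delta>_def)
      have S1: "exp (- \<delta> * p (Suc i)) * \<Delta> i \<le> S i" "S i \<le> exp (- \<delta> * p i) * \<Delta> i"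
        unfolding S_def \<Delta>_def using parts_primitive_increment[OF g pi(1,2) \<delta>] by auto
      have x1: "exp (- \<delta> * p (Suc i)) * \<Delta> i \<le> exp (- \<delta> * \<xi> i) * \<Delta> i"
        using pi \<delta> \<Delta>0 by (intro mult_right_mono) auto
      have x2: "exp (- \<delta> * \<xi> i) * \<Delta> i \<le> exp (- \<delta> * p i) * \<Delta> i"
        using pi \<delta> \<Delta>0 by (intro mult_right_mono) auto
      have "exp (- \<delta> * p i) - exp (- \<delta> * p (Suc i)) \<le> \<delta> * \<eta>"
      proof -
        have e: "exp (- \<delta> * p (Suc i)) = exp (- \<delta> * p i) * exp (- \<delta> * (p (Suc i) - p i))"
          by (simp add: algebra_simps flip: exp_add)
        have "1 - exp (- \<delta> * (p (Suc i) - p i)) \<le> \<delta> * (p (Suc i) - p i)"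
          using exp_ge_add_one_self[of "- \<delta> * (p (Suc i) - p i)"] by linarith
        also have "\<dots> \<le> \<delta> * \<eta>" using pi \<delta> by (intro mult_left_mono) auto
        finally have a: "1 - exp (- \<delta> * (p (Suc i) - p i)) \<le> \<delta> * \<eta>" .
        have b: "0 \<le> 1 - exp (- \<delta> * (p (Suc i) - p i))" using pi \<delta> by simp
        have "exp (- \<delta> * p i) * (1 - exp (- \<delta> * (p (Suc i) - p i))) \<le> 1 * (\<delta> * \<eta>)"
          using a b pi \<delta> by (intro mult_mono) auto
        then show ?thesis unfolding e by (simp add: algebra_simps)
      qed
      then have "(exp (- \<delta> * p i) - exp (- \<delta> * p (Suc i))) * \<Delta> i \<le> \<delta> * \<eta> * \<Delta> i"
        using \<Delta>0 by (rule mult_right_mono)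
      then show ?thesis using S1 x1 x2 unfolding left_diff_distrib by linarith
    qed
    have "\<bar>(\<Sum>i<N. exp (- \<delta> * \<xi> i) * \<Delta> i) - (\<Sum>i<N. S i)\<bar> \<le> (\<Sum>i<N. \<bar>exp (- \<delta> * \<xi> i) * \<Delta> i - S i\<bar>)"
      unfolding sum_subtractf[symmetric] by (rule sum_abs)
    also have "\<dots> \<le> (\<Sum>i<N. \<delta> * \<eta> * \<Delta> i)" using step by (intro sum_mono) auto
    also have "\<dots> = \<delta> * \<eta> * (g T - g 0)" by (simp only: sum_distrib_left[symmetric] D)
    also have "\<dots> \<le> \<delta> * \<eta> * \<bar>g T - g 0\<bar>" using \<delta> \<eta> by (intro mult_left_mono) auto
    also have "\<dots> < \<epsilon>" by (rule \<eta>\<epsilon>)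
    finally show ?thesis unfolding S \<Delta>_def .
  qed
  show "\<exists>\<eta>>0. \<forall>N p \<xi>. p (0::nat) = 0 \<and> p N = T \<and>
      (\<forall>i<N. p i \<le> p (Suc i) \<and> p (Suc i) - p i < \<eta> \<and> \<xi> i \<in> {p i..p (Suc i)}) \<longrightarrow>
      \<bar>(\<Sum>i<N. exp (- \<delta> * \<xi> i) * (g (p (Suc i)) - g (p i))) - (parts_primitive \<delta> g T - parts_primitive \<delta> g 0)\<bar> < \<epsilon>"
    using \<eta> main by blast
qed

text \<open>Justifies the \<open>THE\<close> in \<open>RS_integral\<close>: an equidistant partition
  finer than both mesh bounds has one sum close to both values.\<close>

lemma has_RS_integral_unique:
  assumes I: "has_RS_integral f g a b I" and I': "has_RS_integral f g a b I'" and ab: "a \<le> b"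
  shows "I = I'"
proof (rule ccontr)
  assume "I \<noteq> I'"
  define \<epsilon> where "\<epsilon> = \<bar>I - I'\<bar> / 2"
  have \<epsilon>: "\<epsilon> > 0" using \<open>I \<noteq> I'\<close> by (simp add: \<epsilon>_def)
  obtain \<eta>1 where \<eta>1: "\<eta>1 > 0" "\<And>N p \<xi>. p (0::nat) = a \<and> p N = b \<and>
        (\<forall>i<N. p i \<le> p (Suc i) \<and> p (Suc i) - p i < \<eta>1 \<and> \<xi> i \<in> {p i..p (Suc i)})
        \<Longrightarrow> \<bar>(\<Sum>i<N. f (\<xi> i) * (g (p (Suc i)) - g (p i))) - I\<bar> < \<epsilon>"
    using I \<epsilon> unfolding has_RS_integral_def by blast
  obtain \<eta>2 where \<eta>2: "\<eta>2 > 0" "\<And>N p \<xi>. p (0::nat) = a \<and> p N = b \<and>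
        (\<forall>i<N. p i \<le> p (Suc i) \<and> p (Suc i) - p i < \<eta>2 \<and> \<xi> i \<in> {p i..p (Suc i)})
        \<Longrightarrow> \<bar>(\<Sum>i<N. f (\<xi> i) * (g (p (Suc i)) - g (p i))) - I'\<bar> < \<epsilon>"
    using I' \<epsilon> unfolding has_RS_integral_def by blast
  obtain n :: nat where n: "(b - a) / min \<eta>1 \<eta>2 < real n" using reals_Archimedean2 by blast
  define N where "N = Suc n"
  define p where "p i = a + (b - a) * real i / real N" for i
  have "(b - a) / min \<eta>1 \<eta>2 < real N" using n by (simp add: N_def)
  then have mesh: "(b - a) / real N < min \<eta>1 \<eta>2"
  proof -
    have mn: "0 < min \<eta>1 \<eta>2" "0 < real N" using \<eta>1(1) \<eta>2(1) by (simp_all add: N_def)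
    have "b - a < real N * min \<eta>1 \<eta>2"
      using \<open>(b - a) / min \<eta>1 \<eta>2 < real N\<close> mn(1) by (simp only: pos_divide_less_eq)
    then show ?thesis using mn(2) by (simp only: pos_divide_less_eq mult.commute)
  qed
  have step: "p (Suc i) - p i = (b - a) / real N" for i
    by (simp add: p_def add_divide_distrib distrib_left)
  have "p 0 = a" "p N = b" by (simp_all add: p_def N_def)
  moreover have "p i \<le> p (Suc i)" for i using step[of i] ab by (simp add: N_def del: of_nat_Suc) (smt (verit) divide_nonneg_nonneg of_nat_0_le_iff)
  ultimately have "\<bar>(\<Sum>i<N. f (p i) * (g (p (Suc i)) - g (p i))) - I\<bar> < \<epsilon>"
    "\<bar>(\<Sum>i<N. f (p i) * (g (p (Suc i)) - g (p i))) - I'\<bar> < \<epsilon>"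
    using \<eta>1(2)[of p N p] \<eta>2(2)[of p N p] mesh step by auto
  moreover have "\<bar>I - I'\<bar> \<le> \<bar>A - I'\<bar> + \<bar>A - I\<bar>" for A
    using abs_triangle_ineq4[of "A - I'" "A - I"] by simp
  ultimately show False unfolding \<epsilon>_def by (smt (verit) field_sum_of_halves)
qed

lemma RS_integral_exp:
  assumes "mono_on {0..} g" "\<delta> > 0" "0 \<le> T"
  shows "RS_integral (\<lambda>t. exp (- \<delta> * t)) g 0 T = parts_primitive \<delta> g T - parts_primitive \<delta> g 0"
  unfolding RS_integral_def
  using has_RS_integral_exp[OF assms(1,2)] has_RS_integral_unique[OF _ _ assms(3)]
  by (intro the_equality) blast+

text \<open>The integrals increase with \<open>T\<close>, so the limit exists and is their supremum;
  this is what makes the \<open>Lim\<close> in \<open>I_exp\<close> meaningful.\<close>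

lemma RS_integral_exp_le_I_exp:
  fixes g :: "real \<Rightarrow> real"
  assumes g: "mono_on {0..} g" and \<delta>: "\<delta> > 0" and T: "0 \<le> T"
  shows "ennreal (parts_primitive \<delta> g T - parts_primitive \<delta> g 0) \<le> I_exp \<delta> g"
proof -
  define h where "h T = ennreal (RS_integral (\<lambda>t. exp (- \<delta> * t)) g 0 T)" for T
  have h: "h t = ennreal (parts_primitive \<delta> g t - parts_primitive \<delta> g 0)" if "0 \<le> t" for t
    unfolding h_def using RS_integral_exp[OF g \<delta> that] by simp
  have mono: "h s \<le> h t" if "0 \<le> s" "s \<le> t" for s t
  proof -
    have "0 \<le> exp (- \<delta> * t) * (g t - g s)" using monotone_onD[OF g, of s t] that by simp
    then have "parts_primitive \<delta> g s \<le> parts_primitive \<delta> g t"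
      using parts_primitive_increment(1)[OF g that \<delta>] by linarith
    then show ?thesis using h that by (simp add: ennreal_leI)
  qed
  define L where "L = (SUP t\<in>{0..}. h t)"
  have "(h \<longlongrightarrow> L) at_top"
  proof (rule order_tendstoI)
    fix a assume "a < L"
    then obtain t0 where t0: "t0 \<ge> 0" "a < h t0" unfolding L_def less_SUP_iff by auto
    have "a < h t" if "t \<ge> t0" for t using t0 mono[OF t0(1) that] by (rule_tac less_le_trans)
    then show "\<forall>\<^sub>F t in at_top. a < h t" by (rule eventually_at_top_linorderI)
  next
    fix a assume "L < a"
    have "h t < a" if "t \<ge> 0" for t
    proof -
      have "h t \<le> L" unfolding L_def using that by (intro SUP_upper) auto
      then show ?thesis using \<open>L < a\<close> by simp
    qed
    then show "\<forall>\<^sub>F t in at_top. h t < a" by (rule eventually_at_top_linorderI)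
  qed
  then have "Lim at_top h = L" by (intro tendsto_Lim) auto
  then have "I_exp \<delta> g = L" by (simp add: I_exp_def h_def[abs_def])
  moreover have "h T \<le> L" unfolding L_def using T by (intro SUP_upper) auto
  ultimately show ?thesis using h[OF T] by simp
qed

text \<open>On an equidistant grid the left and right endpoint sums differ by exactly the factor
  \<open>exp (\<delta> * \<eta>)\<close>, and each right endpoint term is below the increment of the
  primitive.\<close>

lemma upper_sum_le_I_exp:
  fixes g :: "real \<Rightarrow> real"
  assumes g: "mono_on {0..} g" and \<delta>: "\<delta> > 0" and \<eta>: "\<eta> > 0"
  shows "(\<Sum>i. ennreal (exp (- \<delta> * (\<eta> * real i)) * (g (\<eta> * real (Suc i)) - g (\<eta> * real i))))
    \<le> ennreal (exp (\<delta> * \<eta>)) * I_exp \<delta> g"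
proof (rule suminf_le_const[OF summableI])
  fix N
  define p where "p i = \<eta> * real i" for i
  have p: "0 \<le> p i" "p i \<le> p (Suc i)" for i using \<eta> by (auto simp: p_def)
  define \<Delta> where "\<Delta> i = g (p (Suc i)) - g (p i)" for i
  have \<Delta>: "0 \<le> \<Delta> i" for i using monotone_onD[OF g, of "p i" "p (Suc i)"] p by (simp add: \<Delta>_def)
  have e: "exp (- \<delta> * p i) = exp (\<delta> * \<eta>) * exp (- \<delta> * p (Suc i))" for i
  proof -
    have "exp (\<delta> * \<eta>) * exp (- \<delta> * p (Suc i)) = exp (\<delta> * \<eta> + - \<delta> * p (Suc i))"
      by (simp only: exp_add)
    also have "\<delta> * \<eta> + - \<delta> * p (Suc i) = - \<delta> * p i" by (simp add: p_def algebra_simps)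
    finally show ?thesis ..
  qed
  have "(\<Sum>i<N. exp (- \<delta> * p i) * \<Delta> i) = exp (\<delta> * \<eta>) * (\<Sum>i<N. exp (- \<delta> * p (Suc i)) * \<Delta> i)"
    unfolding sum_distrib_left
  proof (rule sum.cong[OF refl])
    show "exp (- \<delta> * p i) * \<Delta> i = exp (\<delta> * \<eta>) * (exp (- \<delta> * p (Suc i)) * \<Delta> i)" for i
      unfolding e[of i] mult.assoc ..
  qed
  also have "\<dots> \<le> exp (\<delta> * \<eta>) * (\<Sum>i<N. parts_primitive \<delta> g (p (Suc i)) - parts_primitive \<delta> g (p i))"
    using parts_primitive_increment(1)[OF g p \<delta>] by (intro mult_left_mono sum_mono) (auto simp: \<Delta>_def)
  also have "(\<Sum>i<N. parts_primitive \<delta> g (p (Suc i)) - parts_primitive \<delta> g (p i)) = parts_primitive \<delta> g (p N) - parts_primitive \<delta> g 0"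
    using sum_lessThan_telescope[of "\<lambda>i. parts_primitive \<delta> g (p i)" N] by (simp add: p_def)
  finally have "(\<Sum>i<N. exp (- \<delta> * p i) * \<Delta> i) \<le> exp (\<delta> * \<eta>) * (parts_primitive \<delta> g (p N) - parts_primitive \<delta> g 0)" .
  then have "ennreal (\<Sum>i<N. exp (- \<delta> * p i) * \<Delta> i) \<le> ennreal (exp (\<delta> * \<eta>)) * ennreal (parts_primitive \<delta> g (p N) - parts_primitive \<delta> g 0)"
    by (simp add: ennreal_leI flip: ennreal_mult')
  also have "\<dots> \<le> ennreal (exp (\<delta> * \<eta>)) * I_exp \<delta> g"
    by (intro mult_left_mono RS_integral_exp_le_I_exp[OF g \<delta> p(1)]) simp
  also have "ennreal (\<Sum>i<N. exp (- \<delta> * p i) * \<Delta> i) = (\<Sum>i<N. ennreal (exp (- \<delta> * p i) * \<Delta> i))"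
    using \<Delta> by (intro sum_ennreal[symmetric]) auto
  finally show "(\<Sum>i<N. ennreal (exp (- \<delta> * (\<eta> * real i)) * (g (\<eta> * real (Suc i)) - g (\<eta> * real i))))
    \<le> ennreal (exp (\<delta> * \<eta>)) * I_exp \<delta> g" unfolding p_def \<Delta>_def .
qed

text \<open>A discrete layer-cake formula: \<open>g r\<close> is at most the value at the next grid
  point, which telescopes from \<open>g 0 = 0\<close> into the increments starting at grid points
  not beyond \<open>r\<close>.\<close>

lemma extend_infty_le_layers:
  fixes g :: "real \<Rightarrow> real"
  assumes g: "mono_on {0..} g" "g 0 = 0" and \<eta>: "\<eta> > 0" and r: "0 \<le> r"
  shows "ennreal (g r) \<le> (\<Sum>i. ennreal (g (\<eta> * real (Suc i)) - g (\<eta> * real i)) * (if \<eta> * real i \<le> r then 1 else 0))"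
proof -
  define N where "N = Suc (nat \<lfloor>r / \<eta>\<rfloor>)"
  have fl: "0 \<le> \<lfloor>r / \<eta>\<rfloor>" using r \<eta> by simp
  have "r / \<eta> < real N" unfolding N_def using fl by linarith
  then have rN: "r < \<eta> * real N" using \<eta> by (simp add: field_simps)
  have iN: "\<eta> * real i \<le> r" if "i < N" for i
  proof -
    have "real i \<le> real (nat \<lfloor>r / \<eta>\<rfloor>)" using that by (simp add: N_def)
    also have "\<dots> \<le> r / \<eta>" using fl by linarith
    finally show ?thesis using \<eta> by (simp add: field_simps)
  qed
  have "g r \<le> g (\<eta> * real N)" using monotone_onD[OF g(1), of r "\<eta> * real N"] r rN \<eta> by auto
  also have "\<dots> = (\<Sum>i<N. g (\<eta> * real (Suc i)) - g (\<eta> * real i))"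
    using sum_lessThan_telescope[of "\<lambda>i. g (\<eta> * real i)" N] g(2) by simp
  finally have "ennreal (g r) \<le> ennreal (\<Sum>i<N. g (\<eta> * real (Suc i)) - g (\<eta> * real i))" by (rule ennreal_leI)
  also have "\<dots> = (\<Sum>i<N. ennreal (g (\<eta> * real (Suc i)) - g (\<eta> * real i)))"
  proof (rule sum_ennreal[symmetric])
    show "0 \<le> g (\<eta> * real (Suc i)) - g (\<eta> * real i)" for i
      using monotone_onD[OF g(1), of "\<eta> * real i" "\<eta> * real (Suc i)"] \<eta> by auto
  qed
  also have "\<dots> = (\<Sum>i<N. ennreal (g (\<eta> * real (Suc i)) - g (\<eta> * real i)) * (if \<eta> * real i \<le> r then 1 else 0))"
    using iN by (intro sum.cong) auto
  also have "\<dots> \<le> (\<Sum>i. ennreal (g (\<eta> * real (Suc i)) - g (\<eta> * real i)) * (if \<eta> * real i \<le> r then 1 else 0))"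
    by (intro sum_le_suminf summableI) auto
  finally show ?thesis .
qed

text \<open>Upper sums over a grid of mesh \<open>\<eta>\<close> exceed lower sums at most by the factor
  \<open>exp (\<delta> \<eta>)\<close>, so exponential decay of the superlevel sets bounds the integral without any
  Stieltjes measure.\<close>

lemma nn_integral_extend_infty_le:
  fixes g :: "real \<Rightarrow> real" and s :: "'a \<Rightarrow> ereal"
  assumes g: "mono_on {0..} g" "g 0 = 0" and \<delta>: "\<delta> > 0" and C: "C \<ge> 0"
    and B[measurable]: "B \<in> sets M" and fin: "emeasure M B < \<infinity>"
    and s[measurable]: "s \<in> borel_measurable M" and s0: "\<And>z. z \<in> B \<Longrightarrow> 0 \<le> s z"
    and decay: "\<And>t. 0 \<le> t \<Longrightarrow> emeasure M {z\<in>B. ereal t \<le> s z} \<le> ennreal (C * exp (- \<delta> * t)) * emeasure M B"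
    and I: "I_exp \<delta> g < \<infinity>"
  shows "(\<integral>\<^sup>+z\<in>B. extend_infty g (s z) \<partial>M) \<le> ennreal C * I_exp \<delta> g * emeasure M B"
proof -
  have BM: "B \<subseteq> space M" using B by (rule sets.sets_into_space)
  define S where "S t = {z\<in>B. ereal t \<le> s z}" for t
  have S[measurable]: "S t \<in> sets M" for t
  proof -
    have "S t = B \<inter> {z\<in>space M. ereal t \<le> s z}" using BM by (auto simp: S_def)
    then show ?thesis by simp
  qed
  obtain b where b: "emeasure M B = ennreal b" "0 \<le> b" using fin by (cases "emeasure M B") auto
  \<comment> \<open>The decay at every level makes the set where \<open>s = \<infinity>\<close>
    null, so that layers at finite levels suffice.\<close>
  have AE: "AE z in M. z \<in> B \<longrightarrow> s z \<noteq> \<infinity>"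
  proof -
    have "{z\<in>B. s z = \<infinity>} = B \<inter> {z\<in>space M. s z = \<infinity>}" using BM by auto
    then have m: "{z\<in>B. s z = \<infinity>} \<in> sets M" by simp
    have "emeasure M {z\<in>B. s z = \<infinity>} \<le> ennreal (C * exp (- \<delta> * t) * b)" if "0 \<le> t" for t
    proof -
      have "emeasure M {z\<in>B. s z = \<infinity>} \<le> emeasure M (S t)"
        using S by (intro emeasure_mono) (auto simp: S_def)
      also have "\<dots> \<le> ennreal (C * exp (- \<delta> * t)) * emeasure M B"
        unfolding S_def by (rule decay[OF that])
      finally show ?thesis using C b by (simp add: ennreal_mult')
    qed
    then have "\<forall>\<^sub>F t in at_top. emeasure M {z\<in>B. s z = \<infinity>} \<le> ennreal (C * exp (- \<delta> * t) * b)"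
      by (rule eventually_at_top_linorderI)
    moreover have "((\<lambda>t. ennreal (C * exp (- \<delta> * t) * b)) \<longlongrightarrow> ennreal 0) at_top"
    proof (rule tendsto_ennrealI)
      have "((\<lambda>t. exp (- \<delta> * t)) \<longlongrightarrow> 0) at_top"
        using \<delta> by (intro filterlim_compose[OF exp_at_bot] filterlim_tendsto_neg_mult_at_bot[OF tendsto_const]) (auto intro: filterlim_ident)
      from tendsto_mult_left_zero[OF tendsto_mult_right_zero[OF this, of C], of b]
      show "((\<lambda>t. C * exp (- \<delta> * t) * b) \<longlongrightarrow> 0) at_top" .
    qed
    ultimately have "emeasure M {z\<in>B. s z = \<infinity>} \<le> ennreal 0"
      by (intro tendsto_lowerbound) auto
    then have "emeasure M {z\<in>B. s z = \<infinity>} = 0" by simp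
    then have "{z\<in>B. s z = \<infinity>} \<in> null_sets M" using m by (simp add: null_sets_def)
    then show ?thesis by (rule AE_I') (use BM in auto)
  qed
  have bound: "(\<integral>\<^sup>+z\<in>B. extend_infty g (s z) \<partial>M) \<le> ennreal (exp (\<delta> * \<eta>)) * (ennreal C * I_exp \<delta> g * emeasure M B)"
    if \<eta>: "\<eta> > 0" for \<eta>
  proof -
    define \<Delta> where "\<Delta> i = g (\<eta> * real (Suc i)) - g (\<eta> * real i)" for i
    have \<Delta>0: "0 \<le> \<Delta> i" for i
      using monotone_onD[OF g(1), of "\<eta> * real i" "\<eta> * real (Suc i)"] \<eta> by (auto simp: \<Delta>_def)
    have "(\<integral>\<^sup>+z\<in>B. extend_infty g (s z) \<partial>M) \<le> (\<integral>\<^sup>+z. (\<Sum>i. ennreal (\<Delta> i) * indicator (S (\<eta> * real i)) z) \<partial>M)"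
    proof (rule nn_integral_mono_AE)
      show "AE z in M. extend_infty g (s z) * indicator B z \<le> (\<Sum>i. ennreal (\<Delta> i) * indicator (S (\<eta> * real i)) z)"
        using AE
      proof eventually_elim
        case (elim z)
        show ?case
        proof (cases "z \<in> B")
          case True
          then obtain r where r: "s z = ereal r" "0 \<le> r" using elim s0[OF True] by (cases "s z") auto
          have "extend_infty g (s z) = ennreal (g r)" by (simp add: extend_infty_def r)
          also have "\<dots> \<le> (\<Sum>i. ennreal (\<Delta> i) * (if \<eta> * real i \<le> r then 1 else 0))"
            unfolding \<Delta>_def by (rule extend_infty_le_layers[OF g \<eta> r(2)])
          also have "\<dots> = (\<Sum>i. ennreal (\<Delta> i) * indicator (S (\<eta> * real i)) z)"
            using True by (simp add: S_def r indicator_def of_bool_def)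
          finally show ?thesis using True by simp
        qed simp
      qed
    qed
    also have "\<dots> = (\<Sum>i. \<integral>\<^sup>+z. ennreal (\<Delta> i) * indicator (S (\<eta> * real i)) z \<partial>M)"
      by (rule nn_integral_suminf) simp
    also have "\<dots> = (\<Sum>i. ennreal (\<Delta> i) * emeasure M (S (\<eta> * real i)))"
      by (simp add: nn_integral_cmult_indicator)
    also have "\<dots> \<le> (\<Sum>i. ennreal (exp (- \<delta> * (\<eta> * real i)) * \<Delta> i) * (ennreal C * emeasure M B))"
    proof (intro suminf_le summableI)
      fix i
      have "emeasure M (S (\<eta> * real i)) \<le> ennreal (C * exp (- \<delta> * (\<eta> * real i))) * emeasure M B"
        unfolding S_def using \<eta> by (intro decay) auto
      then have "ennreal (\<Delta> i) * emeasure M (S (\<eta> * real i)) \<le> ennreal (\<Delta> i) * (ennreal (C * exp (- \<delta> * (\<eta> * real i))) * emeasure M B)"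
        by (rule mult_left_mono) simp
      also have "\<dots> = ennreal (exp (- \<delta> * (\<eta> * real i)) * \<Delta> i) * (ennreal C * emeasure M B)"
        using C \<Delta>0[of i] by (simp add: ennreal_mult mult_ac)
      finally show "ennreal (\<Delta> i) * emeasure M (S (\<eta> * real i)) \<le> ennreal (exp (- \<delta> * (\<eta> * real i)) * \<Delta> i) * (ennreal C * emeasure M B)" .
    qed
    also have "\<dots> = (\<Sum>i. ennreal (exp (- \<delta> * (\<eta> * real i)) * \<Delta> i)) * (ennreal C * emeasure M B)"
      by (rule ennreal_suminf_multc)
    also have "\<dots> \<le> (ennreal (exp (\<delta> * \<eta>)) * I_exp \<delta> g) * (ennreal C * emeasure M B)"
      unfolding \<Delta>_def by (intro mult_right_mono upper_sum_le_I_exp[OF g(1) \<delta> \<eta>]) simp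
    finally show ?thesis by (simp add: mult_ac)
  qed
  obtain j where j: "I_exp \<delta> g = ennreal j" "0 \<le> j" using I by (cases "I_exp \<delta> g") auto
  have Y: "ennreal C * I_exp \<delta> g * emeasure M B = ennreal (C * j * b)"
    using C j b by (simp add: ennreal_mult)
  \<comment> \<open>The mesh \<open>1 / (n + 1)\<close> tends to 0 and takes the factor
    \<open>exp (\<delta> * \<eta>)\<close> to 1.\<close>
  have "(\<lambda>n. ennreal (exp (\<delta> * inverse (real (Suc n))) * (C * j * b))) \<longlonglongrightarrow> ennreal (exp (\<delta> * 0) * (C * j * b))"
    by (intro tendsto_ennrealI tendsto_intros LIMSEQ_inverse_real_of_nat)
  moreover have "(\<integral>\<^sup>+z\<in>B. extend_infty g (s z) \<partial>M) \<le> ennreal (exp (\<delta> * inverse (real (Suc n))) * (C * j * b))" for n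
    using bound[of "inverse (real (Suc n))"] C j(2) b(2) unfolding Y by (simp add: ennreal_mult')
  ultimately show ?thesis unfolding Y
    by (intro LIMSEQ_le_const[of _ "ennreal (C * j * b)"]) auto
qed

section \<open>Integration over lines\<close>

text \<open>Integration over the lines through the origin without a measure on the space of lines: the
  kernel \<open>k\<close> gives every annulus \<open>norm y / 2 \<le> norm \<zeta> \<le> norm y\<close> the same mass \<open>\<kappa>\<close>, so averaging
  over \<open>\<zeta>\<close> costs only the constant factor \<open>\<kappa>\<close>.\<close>

lemma emeasure_le_of_lines:
  fixes \<mu> :: "'a::{real_normed_vector, second_countable_topology} measure"
    and act :: "'k::euclidean_space \<Rightarrow> 'a \<Rightarrow> 'a" and k w :: "'k \<Rightarrow> ennreal"
  assumes \<mu>: "sigma_finite_measure \<mu>" and sets\<mu>[measurable_cong]: "sets \<mu> = sets borel"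
    and act[measurable]: "(\<lambda>p. act (snd p) (fst p)) \<in> borel_measurable (borel \<Otimes>\<^sub>M borel)"
    and k[measurable]: "k \<in> borel_measurable borel" and w[measurable]: "w \<in> borel_measurable borel"
    and norm_act: "\<And>\<zeta> y. k \<zeta> \<noteq> 0 \<Longrightarrow> norm (act \<zeta> y) = norm \<zeta> * norm y" and k0: "k 0 = 0"
    and hom: "\<And>\<zeta> f. k \<zeta> \<noteq> 0 \<Longrightarrow> f \<in> borel_measurable borel \<Longrightarrow> w \<zeta> * (\<integral>\<^sup>+y. f (act \<zeta> y) \<partial>\<mu>) = (\<integral>\<^sup>+y. f y \<partial>\<mu>)"
    and \<kappa>: "\<And>\<rho>. 0 < \<rho> \<Longrightarrow> (\<integral>\<^sup>+\<zeta>. k \<zeta> * indicator {\<zeta>. norm \<zeta> \<le> \<rho> \<and> \<rho> \<le> 2 * norm \<zeta>} \<zeta> \<partial>lborel) = \<kappa>"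
    and \<kappa>0: "\<kappa> \<noteq> 0" "\<kappa> \<noteq> \<infinity>"
    and A[measurable]: "A \<in> sets borel" and A0: "0 \<notin> A" and B[measurable]: "B \<in> sets borel"
    and lines: "\<And>y. y \<noteq> 0 \<Longrightarrow> (\<integral>\<^sup>+\<zeta>. k \<zeta> * w \<zeta> * indicator A (act \<zeta> y) \<partial>lborel)
        \<le> c * (\<integral>\<^sup>+\<zeta>. k \<zeta> * w \<zeta> * indicator B (act \<zeta> y) \<partial>lborel)"
  shows "emeasure \<mu> A \<le> c * emeasure \<mu> B"
proof -
  interpret pair_sigma_finite \<mu> "lborel :: 'k measure"
    using \<mu> lborel.sigma_finite_measure_axioms by (rule pair_sigma_finite.intro)
  have [measurable]: "(\<lambda>p. act (snd p) (fst p)) \<in> borel_measurable (\<mu> \<Otimes>\<^sub>M lborel)"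
    using act by (simp add: measurable_cong_sets[OF sets_pair_measure_cong[OF sets\<mu> sets_lborel] refl])
  define \<Psi> where "\<Psi> = {y::'a. 1 \<le> norm y \<and> norm y \<le> 2}"
  have [measurable]: "\<Psi> \<in> sets borel" by (simp add: \<Psi>_def)
  \<comment> \<open>For fixed \<open>\<zeta>\<close> the substitution of
    \<open>act \<zeta> y\<close> for \<open>y\<close> has Jacobian \<open>w \<zeta>\<close> and
    turns the shell \<open>\<Psi>\<close> into
    \<open>norm \<zeta> \<le> norm y \<le> 2 * norm \<zeta>\<close>. Exchanging the integrals again
    leaves \<open>\<kappa>\<close> for every \<open>y\<close> in \<open>D\<close>.\<close>
  have avg: "(\<integral>\<^sup>+y. indicator \<Psi> y * (\<integral>\<^sup>+\<zeta>. k \<zeta> * w \<zeta> * indicator D (act \<zeta> y) \<partial>lborel) \<partial>\<mu>) = \<kappa> * emeasure \<mu> D"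
    if D[measurable]: "D \<in> sets borel" and D0: "0 \<notin> D" for D
  proof -
    have [measurable]: "D \<in> sets \<mu>" using D by (simp add: sets\<mu>)
    have "(\<integral>\<^sup>+y. indicator \<Psi> y * (\<integral>\<^sup>+\<zeta>. k \<zeta> * w \<zeta> * indicator D (act \<zeta> y) \<partial>lborel) \<partial>\<mu>)
        = (\<integral>\<^sup>+y. (\<integral>\<^sup>+\<zeta>. indicator \<Psi> y * (k \<zeta> * w \<zeta> * indicator D (act \<zeta> y)) \<partial>lborel) \<partial>\<mu>)"
    proof (intro nn_integral_cong nn_integral_cmult[symmetric])
      fix y
      have [measurable]: "(\<lambda>\<zeta>. act \<zeta> y) \<in> borel_measurable borel"
        using measurable_compose[OF _ act, of "\<lambda>\<zeta>. (y, \<zeta>)" borel] by simp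
      show "(\<lambda>\<zeta>. k \<zeta> * w \<zeta> * indicator D (act \<zeta> y)) \<in> borel_measurable lborel" by measurable
    qed
    also have "\<dots> = (\<integral>\<^sup>+\<zeta>. (\<integral>\<^sup>+y. indicator \<Psi> y * (k \<zeta> * w \<zeta> * indicator D (act \<zeta> y)) \<partial>\<mu>) \<partial>lborel)"
      by (rule Fubini'[symmetric]) measurable
    also have "\<dots> = (\<integral>\<^sup>+\<zeta>. (\<integral>\<^sup>+y. k \<zeta> * indicator {\<zeta>. norm \<zeta> \<le> norm y \<and> norm y \<le> 2 * norm \<zeta>} \<zeta> * indicator D y \<partial>\<mu>) \<partial>lborel)"
    proof (rule nn_integral_cong)
      fix \<zeta> :: 'k
      show "(\<integral>\<^sup>+y. indicator \<Psi> y * (k \<zeta> * w \<zeta> * indicator D (act \<zeta> y)) \<partial>\<mu>)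
          = (\<integral>\<^sup>+y. k \<zeta> * indicator {\<zeta>. norm \<zeta> \<le> norm y \<and> norm y \<le> 2 * norm \<zeta>} \<zeta> * indicator D y \<partial>\<mu>)"
      proof (cases "k \<zeta> = 0")
        case False
        then have \<zeta>: "0 < norm \<zeta>" using k0 by auto
        define R where "R = {y::'a. norm \<zeta> \<le> norm y \<and> norm y \<le> 2 * norm \<zeta>}"
        have [measurable]: "R \<in> sets borel" by (simp add: R_def)
        have "act \<zeta> y \<in> R \<longleftrightarrow> y \<in> \<Psi>" for y
        proof -
          have "norm \<zeta> * 1 \<le> norm \<zeta> * norm y \<longleftrightarrow> 1 \<le> norm y" "norm \<zeta> * norm y \<le> norm \<zeta> * 2 \<longleftrightarrow> norm y \<le> 2"
            using \<zeta> by (simp_all only: mult_le_cancel_left_pos)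
          then show ?thesis using norm_act[OF False, of y] by (simp add: R_def \<Psi>_def mult.commute)
        qed
        then have ind: "indicator \<Psi> y = (indicator R (act \<zeta> y) :: ennreal)" for y by (simp add: indicator_def)
        have [measurable]: "(\<lambda>y. act \<zeta> y) \<in> borel_measurable borel"
          using measurable_compose[OF _ act, of "\<lambda>y. (y, \<zeta>)" borel] by simp
        have "(\<integral>\<^sup>+y. indicator \<Psi> y * (k \<zeta> * w \<zeta> * indicator D (act \<zeta> y)) \<partial>\<mu>)
            = (\<integral>\<^sup>+y. (k \<zeta> * w \<zeta>) * (indicator R (act \<zeta> y) * indicator D (act \<zeta> y)) \<partial>\<mu>)"
          unfolding ind by (simp add: mult_ac)
        also have "\<dots> = (k \<zeta> * w \<zeta>) * (\<integral>\<^sup>+y. indicator R (act \<zeta> y) * indicator D (act \<zeta> y) \<partial>\<mu>)"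
          by (rule nn_integral_cmult) measurable
        also have "\<dots> = k \<zeta> * (w \<zeta> * (\<integral>\<^sup>+y. indicator R (act \<zeta> y) * indicator D (act \<zeta> y) \<partial>\<mu>))"
          by (simp add: mult_ac)
        also have "w \<zeta> * (\<integral>\<^sup>+y. indicator R (act \<zeta> y) * indicator D (act \<zeta> y) \<partial>\<mu>) = (\<integral>\<^sup>+y. indicator R y * indicator D y \<partial>\<mu>)"
          using hom[OF False, of "\<lambda>y. indicator R y * indicator D y"] by simp
        also have "k \<zeta> * (\<integral>\<^sup>+y. indicator R y * indicator D y \<partial>\<mu>) = (\<integral>\<^sup>+y. k \<zeta> * (indicator R y * indicator D y) \<partial>\<mu>)"
          by (rule nn_integral_cmult[symmetric]) measurable
        finally show ?thesis by (simp add: R_def indicator_def mult_ac)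
      qed simp
    qed
    also have "\<dots> = (\<integral>\<^sup>+y. (\<integral>\<^sup>+\<zeta>. k \<zeta> * indicator {\<zeta>. norm \<zeta> \<le> norm y \<and> norm y \<le> 2 * norm \<zeta>} \<zeta> * indicator D y \<partial>lborel) \<partial>\<mu>)"
    proof (rule Fubini')
      have "(\<lambda>p. k (snd p) * (if norm (snd p) \<le> norm (fst p) \<and> norm (fst p) \<le> 2 * norm (snd p) then 1 else 0) * indicator D (fst p))
        \<in> borel_measurable (\<mu> \<Otimes>\<^sub>M (lborel :: 'k measure))"
        by measurable
      then show "(\<lambda>(y, \<zeta>). k \<zeta> * indicator {\<zeta>. norm \<zeta> \<le> norm y \<and> norm y \<le> 2 * norm \<zeta>} \<zeta> * indicator D y)
        \<in> borel_measurable (\<mu> \<Otimes>\<^sub>M (lborel :: 'k measure))"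
        by (simp add: case_prod_beta indicator_def[of "{_. _}"])
    qed
    also have "\<dots> = (\<integral>\<^sup>+y. \<kappa> * indicator D y \<partial>\<mu>)"
    proof (rule nn_integral_cong)
      fix y :: 'a
      show "(\<integral>\<^sup>+\<zeta>. k \<zeta> * indicator {\<zeta>. norm \<zeta> \<le> norm y \<and> norm y \<le> 2 * norm \<zeta>} \<zeta> * indicator D y \<partial>lborel) = \<kappa> * indicator D y"
      proof (cases "y \<in> D")
        case True
        then have "0 < norm y" using D0 by auto
        from \<kappa>[OF this] True show ?thesis by simp
      qed simp
    qed
    also have "\<dots> = \<kappa> * emeasure \<mu> D" by (rule nn_integral_cmult_indicator) measurable
    finally show ?thesis .
  qed
  \<comment> \<open>The averaging identity concerns sets without the origin, since radius 0 has no
    annulus. The line integrals are unchanged, as \<open>act \<zeta> y\<close> is nonzero wherever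
    \<open>k \<zeta>\<close> is.\<close>
  have B0: "B - {0} \<in> sets borel" by measurable
  have "\<kappa> * emeasure \<mu> A \<le> (\<integral>\<^sup>+y. c * (indicator \<Psi> y * (\<integral>\<^sup>+\<zeta>. k \<zeta> * w \<zeta> * indicator (B - {0}) (act \<zeta> y) \<partial>lborel)) \<partial>\<mu>)"
    unfolding avg[OF A A0, symmetric]
  proof (rule nn_integral_mono)
    fix y :: 'a
    show "indicator \<Psi> y * (\<integral>\<^sup>+\<zeta>. k \<zeta> * w \<zeta> * indicator A (act \<zeta> y) \<partial>lborel)
      \<le> c * (indicator \<Psi> y * (\<integral>\<^sup>+\<zeta>. k \<zeta> * w \<zeta> * indicator (B - {0}) (act \<zeta> y) \<partial>lborel))"
    proof (cases "y \<in> \<Psi>")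
      case True
      then have y: "y \<noteq> 0" by (auto simp: \<Psi>_def)
      have "(\<integral>\<^sup>+\<zeta>. k \<zeta> * w \<zeta> * indicator (B - {0}) (act \<zeta> y) \<partial>lborel) = (\<integral>\<^sup>+\<zeta>. k \<zeta> * w \<zeta> * indicator B (act \<zeta> y) \<partial>lborel)"
      proof (rule nn_integral_cong)
        fix \<zeta>
        have "act \<zeta> y \<noteq> 0" if "k \<zeta> \<noteq> 0"
        proof -
          have "norm (act \<zeta> y) \<noteq> 0" using norm_act[OF that, of y] y that k0 by auto
          then show ?thesis by simp
        qed
        then show "k \<zeta> * w \<zeta> * indicator (B - {0}) (act \<zeta> y) = k \<zeta> * w \<zeta> * indicator B (act \<zeta> y)"
          by (cases "k \<zeta> = 0") (auto simp: indicator_def)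
      qed
      then show ?thesis using lines[OF y] True by simp
    qed simp
  qed
  also have "\<dots> = c * (\<integral>\<^sup>+y. indicator \<Psi> y * (\<integral>\<^sup>+\<zeta>. k \<zeta> * w \<zeta> * indicator (B - {0}) (act \<zeta> y) \<partial>lborel) \<partial>\<mu>)"
    by (rule nn_integral_cmult) measurable
  also have "\<dots> = c * (\<kappa> * emeasure \<mu> (B - {0}))" by (subst avg[OF B0]) auto
  also have "\<dots> \<le> c * (\<kappa> * emeasure \<mu> B)"
    by (intro mult_left_mono emeasure_mono) (auto simp: sets\<mu>)
  finally have "\<kappa> * emeasure \<mu> A \<le> \<kappa> * (c * emeasure \<mu> B)" by (simp add: mult_ac)
  then show ?thesis using \<kappa>0 by (simp add: ennreal_mult_le_mult_iff)
qed

text \<open>\<open>1 / \<tau>\<close> is the scale-invariant density on the positive axis, so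
  \<open>{\<rho> / 2..\<rho>}\<close> has mass \<open>ln 2\<close> for every \<open>\<rho>\<close>;
  times the Jacobian \<open>\<tau> ^ d\<close> it is the polar weight.\<close>

lemma emeasure_le_of_rays:
  fixes \<mu> :: "'a::{real_normed_vector, second_countable_topology} measure"
  assumes \<mu>: "sigma_finite_measure \<mu>" "sets \<mu> = sets borel"
    and hom: "\<And>\<tau> f. 0 < \<tau> \<Longrightarrow> f \<in> borel_measurable borel \<Longrightarrow> ennreal (\<tau> ^ d) * (\<integral>\<^sup>+y. f (\<tau> *\<^sub>R y) \<partial>\<mu>) = (\<integral>\<^sup>+y. f y \<partial>\<mu>)"
    and d: "0 < d" and A: "A \<in> sets borel" "0 \<notin> A" and B: "B \<in> sets borel"
    and rays: "\<And>y. y \<noteq> 0 \<Longrightarrow> (\<integral>\<^sup>+\<tau>\<in>{0<..}. ennreal (\<tau> ^ (d - 1)) * indicator A (\<tau> *\<^sub>R y) \<partial>lborel)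
        \<le> c * (\<integral>\<^sup>+\<tau>\<in>{0<..}. ennreal (\<tau> ^ (d - 1)) * indicator B (\<tau> *\<^sub>R y) \<partial>lborel)"
  shows "emeasure \<mu> A \<le> c * emeasure \<mu> B"
proof (rule emeasure_le_of_lines[where act = "\<lambda>\<tau> y. \<tau> *\<^sub>R y" and k = "\<lambda>\<tau>. ennreal (1 / \<tau>) * indicator {0<..} \<tau>"
    and w = "\<lambda>\<tau>. ennreal (\<tau> ^ d)" and \<kappa> = "ennreal (ln 2)", OF \<mu> _ _ _ _ _ _ _ _ _ A B])
  have "(\<lambda>p::'a \<times> real. snd p *\<^sub>R fst p) \<in> borel_measurable borel"
    by (intro borel_measurable_continuous_onI continuous_intros)
  then show "(\<lambda>p::'a \<times> real. snd p *\<^sub>R fst p) \<in> borel_measurable (borel \<Otimes>\<^sub>M borel)"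
    by (simp add: borel_prod)
  show "(\<integral>\<^sup>+\<tau>. ennreal (1 / \<tau>) * indicator {0<..} \<tau> * indicator {\<tau>. norm \<tau> \<le> \<rho> \<and> \<rho> \<le> 2 * norm \<tau>} \<tau> \<partial>lborel) = ennreal (ln 2)"
    if \<rho>: "0 < \<rho>" for \<rho> :: real
  proof -
    have "(\<integral>\<^sup>+\<tau>. ennreal (1 / \<tau>) * indicator {0<..} \<tau> * indicator {\<tau>. norm \<tau> \<le> \<rho> \<and> \<rho> \<le> 2 * norm \<tau>} \<tau> \<partial>lborel)
        = (\<integral>\<^sup>+\<tau>. ennreal (1 / \<tau>) * indicator {\<rho> / 2..\<rho>} \<tau> \<partial>lborel)"
      using \<rho> by (intro nn_integral_cong) (auto simp: indicator_def)
    also have "\<dots> = ennreal (ln \<rho> - ln (\<rho> / 2))"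
      using \<rho> by (intro nn_integral_FTC_Icc) (auto intro!: derivative_eq_intros)
    also have "ln \<rho> - ln (\<rho> / 2) = ln 2" using \<rho> by (simp add: ln_divide_pos)
    finally show ?thesis .
  qed
  have eq: "ennreal (1 / \<tau>) * indicator {0<..} \<tau> * ennreal (\<tau> ^ d) * x = ennreal (\<tau> ^ (d - 1)) * x * indicator {0<..} \<tau>" for \<tau> x
  proof (cases "0 < \<tau>")
    case True
    obtain e where e: "d = Suc e" using d by (cases d) auto
    have "ennreal (1 / \<tau>) * ennreal (\<tau> ^ d) = ennreal (1 / \<tau> * \<tau> ^ d)" using True by (intro ennreal_mult[symmetric]) auto
    also have "1 / \<tau> * \<tau> ^ d = \<tau> ^ (d - 1)" using True by (simp add: e)
    finally show ?thesis using True by simp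
  qed simp
  show "(\<integral>\<^sup>+\<tau>. ennreal (1 / \<tau>) * indicator {0<..} \<tau> * ennreal (\<tau> ^ d) * indicator A (\<tau> *\<^sub>R y) \<partial>lborel)
      \<le> c * (\<integral>\<^sup>+\<tau>. ennreal (1 / \<tau>) * indicator {0<..} \<tau> * ennreal (\<tau> ^ d) * indicator B (\<tau> *\<^sub>R y) \<partial>lborel)"
    if "y \<noteq> 0" for y :: 'a
    unfolding eq by (rule rays[OF that])
  show "ennreal (\<tau> ^ d) * (\<integral>\<^sup>+y. f (\<tau> *\<^sub>R y) \<partial>\<mu>) = (\<integral>\<^sup>+y. f y \<partial>\<mu>)"
    if "ennreal (1 / \<tau>) * indicator {0<..} \<tau> \<noteq> 0" "f \<in> borel_measurable borel" for \<tau> f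
    using that by (intro hom) (auto simp: indicator_def split: if_splits)
qed (auto simp: indicator_def split: if_splits)

lemma norm_vector_scalar_mult: "norm (\<zeta> *s z) = norm \<zeta> * norm (z :: complex ^ 'n)"
  by (simp add: norm_vec_def L2_set_def norm_mult power_mult_distrib real_sqrt_mult flip: sum_distrib_left)

lemma linear_vector_scalar_mult: "linear (\<lambda>z :: complex ^ 'n. \<zeta> *s z)"
  by (rule linearI) (simp_all add: vec_eq_iff algebra_simps)

lemma continuous_on_vector_scalar_mult [continuous_intros]:
  fixes g :: "'a::topological_space \<Rightarrow> complex ^ 'n"
  assumes "continuous_on S f" "continuous_on S g"
  shows "continuous_on S (\<lambda>x. f x *s g x)"
  unfolding vector_scalar_mult_def using assms
  by (intro continuous_on_vec_lambda continuous_intros)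

text \<open>The scale-invariant density of the punctured plane is
  \<open>1 / |\<zeta>|\<^sup>2\<close>, and multiplication by \<open>\<zeta>\<close> has Jacobian
  \<open>|\<zeta>| ^ (2n)\<close>. The mass \<open>\<kappa>\<close> of an annulus cancels in the
  end, so only its positivity and finiteness are established.\<close>

lemma emeasure_le_of_complex_lines:
  fixes A B :: "(complex ^ 'n) set"
  assumes A: "A \<in> sets borel" "0 \<notin> A" and B: "B \<in> sets borel"
    and lines: "\<And>y. y \<noteq> 0 \<Longrightarrow> (\<integral>\<^sup>+\<zeta>. ennreal (norm \<zeta> ^ (2 * (CARD('n) - 1))) * indicator A (\<zeta> *s y) \<partial>lborel)
        \<le> c * (\<integral>\<^sup>+\<zeta>. ennreal (norm \<zeta> ^ (2 * (CARD('n) - 1))) * indicator B (\<zeta> *s y) \<partial>lborel)"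
  shows "emeasure lborel A \<le> c * emeasure lborel B"
proof -
  let ?k = "\<lambda>\<zeta>::complex. ennreal (1 / (norm \<zeta>)\<^sup>2)"
  let ?w = "\<lambda>\<zeta>::complex. ennreal (norm \<zeta> ^ (2 * CARD('n)))"
  define \<kappa> where "\<kappa> = (\<integral>\<^sup>+\<zeta>. ?k \<zeta> * indicator {\<zeta>. norm \<zeta> \<le> 1 \<and> 1 \<le> 2 * norm \<zeta>} \<zeta> \<partial>lborel)"
  have kz: "?k \<zeta> \<noteq> 0 \<longleftrightarrow> \<zeta> \<noteq> 0" for \<zeta> by simp
  show ?thesis
  proof (rule emeasure_le_of_lines[where act = "(*s)" and k = ?k and w = ?w and \<kappa> = \<kappa>, OF _ _ _ _ _ _ _ _ _ _ _ A B])
    have "(\<lambda>p::(complex ^ 'n) \<times> complex. snd p *s fst p) \<in> borel_measurable borel"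
      by (intro borel_measurable_continuous_onI continuous_intros)
    then show "(\<lambda>p::(complex ^ 'n) \<times> complex. snd p *s fst p) \<in> borel_measurable (borel \<Otimes>\<^sub>M borel)"
      by (simp add: borel_prod)
    show "?w \<zeta> * (\<integral>\<^sup>+y. f (\<zeta> *s y) \<partial>lborel) = (\<integral>\<^sup>+y. f y \<partial>lborel)"
      if "?k \<zeta> \<noteq> 0" and f: "f \<in> borel_measurable borel" for \<zeta> and f :: "complex ^ 'n \<Rightarrow> ennreal"
    proof -
      have \<zeta>: "norm \<zeta> > 0" using that by simp
      have "(\<integral>\<^sup>+y. f y \<partial>lborel) = ennreal (norm \<zeta> ^ DIM(complex ^ 'n)) * (\<integral>\<^sup>+y. f (\<zeta> *s y) \<partial>lborel)"
        by (rule nn_integral_lborel_similarity[OF linear_vector_scalar_mult norm_vector_scalar_mult \<zeta> f])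
      then show ?thesis by (simp add: mult.commute)
    qed
    show "(\<integral>\<^sup>+\<zeta>. ?k \<zeta> * indicator {\<zeta>. norm \<zeta> \<le> \<rho> \<and> \<rho> \<le> 2 * norm \<zeta>} \<zeta> \<partial>lborel) = \<kappa>" if \<rho>: "0 < \<rho>" for \<rho>
    proof -
      have "(\<integral>\<^sup>+\<zeta>. ?k \<zeta> * indicator {\<zeta>. norm \<zeta> \<le> \<rho> \<and> \<rho> \<le> 2 * norm \<zeta>} \<zeta> \<partial>lborel)
          = ennreal (\<rho> ^ DIM(complex)) * (\<integral>\<^sup>+\<zeta>. ?k (\<rho> *\<^sub>R \<zeta>) * indicator {\<zeta>. norm \<zeta> \<le> \<rho> \<and> \<rho> \<le> 2 * norm \<zeta>} (\<rho> *\<^sub>R \<zeta>) \<partial>lborel)"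
        by (rule nn_integral_lborel_similarity) (use \<rho> in \<open>simp_all add: linear_scale_self\<close>)
      also have "\<dots> = (\<integral>\<^sup>+\<zeta>. ennreal (\<rho> ^ 2) * (?k (\<rho> *\<^sub>R \<zeta>) * indicator {\<zeta>. norm \<zeta> \<le> \<rho> \<and> \<rho> \<le> 2 * norm \<zeta>} (\<rho> *\<^sub>R \<zeta>)) \<partial>lborel)"
        by (simp add: nn_integral_cmult)
      also have "\<dots> = \<kappa>" unfolding \<kappa>_def
      proof (rule nn_integral_cong)
        fix \<zeta> :: complex
        have "ennreal (\<rho> ^ 2) * ?k (\<rho> *\<^sub>R \<zeta>) = ennreal (\<rho> ^ 2 * (1 / (norm (\<rho> *\<^sub>R \<zeta>))\<^sup>2))"
          by (intro ennreal_mult[symmetric]) auto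
        also have "\<rho> ^ 2 * (1 / (norm (\<rho> *\<^sub>R \<zeta>))\<^sup>2) = 1 / (norm \<zeta>)\<^sup>2"
          using \<rho> by (simp add: power_mult_distrib)
        finally have 1: "ennreal (\<rho> ^ 2) * ?k (\<rho> *\<^sub>R \<zeta>) = ?k \<zeta>" .
        have "norm (\<rho> *\<^sub>R \<zeta>) \<le> \<rho> \<longleftrightarrow> norm \<zeta> \<le> 1" "\<rho> \<le> 2 * norm (\<rho> *\<^sub>R \<zeta>) \<longleftrightarrow> 1 \<le> 2 * norm \<zeta>"
          using \<rho> mult_le_cancel_left_pos[OF \<rho>, of "norm \<zeta>" 1] mult_le_cancel_left_pos[OF \<rho>, of 1 "2 * norm \<zeta>"] by (auto simp: mult_ac)
        then have 2: "indicator {\<zeta>. norm \<zeta> \<le> \<rho> \<and> \<rho> \<le> 2 * norm \<zeta>} (\<rho> *\<^sub>R \<zeta>) = (indicator {\<zeta>. norm \<zeta> \<le> 1 \<and> 1 \<le> 2 * norm \<zeta>} \<zeta> :: ennreal)"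
          by (simp add: indicator_def)
        show "ennreal (\<rho> ^ 2) * (?k (\<rho> *\<^sub>R \<zeta>) * indicator {\<zeta>. norm \<zeta> \<le> \<rho> \<and> \<rho> \<le> 2 * norm \<zeta>} (\<rho> *\<^sub>R \<zeta>))
            = ?k \<zeta> * indicator {\<zeta>. norm \<zeta> \<le> 1 \<and> 1 \<le> 2 * norm \<zeta>} \<zeta>"
          unfolding mult.assoc[symmetric] 1 2 ..
      qed
      finally show ?thesis .
    qed
    \<comment> \<open>A disc inside the annulus, where the density is at least 1, witnesses
      \<open>\<kappa> > 0\<close>.\<close>
    have sub: "ball (3/4) (1/4) \<subseteq> {\<zeta>::complex. norm \<zeta> \<le> 1 \<and> 1 \<le> 2 * norm \<zeta>}"
    proof
      fix \<zeta> :: complex assume "\<zeta> \<in> ball (3/4) (1/4)"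
      then have d: "norm (3/4 - \<zeta>) < 1/4" by (simp add: dist_norm)
      have "norm (3/4 :: complex) \<le> norm (3/4 - \<zeta>) + norm \<zeta>" using norm_triangle_ineq[of "3/4 - \<zeta>" \<zeta>] by simp
      moreover have "norm \<zeta> \<le> norm (3/4 - \<zeta>) + norm (3/4 :: complex)"
        using norm_triangle_ineq4[of "3/4" "3/4 - \<zeta>"] by simp
      moreover have "norm (3/4 :: complex) = 3/4" by (simp add: norm_divide)
      ultimately show "\<zeta> \<in> {\<zeta>. norm \<zeta> \<le> 1 \<and> 1 \<le> 2 * norm \<zeta>}" using d by simp
    qed
    show "\<kappa> \<noteq> 0"
    proof -
      have "0 < emeasure lborel (ball (3/4::complex) (1/4))" by (simp add: emeasure_ball)
      also have "\<dots> = (\<integral>\<^sup>+\<zeta>. indicator (ball (3/4::complex) (1/4)) \<zeta> \<partial>lborel)" by simp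
      also have "\<dots> \<le> \<kappa>" unfolding \<kappa>_def
      proof (rule nn_integral_mono)
        fix \<zeta> :: complex
        show "indicator (ball (3/4) (1/4)) \<zeta> \<le> ?k \<zeta> * indicator {\<zeta>. norm \<zeta> \<le> 1 \<and> 1 \<le> 2 * norm \<zeta>} \<zeta>"
        proof (cases "\<zeta> \<in> ball (3/4) (1/4)")
          case True
          then have n: "norm \<zeta> \<le> 1" "1 \<le> 2 * norm \<zeta>" using sub by auto
          then have "(norm \<zeta>)\<^sup>2 \<le> 1" "0 < (norm \<zeta>)\<^sup>2" by (auto simp: abs_square_le_1)
          then have "1 \<le> 1 / (norm \<zeta>)\<^sup>2" by (simp add: le_divide_eq_1)
          then have "ennreal 1 \<le> ?k \<zeta>" by (rule ennreal_leI)
          then show ?thesis using n True by simp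
        qed simp
      qed
      finally show ?thesis by simp
    qed
    show "\<kappa> \<noteq> \<infinity>"
    proof -
      have "\<kappa> \<le> (\<integral>\<^sup>+\<zeta>. 4 * indicator (cball (0::complex) 1) \<zeta> \<partial>lborel)" unfolding \<kappa>_def
      proof (rule nn_integral_mono)
        fix \<zeta> :: complex
        show "?k \<zeta> * indicator {\<zeta>. norm \<zeta> \<le> 1 \<and> 1 \<le> 2 * norm \<zeta>} \<zeta> \<le> 4 * indicator (cball 0 1) \<zeta>"
        proof (cases "norm \<zeta> \<le> 1 \<and> 1 \<le> 2 * norm \<zeta>")
          case True
          then have "(1/2)\<^sup>2 \<le> (norm \<zeta>)\<^sup>2" by (intro power_mono) auto
          then have "1 / 4 \<le> (norm \<zeta>)\<^sup>2" by (simp add: power2_eq_square)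
          then have "1 / (norm \<zeta>)\<^sup>2 \<le> 1 / (1 / 4)" by (intro divide_left_mono) auto
          then have "?k \<zeta> \<le> ennreal 4" by (intro ennreal_leI) simp
          then show ?thesis using True by simp
        qed simp
      qed
      also have "\<dots> = 4 * emeasure lborel (cball (0::complex) 1)" by (simp add: nn_integral_cmult_indicator)
      also have "\<dots> < \<infinity>" using emeasure_lborel_cball_finite[of "0::complex" 1] by (simp add: ennreal_mult_less_top)
      finally show ?thesis by simp
    qed
    have eq: "?k \<zeta> * ?w \<zeta> * x = ennreal (norm \<zeta> ^ (2 * (CARD('n) - 1))) * x" if "\<zeta> \<noteq> 0" for \<zeta> x
    proof -
      obtain e where e: "CARD('n) = Suc e" using zero_less_card_finite[where 'a='n] by (cases "CARD('n)") auto
      have "?k \<zeta> * ?w \<zeta> = ennreal (1 / (norm \<zeta>)\<^sup>2 * norm \<zeta> ^ (2 * CARD('n)))"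
        by (intro ennreal_mult[symmetric]) auto
      also have "1 / (norm \<zeta>)\<^sup>2 * norm \<zeta> ^ (2 * CARD('n)) = norm \<zeta> ^ (2 * (CARD('n) - 1))"
        using that by (simp add: e power2_eq_square)
      finally show ?thesis by simp
    qed
    have eqI: "(\<integral>\<^sup>+\<zeta>. ?k \<zeta> * ?w \<zeta> * f \<zeta> \<partial>lborel) = (\<integral>\<^sup>+\<zeta>. ennreal (norm \<zeta> ^ (2 * (CARD('n) - 1))) * f \<zeta> \<partial>lborel)" for f
    proof (rule nn_integral_cong_AE)
      have "AE \<zeta> in lborel. \<zeta> \<noteq> (0::complex)" by (rule AE_lborel_singleton)
      then show "AE \<zeta> in lborel. ?k \<zeta> * ?w \<zeta> * f \<zeta> = ennreal (norm \<zeta> ^ (2 * (CARD('n) - 1))) * f \<zeta>"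
        by eventually_elim (rule eq)
    qed
    show "(\<integral>\<^sup>+\<zeta>. ?k \<zeta> * ?w \<zeta> * indicator A (\<zeta> *s y) \<partial>lborel) \<le> c * (\<integral>\<^sup>+\<zeta>. ?k \<zeta> * ?w \<zeta> * indicator B (\<zeta> *s y) \<partial>lborel)"
      if "y \<noteq> 0" for y :: "complex ^ 'n"
      unfolding eqI by (rule lines[OF that])
    show "sigma_finite_measure (lborel :: (complex ^ 'n) measure)" by (rule sigma_finite_lborel)
  qed (simp_all add: norm_vector_scalar_mult)
qed

section \<open>Lebesgue measure on a subspace\<close>

lemma orthonormal_basis_of_finite:
  fixes E :: "'a::euclidean_space set"
  assumes "orthonormal_basis_of G E"
  shows "finite E" "card E \<le> DIM('a)"
proof -
  have "0 \<notin> E" using assms by (force simp: orthonormal_basis_of_def)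
  then have "independent E"
    using assms by (intro pairwise_orthogonal_independent) (auto simp: orthonormal_basis_of_def)
  then show "finite E" "card E \<le> DIM('a)" using independent_bound by auto
qed

lemma subspace_lborel_basis:
  fixes G :: "'a::euclidean_space set"
  assumes "subspace G"
  obtains E where "orthonormal_basis_of G E"
    "subspace_lborel G = distr (\<Pi>\<^sub>M e\<in>E. lborel) borel (\<lambda>x. \<Sum>e\<in>E. x e *\<^sub>R e)"
proof -
  obtain B where "B \<subseteq> G" "pairwise orthogonal B" "\<And>x. x \<in> B \<Longrightarrow> norm x = 1" "span B = G"
    using orthonormal_basis_subspace[OF assms] by metis
  then have "orthonormal_basis_of G B" by (simp add: orthonormal_basis_of_def)
  then have "orthonormal_basis_of G (SOME E. orthonormal_basis_of G E)" by (rule someI)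
  then show ?thesis using that by (simp add: subspace_lborel_def Let_def)
qed

text \<open>On boxes this is the one-dimensional substitution in every coordinate, and boxes
  determine the product measure. The restriction to \<open>E\<close> keeps the map within
  extensional functions.\<close>

lemma nn_integral_PiM_lborel_affine:
  fixes a :: "'i \<Rightarrow> real"
  assumes E[simp]: "finite E" and c: "c > 0" and f: "f \<in> borel_measurable (\<Pi>\<^sub>M i\<in>E. (lborel::real measure))"
  shows "ennreal (c ^ card E) * (\<integral>\<^sup>+x. f (\<lambda>i\<in>E. a i + c * x i) \<partial>(\<Pi>\<^sub>M i\<in>E. lborel)) = (\<integral>\<^sup>+x. f x \<partial>(\<Pi>\<^sub>M i\<in>E. lborel))"
proof -
  interpret product_sigma_finite "\<lambda>i::'i. lborel :: real measure" by standard
  let ?P = "\<Pi>\<^sub>M i\<in>E. (lborel :: real measure)"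
  let ?T = "\<lambda>x. \<lambda>i\<in>E. a i + c * x i"
  have T[measurable]: "?T \<in> measurable ?P ?P"
    by (intro measurable_restrict) simp
  have "density (distr ?P ?P ?T) (\<lambda>_. ennreal (c ^ card E)) = ?P"
  proof (rule PiM_eqI)
    fix A :: "'i \<Rightarrow> real set" assume A: "\<And>i. i \<in> E \<Longrightarrow> A i \<in> sets lborel"
    have PA: "Pi\<^sub>E E A \<in> sets ?P" using A by (intro sets_PiM_I_finite) auto
    have pre: "?T -` Pi\<^sub>E E A \<inter> space ?P = Pi\<^sub>E E (\<lambda>i. (\<lambda>x. a i + c * x) -` A i)"
      by (auto simp: space_PiM PiE_iff)
    have preA: "(\<lambda>x. a i + c * x) -` A i \<in> sets lborel" if "i \<in> E" for i
      using measurable_sets[of "\<lambda>x. a i + c * x" borel borel "A i"] A[OF that] by simp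
    have one: "ennreal c * emeasure lborel ((\<lambda>x. a i + c * x) -` A i) = emeasure lborel (A i)" if "i \<in> E" for i
    proof -
      have "emeasure lborel (A i) = (\<integral>\<^sup>+x. indicator (A i) x \<partial>lborel)" using A[OF that] by simp
      also have "\<dots> = ennreal \<bar>c\<bar> * (\<integral>\<^sup>+x. indicator (A i) (a i + c * x) \<partial>lborel)"
        using A[OF that] c by (intro nn_integral_real_affine) auto
      also have "(\<integral>\<^sup>+x. indicator (A i) (a i + c * x) \<partial>lborel) = (\<integral>\<^sup>+x. indicator ((\<lambda>x. a i + c * x) -` A i) x \<partial>lborel)"
        by (intro nn_integral_cong) (simp add: indicator_def)
      also have "\<dots> = emeasure lborel ((\<lambda>x. a i + c * x) -` A i)" using preA[OF that] by simp
      finally show ?thesis using c by simp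
    qed
    have "emeasure (density (distr ?P ?P ?T) (\<lambda>_. ennreal (c ^ card E))) (Pi\<^sub>E E A)
        = ennreal (c ^ card E) * emeasure (distr ?P ?P ?T) (Pi\<^sub>E E A)"
      using PA by (subst emeasure_density) (auto simp: nn_integral_cmult_indicator)
    also have "emeasure (distr ?P ?P ?T) (Pi\<^sub>E E A) = emeasure ?P (Pi\<^sub>E E (\<lambda>i. (\<lambda>x. a i + c * x) -` A i))"
      using PA by (subst emeasure_distr[OF T]) (simp_all add: pre)
    also have "\<dots> = (\<Prod>i\<in>E. emeasure lborel ((\<lambda>x. a i + c * x) -` A i))"
      using preA by (intro emeasure_PiM) auto
    also have "ennreal (c ^ card E) * \<dots> = (\<Prod>i\<in>E. ennreal c * emeasure lborel ((\<lambda>x. a i + c * x) -` A i))"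
      using c by (simp add: prod.distrib ennreal_power)
    also have "\<dots> = (\<Prod>i\<in>E. emeasure lborel (A i))" using one by (intro prod.cong) auto
    finally show "emeasure (density (distr ?P ?P ?T) (\<lambda>_. ennreal (c ^ card E))) (Pi\<^sub>E E A) = (\<Prod>i\<in>E. emeasure lborel (A i))" .
  qed simp_all
  then have "(\<integral>\<^sup>+x. f x \<partial>?P) = (\<integral>\<^sup>+x. f x \<partial>density (distr ?P ?P ?T) (\<lambda>_. ennreal (c ^ card E)))" by simp
  also have "\<dots> = (\<integral>\<^sup>+x. ennreal (c ^ card E) * f x \<partial>distr ?P ?P ?T)"
    using f by (intro nn_integral_density) auto
  also have "\<dots> = (\<integral>\<^sup>+x. ennreal (c ^ card E) * f (?T x) \<partial>?P)"
    using f by (intro nn_integral_distr T) auto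
  also have "\<dots> = ennreal (c ^ card E) * (\<integral>\<^sup>+x. f (?T x) \<partial>?P)"
    using measurable_compose[OF T f] by (intro nn_integral_cmult) simp
  finally show ?thesis ..
qed

context
  fixes G E :: "'a::euclidean_space set" and \<mu> :: "'a measure"
  assumes GE: "orthonormal_basis_of G E"
    and \<mu>: "\<mu> = distr (\<Pi>\<^sub>M e\<in>E. lborel) borel (\<lambda>x. \<Sum>e\<in>E. x e *\<^sub>R e)"
begin

lemma coordinate_map_measurable [measurable]:
  "(\<lambda>x. \<Sum>e\<in>E. x e *\<^sub>R e) \<in> borel_measurable (\<Pi>\<^sub>M e\<in>E. (lborel::real measure))"
  by (intro borel_measurable_sum borel_measurable_scaleR borel_measurable_const)
    (metis measurable_component_singleton measurable_lborel1)

text \<open>Translations by points of \<open>G\<close> (\<open>c = 1\<close>) and dilations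
  (\<open>x0 = 0\<close>) at once, both acting coordinatewise. They serve to move a maximum point to
  the origin and to supply the Jacobian along rays.\<close>

lemma nn_integral_subspace_affine:
  assumes c: "c > 0" and x0: "x0 \<in> G" and f[measurable]: "f \<in> borel_measurable borel"
  shows "ennreal (c ^ card E) * (\<integral>\<^sup>+y. f (x0 + c *\<^sub>R y) \<partial>\<mu>) = (\<integral>\<^sup>+y. f y \<partial>\<mu>)"
proof -
  let ?\<Phi> = "\<lambda>x. \<Sum>e\<in>E. x e *\<^sub>R e"
  have fin: "finite E" by (rule orthonormal_basis_of_finite(1)[OF GE])
  have "x0 \<in> span E" using x0 GE by (simp add: orthonormal_basis_of_def)
  then obtain a where a: "x0 = (\<Sum>e\<in>E. a e *\<^sub>R e)" using span_finite[OF fin] by auto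
  have \<Phi>: "?\<Phi> (\<lambda>e\<in>E. a e + c * x e) = x0 + c *\<^sub>R ?\<Phi> x" for x
    by (simp add: a scaleR_sum_right scaleR_add_left sum.distrib)
  have "(\<integral>\<^sup>+y. f y \<partial>\<mu>) = (\<integral>\<^sup>+x. f (?\<Phi> x) \<partial>(\<Pi>\<^sub>M e\<in>E. lborel))"
    unfolding \<mu> by (rule nn_integral_distr) measurable
  also have "\<dots> = ennreal (c ^ card E) * (\<integral>\<^sup>+x. f (?\<Phi> (\<lambda>e\<in>E. a e + c * x e)) \<partial>(\<Pi>\<^sub>M e\<in>E. lborel))"
    by (rule nn_integral_PiM_lborel_affine[OF fin c, symmetric]) measurable
  also have "(\<integral>\<^sup>+x. f (?\<Phi> (\<lambda>e\<in>E. a e + c * x e)) \<partial>(\<Pi>\<^sub>M e\<in>E. lborel)) = (\<integral>\<^sup>+y. f (x0 + c *\<^sub>R y) \<partial>\<mu>)"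
    unfolding \<mu> \<Phi> by (rule nn_integral_distr[symmetric]) measurable
  finally show ?thesis ..
qed

text \<open>Each coordinate is the inner product with a unit vector, hence bounded by the norm; the
  preimage of a bounded set lies in a cube.\<close>

lemma emeasure_subspace_bounded:
  assumes "bounded S" "S \<in> sets borel"
  shows "emeasure \<mu> S < \<infinity>"
proof -
  interpret product_sigma_finite "\<lambda>e::'a. lborel :: real measure" by standard
  let ?\<Phi> = "\<lambda>x. \<Sum>e\<in>E. x e *\<^sub>R e"
  have fin: "finite E" by (rule orthonormal_basis_of_finite(1)[OF GE])
  obtain R where R: "\<And>x. x \<in> S \<Longrightarrow> norm x \<le> R" using assms(1) by (auto simp: bounded_iff)
  have sub: "?\<Phi> -` S \<inter> space (\<Pi>\<^sub>M e\<in>E. lborel) \<subseteq> Pi\<^sub>E E (\<lambda>e. {-R..R})"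
  proof
    fix x assume x: "x \<in> ?\<Phi> -` S \<inter> space (\<Pi>\<^sub>M e\<in>E. lborel)"
    have "x e \<in> {-R..R}" if e: "e \<in> E" for e
    proof -
      have "i \<bullet> e = (if i = e then 1 else 0)" if "i \<in> E" for i
        using GE that e by (auto simp: orthonormal_basis_of_def pairwise_def orthogonal_def norm_eq_1)
      then have "?\<Phi> x \<bullet> e = (\<Sum>i\<in>E. if i = e then x i else 0)"
        unfolding inner_sum_left by (intro sum.cong) auto
      then have xe: "?\<Phi> x \<bullet> e = x e" using fin e by simp
      have "\<bar>?\<Phi> x \<bullet> e\<bar> \<le> norm (?\<Phi> x) * norm e" by (rule Cauchy_Schwarz_ineq2)
      also have "\<dots> \<le> R" using R x e GE by (simp add: orthonormal_basis_of_def)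
      finally show ?thesis unfolding xe by auto
    qed
    then show "x \<in> Pi\<^sub>E E (\<lambda>e. {-R..R})" using x by (auto simp: space_PiM PiE_iff)
  qed
  have "emeasure \<mu> S = emeasure (\<Pi>\<^sub>M e\<in>E. lborel) (?\<Phi> -` S \<inter> space (\<Pi>\<^sub>M e\<in>E. lborel))"
    unfolding \<mu> by (rule emeasure_distr[OF coordinate_map_measurable assms(2)])
  also have "\<dots> \<le> emeasure (\<Pi>\<^sub>M e\<in>E. lborel) (Pi\<^sub>E E (\<lambda>e. {-R..R}))"
    using fin by (intro emeasure_mono sub sets_PiM_I_finite) auto
  also have "\<dots> = (\<Prod>e\<in>E. emeasure lborel {-R..R})" using fin by (intro emeasure_PiM) auto
  also have "\<dots> < \<infinity>"
  proof -
    have "emeasure lborel {-R..R} \<noteq> top" by (simp add: emeasure_lborel_Icc_eq)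
    then have "(\<Prod>e\<in>E. emeasure lborel {-R..R}) \<noteq> top"
      by (auto simp: ennreal_prod_eq_top simp del: prod_constant)
    then show ?thesis by (simp add: less_top)
  qed
  finally show ?thesis .
qed

lemma sigma_finite_subspace: "sigma_finite_measure \<mu>"
proof
  have "sets \<mu> = sets borel" "space \<mu> = UNIV" by (simp_all add: \<mu>)
  moreover have "emeasure \<mu> (cball 0 (real n)) \<noteq> \<infinity>" for n
    using emeasure_subspace_bounded[of "cball 0 (real n)"] by simp
  moreover have "(\<Union>n. cball 0 (real n)) = (UNIV :: 'a set)"
    using real_arch_simple by (fastforce simp: dist_norm)
  ultimately show "\<exists>A. countable A \<and> A \<subseteq> sets \<mu> \<and> \<Union>A = space \<mu> \<and> (\<forall>a\<in>A. emeasure \<mu> a \<noteq> \<infinity>)"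
    by (intro exI[of _ "range (\<lambda>n::nat. cball 0 (real n))"]) auto
qed

end

section \<open>The Lelong class\<close>

text \<open>Restriction to a line keeps the coefficient 1 in front of
  \<open>log_plus (norm \<zeta>)\<close>, whatever the length of the direction \<open>b\<close>;
  this is the growth that a decay \<open>O(1/\<zeta>)\<close> of \<open>F\<close>
  compensates.\<close>

lemma log_plus_norm_line:
  fixes x b :: "complex ^ 'n"
  shows "log_plus (norm (x + \<zeta> *s b)) \<le> log_plus (norm x + norm b) + log_plus (norm \<zeta>)"
proof -
  have "norm (x + \<zeta> *s b) \<le> norm x + norm \<zeta> * norm b"
    using norm_triangle_ineq[of x "\<zeta> *s b"] by (simp add: norm_vector_scalar_mult)
  also have "\<dots> \<le> max 1 (norm \<zeta>) * norm x + max 1 (norm \<zeta>) * norm b"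
    using mult_right_mono[of 1 "max 1 (norm \<zeta>)" "norm x"] mult_right_mono[of "norm \<zeta>" "max 1 (norm \<zeta>)" "norm b"]
    by simp
  also have "\<dots> = (norm x + norm b) * max 1 (norm \<zeta>)" by (simp add: algebra_simps)
  also have "\<dots> \<le> max 1 (norm x + norm b) * max 1 (norm \<zeta>)" by (intro mult_right_mono) auto
  finally have "norm (x + \<zeta> *s b) \<le> max 1 (norm x + norm b) * max 1 (norm \<zeta>)" .
  moreover have "1 \<le> max 1 (norm x + norm b) * max 1 (norm \<zeta>)"
    using mult_mono[of 1 "max 1 (norm x + norm b)" 1 "max 1 (norm \<zeta>)"] by simp
  ultimately have "log_plus (norm (x + \<zeta> *s b)) \<le> ln (max 1 (norm x + norm b) * max 1 (norm \<zeta>))"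
    unfolding log_plus_def by (intro ln_mono) auto
  also have "\<dots> = log_plus (norm x + norm b) + log_plus (norm \<zeta>)"
    unfolding log_plus_def by (intro ln_mult_pos) (auto simp: less_max_iff_disj)
  finally show ?thesis .
qed

lemma lelong_class_usc: "u \<in> lelong_class \<Longrightarrow> upper_semicontinuous_on UNIV u"
  and lelong_class_not_PInf: "u \<in> lelong_class \<Longrightarrow> u z \<noteq> \<infinity>"
  by (auto simp: lelong_class_def plurisubharmonic_on_def)

lemma lelong_class_line:
  assumes "u \<in> lelong_class"
  obtains C where "subharmonic_on UNIV (\<lambda>\<zeta>. u (x + \<zeta> *s b))"
    "\<And>\<zeta>. u (x + \<zeta> *s b) \<le> ereal (C + log_plus (norm \<zeta>))"
proof -
  have "subharmonic_on UNIV (\<lambda>\<zeta>. u (x + \<zeta> *s b))"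
    using assms by (simp add: lelong_class_def plurisubharmonic_on_def)
  moreover have "(SUP z. u z - ereal (log_plus (norm z))) < \<infinity>"
    using assms by (simp add: lelong_class_def)
  then obtain C where C: "(SUP z. u z - ereal (log_plus (norm z))) \<le> ereal C"
    by (cases "SUP z. u z - ereal (log_plus (norm z))") auto
  have "u (x + \<zeta> *s b) \<le> ereal (C + log_plus (norm x + norm b) + log_plus (norm \<zeta>))" for \<zeta>
  proof -
    let ?z = "x + \<zeta> *s b"
    have "u ?z - ereal (log_plus (norm ?z)) \<le> ereal C"
      by (rule order_trans[OF SUP_upper C]) simp
    then have "u ?z \<le> ereal (C + log_plus (norm ?z))" by (cases "u ?z") auto
    also have "\<dots> \<le> ereal (C + log_plus (norm x + norm b) + log_plus (norm \<zeta>))"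
      using log_plus_norm_line[of x \<zeta> b] by simp
    finally show ?thesis .
  qed
  ultimately show ?thesis using that by blast
qed

lemma of_real_vector_scalar_mult: "complex_of_real r *s z = r *\<^sub>R (z :: complex ^ 'n)"
  by (simp add: vec_eq_iff) (simp add: scaleR_conv_of_real)

text \<open>Genericity enters here: the value \<open>-\<infinity>\<close> on a ball of \<open>G\<close> spreads along real lines
  through \<open>G\<close> and then along complex lines through \<open>G + J G\<close>.\<close>

lemma lelong_class_not_MInf_on_generic:
  fixes a :: "complex ^ 'n"
  assumes u: "u \<in> lelong_class" and G: "generic_subspace G" and a: "a \<in> G" and r: "r > 0"
  shows "\<exists>z\<in>cball a r \<inter> G. u z \<noteq> - \<infinity>"
proof (rule ccontr)
  assume neg: "\<not> ?thesis"
  have sG: "subspace G" using G by (simp add: generic_subspace_def)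
  have onG: "u y = - \<infinity>" if y: "y \<in> G" for y
  proof -
    obtain C where C: "subharmonic_on UNIV (\<lambda>\<zeta>. u (y + \<zeta> *s (a - y)))"
      "\<And>\<zeta>. u (y + \<zeta> *s (a - y)) \<le> ereal (C + log_plus (norm \<zeta>))"
      using lelong_class_line[OF u] by blast
    \<comment> \<open>Parameters in \<open>{1 - \<epsilon>..1}\<close> give points within
      \<open>r\<close> of \<open>a\<close>. The summand 1 covers \<open>a = y\<close>, and
      \<open>1/2\<close> keeps the parameters positive.\<close>
    define \<epsilon> where "\<epsilon> = min (1/2) (r / (norm (a - y) + 1))"
    have "0 < r / (norm (a - y) + 1)" using r by (intro divide_pos_pos add_nonneg_pos) auto
    then have \<epsilon>: "0 < \<epsilon>" "\<epsilon> \<le> 1/2" "\<epsilon> \<le> r / (norm (a - y) + 1)"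
      unfolding \<epsilon>_def by (simp_all only: min_less_iff_conj min.cobounded1 min.cobounded2) simp
    have "u (y + of_real \<tau> *s (a - y)) = - \<infinity>" if \<tau>: "\<tau> \<in> {1 - \<epsilon>..1}" for \<tau> :: real
    proof -
      let ?z = "y + \<tau> *\<^sub>R (a - y)"
      have "a - ?z = (1 - \<tau>) *\<^sub>R (a - y)" by (simp add: algebra_simps)
      then have "norm (a - ?z) = (1 - \<tau>) * norm (a - y)" using \<tau> by simp
      also have "\<dots> \<le> r / (norm (a - y) + 1) * (norm (a - y) + 1)"
        using \<tau> \<epsilon> r by (intro mult_mono) auto
      also have "\<dots> = r" by (simp add: add_nonneg_eq_0_iff)
      finally have "?z \<in> cball a r" by (simp add: dist_norm)
      moreover have "?z \<in> G" using sG y a by (intro subspace_add subspace_scale subspace_diff)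
      ultimately have "u ?z = - \<infinity>" using neg by blast
      then show ?thesis by (simp only: of_real_vector_scalar_mult)
    qed
    then have "u (y + 0 *s (a - y)) = - \<infinity>"
      using \<epsilon> by (intro subharmonic_MInf_segment[OF C, of "1 - \<epsilon>" 1]) auto
    then show ?thesis by simp
  qed
  have "u z = - \<infinity>" for z
  proof -
    have "z \<in> {x + y | x y. x \<in> G \<and> y \<in> J ` G}" using G by (simp add: generic_subspace_def)
    \<comment> \<open>The complex line through \<open>x\<close> in direction \<open>y\<close> runs
      inside \<open>G\<close> at real parameters and reaches \<open>z\<close> at the parameter
      \<open>\<i>\<close>.\<close>
    then obtain x y where xy: "x \<in> G" "y \<in> G" "z = x + \<i> *s y" by (auto simp: J_def)
    obtain C where C: "subharmonic_on UNIV (\<lambda>\<zeta>. u (x + \<zeta> *s y))"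
      "\<And>\<zeta>. u (x + \<zeta> *s y) \<le> ereal (C + log_plus (norm \<zeta>))"
      using lelong_class_line[OF u] by blast
    have "u (x + of_real \<tau> *s y) = - \<infinity>" for \<tau> :: real
      unfolding of_real_vector_scalar_mult using xy sG by (intro onG subspace_add subspace_scale)
    then have "u (x + \<i> *s y) = - \<infinity>" by (rule subharmonic_MInf_imaginary[OF C])
    then show ?thesis using xy by simp
  qed
  then show False using u by (simp add: lelong_class_def)
qed

section \<open>Maximum points and the estimates on lines through them\<close>

lemma upper_semicontinuous_closed_ge:
  fixes u :: "'a::t2_space \<Rightarrow> ereal"
  assumes "upper_semicontinuous_on UNIV u"
  shows "closed {z. c \<le> u z}"
proof -
  have "open {z. u z < c}" using assms by (simp add: upper_semicontinuous_on_def)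
  moreover have "- {z. u z < c} = {z. c \<le> u z}" by auto
  ultimately show ?thesis by (metis closed_Compl)
qed

lemma lelong_class_attains_SUP:
  fixes K :: "(complex ^ 'n) set"
  assumes u: "u \<in> lelong_class" and K: "compact K" and z: "z \<in> K" "u z \<noteq> - \<infinity>"
  obtains x m where "x \<in> K" "u x = ereal m" "(SUP w\<in>K. u w) = ereal m" "\<And>w. w \<in> K \<Longrightarrow> u w \<le> ereal m"
proof -
  have cl: "closed {w\<in>K. c \<le> u w}" for c
  proof -
    have "closed (K \<inter> {w. c \<le> u w})"
      using compact_imp_closed[OF K] upper_semicontinuous_closed_ge[OF lelong_class_usc[OF u]]
      by (rule closed_Int)
    also have "K \<inter> {w. c \<le> u w} = {w\<in>K. c \<le> u w}" by blast
    finally show ?thesis .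
  qed
  obtain x where x: "x \<in> K" "\<And>w. w \<in> K \<Longrightarrow> u w \<le> u x"
    using upper_semicontinuous_attains_sup[OF K _ cl] z(1) by blast
  have "u z \<le> u x" using x(2) z(1) by simp
  then obtain m where m: "u x = ereal m" using z(2) lelong_class_not_PInf[OF u, of x] by (cases "u x") auto
  have "(SUP w\<in>K. u w) = ereal m"
    using x m by (intro antisym SUP_least SUP_upper2[of x]) auto
  then show ?thesis using that x m by metis
qed

text \<open>By convexity the part of the ray in \<open>Bs\<close> is a segment with parameters up to
  \<open>len\<close>. Its weight is at most \<open>len ^ (d - 1)\<close> pointwise and
  \<open>len ^ d / d\<close> in total, so the bound \<open>4 * len * exp (-t)\<close> on the
  sublevel set acquires the factor \<open>d\<close>.\<close>

lemma real_ray_estimate: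
  fixes Bs :: "(complex ^ 'n) set"
  assumes u: "u \<in> lelong_class" and ux: "u x = ereal m" and t: "t > 0" and d: "0 < d"
    and Bs: "compact Bs" "convex Bs" "0 \<in> Bs" and y: "y \<noteq> 0"
  shows "(\<integral>\<^sup>+\<tau>\<in>{0<..}. ennreal (\<tau> ^ (d - 1)) * indicator {y\<in>Bs. u (x + y) \<le> ereal (m - t)} (\<tau> *\<^sub>R y) \<partial>lborel)
    \<le> ennreal (4 * real d * exp (- t)) * (\<integral>\<^sup>+\<tau>\<in>{0<..}. ennreal (\<tau> ^ (d - 1)) * indicator Bs (\<tau> *\<^sub>R y) \<partial>lborel)"
proof -
  obtain C where C: "subharmonic_on UNIV (\<lambda>\<zeta>. u (x + \<zeta> *s y))"
    "\<And>\<zeta>. u (x + \<zeta> *s y) \<le> ereal (C + log_plus (norm \<zeta>))"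
    using lelong_class_line[OF u] by blast
  define T where "T = {\<tau>. 0 \<le> \<tau> \<and> \<tau> *\<^sub>R y \<in> Bs}"
  have "closed T"
  proof -
    have "closed ((\<lambda>\<tau>. \<tau> *\<^sub>R y) -` Bs)"
      using compact_imp_closed[OF Bs(1)] by (intro closed_vimage continuous_intros) auto
    moreover have "T = {0..} \<inter> (\<lambda>\<tau>. \<tau> *\<^sub>R y) -` Bs" by (auto simp: T_def)
    ultimately show ?thesis by (simp add: closed_Int)
  qed
  moreover have "bounded T"
  proof -
    obtain R where R: "\<And>z. z \<in> Bs \<Longrightarrow> norm z \<le> R" using compact_imp_bounded[OF Bs(1)] by (auto simp: bounded_iff)
    have "norm \<tau> \<le> R / norm y" if "\<tau> \<in> T" for \<tau>
    proof -
      have "\<bar>\<tau>\<bar> * norm y \<le> R" using R[of "\<tau> *\<^sub>R y"] that by (simp add: T_def)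
      then show ?thesis using y by (simp add: pos_le_divide_eq)
    qed
    then show ?thesis by (auto simp: bounded_iff)
  qed
  ultimately have "compact T" by (simp add: compact_eq_bounded_closed)
  moreover have "T \<noteq> {}" using Bs(3) by (auto simp: T_def intro!: exI[of _ 0])
  ultimately obtain len where len: "len \<in> T" "\<And>\<tau>. \<tau> \<in> T \<Longrightarrow> \<tau> \<le> len"
    using continuous_attains_sup[of T "\<lambda>x. x"] by (auto intro: continuous_on_id)
  have T: "\<tau> *\<^sub>R y \<in> Bs \<longleftrightarrow> \<tau> \<le> len" if \<tau>: "0 < \<tau>" for \<tau>
  proof
    show "\<tau> \<le> len" if "\<tau> *\<^sub>R y \<in> Bs" using len(2) \<tau> that by (simp add: T_def)
    assume le: "\<tau> \<le> len"
    then have l0: "len > 0" using \<tau> by simp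
    have "(1 - \<tau> / len) *\<^sub>R 0 + (\<tau> / len) *\<^sub>R (len *\<^sub>R y) \<in> Bs"
      using len(1) \<tau> le l0 by (intro convexD[OF Bs(2) Bs(3)]) (auto simp: T_def)
    then show "\<tau> *\<^sub>R y \<in> Bs" using l0 by simp
  qed
  show ?thesis
  proof (cases "len > 0")
    case True
    define S where "S = {\<tau>\<in>{0..len}. u (x + of_real \<tau> *s y) \<le> ereal (m - t)}"
    have "(\<integral>\<^sup>+\<tau>\<in>{0<..}. ennreal (\<tau> ^ (d - 1)) * indicator {y\<in>Bs. u (x + y) \<le> ereal (m - t)} (\<tau> *\<^sub>R y) \<partial>lborel)
        \<le> (\<integral>\<^sup>+\<tau>. ennreal (len ^ (d - 1)) * indicator S \<tau> \<partial>lborel)"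
    proof (rule nn_integral_mono)
      fix \<tau> :: real
      show "ennreal (\<tau> ^ (d - 1)) * indicator {y\<in>Bs. u (x + y) \<le> ereal (m - t)} (\<tau> *\<^sub>R y) * indicator {0<..} \<tau>
          \<le> ennreal (len ^ (d - 1)) * indicator S \<tau>"
      proof (cases "0 < \<tau> \<and> \<tau> *\<^sub>R y \<in> Bs \<and> u (x + \<tau> *\<^sub>R y) \<le> ereal (m - t)")
        case True
        then have "\<tau> \<in> S" using T[of \<tau>] by (simp add: S_def of_real_vector_scalar_mult)
        moreover have "\<tau> ^ (d - 1) \<le> len ^ (d - 1)" using True T[of \<tau>] by (intro power_mono) auto
        ultimately show ?thesis using True by (simp add: ennreal_leI)
      qed (auto simp: indicator_def)
    qed
    also have "\<dots> = ennreal (len ^ (d - 1)) * emeasure lborel S"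
    proof (rule nn_integral_cmult_indicator)
      have [measurable]: "(\<lambda>\<zeta>. u (x + \<zeta> *s y)) \<in> borel_measurable borel"
        using C(1) by (auto simp: subharmonic_on_def intro: usc_borel_measurable)
      have [measurable]: "(\<lambda>\<tau>::real. u (x + of_real \<tau> *s y)) \<in> borel_measurable borel"
        using measurable_compose[of complex_of_real borel borel, OF _ \<open>(\<lambda>\<zeta>. u (x + \<zeta> *s y)) \<in> borel_measurable borel\<close>] by simp
      show "S \<in> sets lborel" unfolding S_def by measurable
    qed
    also have "\<dots> \<le> ennreal (len ^ (d - 1)) * ennreal (4 * len * exp (- t))"
      unfolding S_def using ux True t by (intro mult_left_mono subharmonic_segment_sublevel[OF C]) auto
    also have "\<dots> = ennreal (len ^ (d - 1) * (4 * len * exp (- t)))"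
      using True by (intro ennreal_mult[symmetric]) auto
    also have "len ^ (d - 1) * (4 * len * exp (- t)) = 4 * real d * exp (- t) * (len ^ d / real d)"
    proof -
      have "len ^ d = len * len ^ (d - 1)" using d by (cases d) auto
      then show ?thesis using d by simp
    qed
    also have "ennreal \<dots> = ennreal (4 * real d * exp (- t)) * ennreal (len ^ d / real d)"
      using True by (intro ennreal_mult) auto
    also have "ennreal (len ^ d / real d) = (\<integral>\<^sup>+\<tau>. ennreal (\<tau> ^ (d - 1)) * indicator {0..len} \<tau> \<partial>lborel)"
    proof -
      have "(\<integral>\<^sup>+\<tau>. ennreal (\<tau> ^ (d - 1)) * indicator {0..len} \<tau> \<partial>lborel) = ennreal (len ^ d / real d - 0 ^ d / real d)"
      proof (rule nn_integral_FTC_Icc)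
        show "((\<lambda>\<tau>. \<tau> ^ d / real d) has_real_derivative \<tau> ^ (d - 1)) (at \<tau>)" for \<tau> :: real
          using DERIV_cdivide[OF DERIV_pow[of d \<tau>], of "real d"] d by simp
      qed (use True in auto)
      then show ?thesis using d by (simp add: zero_power)
    qed
    also have "\<dots> = (\<integral>\<^sup>+\<tau>\<in>{0<..}. ennreal (\<tau> ^ (d - 1)) * indicator Bs (\<tau> *\<^sub>R y) \<partial>lborel)"
    proof (rule nn_integral_cong_AE)
      have "AE \<tau> in lborel. \<tau> \<noteq> (0::real)" by (rule AE_lborel_singleton)
      then show "AE \<tau> in lborel. ennreal (\<tau> ^ (d - 1)) * indicator {0..len} \<tau>
          = ennreal (\<tau> ^ (d - 1)) * indicator Bs (\<tau> *\<^sub>R y) * indicator {0<..} \<tau>"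
      proof eventually_elim
        case (elim \<tau>)
        show ?case
        proof (cases "0 < \<tau>")
          case True
          then show ?thesis using T[OF True] by (simp add: indicator_def)
        qed (use elim in \<open>auto simp: indicator_def\<close>)
      qed
    qed
    finally show ?thesis .
  next
    case False
    \<comment> \<open>The ray leaves \<open>Bs\<close> immediately, and the left-hand side
      vanishes.\<close>
    then have z: "ennreal (\<tau> ^ (d - 1)) * indicator {y\<in>Bs. u (x + y) \<le> ereal (m - t)} (\<tau> *\<^sub>R y) * indicator {0<..} \<tau> = 0" for \<tau>
      using T[of \<tau>] by (auto simp: indicator_def)
    show ?thesis by (simp only: z nn_integral_const mult_zero_left zero_le)
  qed
qed

text \<open>Rotation carries the disc about \<open>norm c\<close> to the disc about
  \<open>c\<close>. A lower bound is the useful direction, as the moment enters on the larger side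
  of the line estimate.\<close>

lemma nn_integral_power_disc_rotated:
  fixes c :: complex
  assumes c: "c \<noteq> 0"
  shows "ennreal ((2 * norm c) ^ (2 * k + 2) / (2 * k + 2) * (pi * (fact (2 * Suc k) / ((fact (Suc k))\<^sup>2 * 4 ^ Suc k))))
    \<le> (\<integral>\<^sup>+\<zeta>\<in>cball c (norm c). ennreal (norm \<zeta> ^ (2 * k)) \<partial>lborel)"
proof -
  define \<alpha> where "\<alpha> = sgn c"
  have \<alpha>: "norm \<alpha> = 1" "c = \<alpha> * of_real (norm c)" using c by (simp add: \<alpha>_def norm_sgn, simp add: \<alpha>_def sgn_eq)
  have R: "norm c > 0" using c by simp
  have inD: "\<alpha> * w \<in> cball c (norm c)" if w: "(norm w)\<^sup>2 \<le> 2 * norm c * Re w" for w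
  proof -
    have "c - \<alpha> * w = \<alpha> * (of_real (norm c) - w)" using \<alpha>(2) by (simp add: algebra_simps)
    then have n: "norm (c - \<alpha> * w) = norm (of_real (norm c) - w)" by (simp only: norm_mult \<alpha>(1) mult_1)
    have "(norm (of_real \<rho> - w))\<^sup>2 = (norm w)\<^sup>2 - 2 * \<rho> * Re w + \<rho>\<^sup>2" for \<rho> :: real
      unfolding cmod_power2 by (simp add: power2_eq_square algebra_simps)
    from this[of "norm c"] have "(norm (of_real (norm c) - w))\<^sup>2 \<le> (norm c)\<^sup>2" using w by simp
    then have "norm (of_real (norm c) - w) \<le> norm c" by (rule power2_le_imp_le) simp
    then show ?thesis using n by (simp add: dist_norm)
  qed
  have "ennreal ((2 * norm c) ^ (2 * k + 2) / (2 * k + 2) * (pi * (fact (2 * Suc k) / ((fact (Suc k))\<^sup>2 * 4 ^ Suc k))))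
      = (\<integral>\<^sup>+w\<in>{w. 0 < Re w \<and> (norm w)\<^sup>2 \<le> 2 * norm c * Re w}. ennreal (norm w ^ (2 * k)) \<partial>lborel)"
    by (rule nn_integral_power_disc[OF R, symmetric])
  also have "\<dots> \<le> (\<integral>\<^sup>+w. ennreal (norm (\<alpha> * w) ^ (2 * k)) * indicator (cball c (norm c)) (\<alpha> * w) \<partial>lborel)"
    using inD by (intro nn_integral_mono) (auto simp: indicator_def norm_mult \<alpha>(1))
  also have "\<dots> = ennreal (1 ^ DIM(complex)) * (\<integral>\<^sup>+w. ennreal (norm (\<alpha> * w) ^ (2 * k)) * indicator (cball c (norm c)) (\<alpha> * w) \<partial>lborel)"
    by simp
  also have "\<dots> = (\<integral>\<^sup>+\<zeta>\<in>cball c (norm c). ennreal (norm \<zeta> ^ (2 * k)) \<partial>lborel)"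
  proof (rule nn_integral_lborel_similarity[symmetric])
    show "(\<lambda>\<zeta>. ennreal (norm \<zeta> ^ (2 * k)) * indicator (cball c (norm c)) \<zeta>) \<in> borel_measurable borel"
    proof -
      have [measurable]: "cball c (norm c) \<in> sets borel" by simp
      show ?thesis by measurable
    qed
  qed (simp_all add: norm_mult \<alpha>(1) bounded_linear.linear[OF bounded_linear_mult_right])
  finally show ?thesis .
qed

text \<open>As \<open>x\<close> lies on the sphere, a complex line through \<open>x\<close> cuts the
  ball in a disc with parameter \<open>0\<close> on its boundary. There the weight is at most
  \<open>(2 * |c|) ^ (2n - 2)\<close>; this times \<open>4 * pi * |c|\<^sup>2\<close>, divided by
  the moment of the disc, is exactly \<open>c_ball n\<close>.\<close>

lemma complex_line_estimate:
  fixes x a :: "complex ^ 'n"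
  assumes u: "u \<in> lelong_class" and ux: "u x = ereal m" and t: "t > 0"
    and r: "dist a x = r" and y: "y \<noteq> 0"
  shows "(\<integral>\<^sup>+\<zeta>. ennreal (norm \<zeta> ^ (2 * (CARD('n) - 1))) * indicator {y. x + y \<in> cball a r \<and> u (x + y) \<le> ereal (m - t)} (\<zeta> *s y) \<partial>lborel)
    \<le> ennreal (c_ball CARD('n) * exp (- 2 * t)) * (\<integral>\<^sup>+\<zeta>. ennreal (norm \<zeta> ^ (2 * (CARD('n) - 1))) * indicator {y. x + y \<in> cball a r} (\<zeta> *s y) \<partial>lborel)"
    (is "?I \<le> _ * ?K")
proof -
  obtain C where C: "subharmonic_on UNIV (\<lambda>\<zeta>. u (x + \<zeta> *s y))"
    "\<And>\<zeta>. u (x + \<zeta> *s y) \<le> ereal (C + log_plus (norm \<zeta>))"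
    using lelong_class_line[OF u] by blast
  define p where "p = a - x"
  have np: "norm p = r" using r by (simp add: p_def dist_norm)
  \<comment> \<open>The Hermitian product of \<open>y\<close> with \<open>p\<close>; thus
    \<open>c *s y\<close> is the orthogonal projection of \<open>p\<close> to the line spanned by
    \<open>y\<close>, the centre of the disc.\<close>
  define h where "h = (\<Sum>i\<in>UNIV. y $ i * cnj (p $ i))"
  define c where "c = cnj h / of_real ((norm y)\<^sup>2)"
  have ny: "0 < (norm y)\<^sup>2" using y by simp
  have nsq: "(norm z)\<^sup>2 = (\<Sum>i\<in>UNIV. (norm (z $ i))\<^sup>2)" for z :: "complex ^ 'n"
    by (simp add: norm_vec_def L2_set_def sum_nonneg)
  have expand: "(norm (\<zeta> *s y - p))\<^sup>2 = (norm \<zeta>)\<^sup>2 * (norm y)\<^sup>2 - 2 * Re (\<zeta> * h) + (norm p)\<^sup>2" for \<zeta>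
  proof -
    have "(norm (\<zeta> * y $ i - p $ i))\<^sup>2 = (norm \<zeta>)\<^sup>2 * (norm (y $ i))\<^sup>2 - 2 * Re (\<zeta> * (y $ i * cnj (p $ i))) + (norm (p $ i))\<^sup>2" for i
    proof -
      have "(norm (z - w))\<^sup>2 = (norm z)\<^sup>2 - 2 * Re (z * cnj w) + (norm w)\<^sup>2" for z w :: complex
        unfolding cmod_power2 by (simp add: power2_eq_square algebra_simps)
      from this[of "\<zeta> * y $ i" "p $ i"] show ?thesis by (simp only: norm_mult power_mult_distrib mult.assoc)
    qed
    then show ?thesis
      unfolding nsq h_def by (simp add: sum.distrib sum_subtractf sum_distrib_left)
  qed
  have in_disc: "x + \<zeta> *s y \<in> cball a r \<longleftrightarrow> \<zeta> \<in> cball c (norm c)" for \<zeta>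
  proof -
    have "x + \<zeta> *s y \<in> cball a r \<longleftrightarrow> norm (\<zeta> *s y - p) \<le> norm p"
      by (simp add: dist_norm p_def np[symmetric] norm_minus_commute algebra_simps)
    also have "\<dots> \<longleftrightarrow> (norm (\<zeta> *s y - p))\<^sup>2 \<le> (norm p)\<^sup>2" by (simp add: power2_le_iff_abs_le)
    also have "\<dots> \<longleftrightarrow> (norm \<zeta>)\<^sup>2 * (norm y)\<^sup>2 \<le> 2 * Re (\<zeta> * h)" unfolding expand by linarith
    also have "\<dots> \<longleftrightarrow> (norm \<zeta>)\<^sup>2 \<le> 2 * Re (\<zeta> * h) / (norm y)\<^sup>2" using ny by (simp only: pos_le_divide_eq)
    also have "2 * Re (\<zeta> * h) / (norm y)\<^sup>2 = 2 * Re (\<zeta> * cnj c)"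
      by (simp add: c_def)
    also have "(norm \<zeta>)\<^sup>2 \<le> 2 * Re (\<zeta> * cnj c) \<longleftrightarrow> (norm (c - \<zeta>))\<^sup>2 \<le> (norm c)\<^sup>2"
      unfolding cmod_power2 by (simp add: power2_eq_square algebra_simps)
    also have "\<dots> \<longleftrightarrow> \<zeta> \<in> cball c (norm c)" by (simp add: dist_norm power2_le_iff_abs_le)
    finally show ?thesis .
  qed
  obtain k where k: "CARD('n) = Suc k" using zero_less_card_finite[where 'a='n] by (cases "CARD('n)") auto
  define S where "S = {\<zeta>\<in>cball c (norm c). u (x + \<zeta> *s y) \<le> ereal (m - t)}"
  have [measurable]: "(\<lambda>\<zeta>. u (x + \<zeta> *s y)) \<in> borel_measurable borel"
    using C(1) by (auto simp: subharmonic_on_def intro: usc_borel_measurable)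
  have Sm: "S \<in> sets lborel" unfolding S_def by measurable
  have "?I \<le> (\<integral>\<^sup>+\<zeta>. ennreal ((2 * norm c) ^ (2 * k)) * indicator S \<zeta> \<partial>lborel)"
  proof (rule nn_integral_mono)
    fix \<zeta> :: complex
    show "ennreal (norm \<zeta> ^ (2 * (CARD('n) - 1))) * indicator {y. x + y \<in> cball a r \<and> u (x + y) \<le> ereal (m - t)} (\<zeta> *s y)
        \<le> ennreal ((2 * norm c) ^ (2 * k)) * indicator S \<zeta>"
    proof (cases "\<zeta> \<in> S")
      case True
      then have "norm (\<zeta> - c) \<le> norm c" by (simp add: S_def dist_norm norm_minus_commute)
      then have "norm \<zeta> \<le> 2 * norm c" using norm_triangle_ineq[of "\<zeta> - c" c] by simp
      then have "norm \<zeta> ^ (2 * k) \<le> (2 * norm c) ^ (2 * k)" by (intro power_mono) auto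
      then show ?thesis using True by (auto simp: k indicator_def intro!: ennreal_leI)
    next
      case False
      then have "\<not> (x + \<zeta> *s y \<in> cball a r \<and> u (x + \<zeta> *s y) \<le> ereal (m - t))"
        unfolding in_disc by (simp add: S_def)
      then show ?thesis by simp
    qed
  qed
  also have "\<dots> = ennreal ((2 * norm c) ^ (2 * k)) * emeasure lborel S"
    by (rule nn_integral_cmult_indicator[OF Sm])
  also have "\<dots> \<le> ennreal ((2 * norm c) ^ (2 * k)) * ennreal (4 * pi * (norm c)\<^sup>2 * exp (- 2 * t))"
    unfolding S_def using ux t by (intro mult_left_mono subharmonic_disc_sublevel[OF C]) auto
  also have "\<dots> = ennreal (pi * (2 * norm c) ^ (2 * k + 2) * exp (- 2 * t))"
    by (simp add: power2_eq_square mult_ac flip: ennreal_mult)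
  finally have I: "?I \<le> ennreal (pi * (2 * norm c) ^ (2 * k + 2) * exp (- 2 * t))" .
  show ?thesis
  proof (cases "c = 0")
    \<comment> \<open>The line is complex tangent to the sphere and the disc shrinks to a
      point.\<close>
    case True
    then have "?I \<le> 0" using I by simp
    then show ?thesis by simp
  next
    case False
    define Q where "Q = (2 * norm c) ^ (2 * k + 2) / (2 * k + 2) * (pi * (fact (2 * Suc k) / ((fact (Suc k))\<^sup>2 * 4 ^ Suc k)))"
    have K: "ennreal Q \<le> ?K"
    proof -
      have "ennreal Q \<le> (\<integral>\<^sup>+\<zeta>\<in>cball c (norm c). ennreal (norm \<zeta> ^ (2 * k)) \<partial>lborel)"
        unfolding Q_def by (rule nn_integral_power_disc_rotated[OF False])
      also have "\<dots> = ?K" using in_disc by (intro nn_integral_cong) (simp add: k indicator_def)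
      finally show ?thesis .
    qed
    have f: "(fact (2 * Suc k) :: real) = real (2 * k + 2) * fact (2 * Suc k - 1)"
      by (simp add: algebra_simps)
    have "c_ball CARD('n) * Q = pi * (2 * norm c) ^ (2 * k + 2)"
    proof -
      \<comment> \<open>With \<open>n = k + 1\<close>: \<open>P = 4 ^ n\<close>,
        \<open>F = (fact n)\<^sup>2\<close>, \<open>D = fact (2n - 1)\<close>,
        \<open>A = 2n\<close>. The Wallis factor of the moment cancels against
        \<open>c_ball n\<close>.\<close>
      have gen: "(P * F / D) * (N / A * (pi * (A * D / (F * P)))) = pi * N"
        if "P \<noteq> 0" "F \<noteq> 0" "D \<noteq> 0" "A \<noteq> 0" for P F D N A :: real
        using that by (simp add: field_simps)
      show ?thesis unfolding c_ball_def Q_def k f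
        by (rule gen) (auto simp: add_nonneg_eq_0_iff)
    qed
    then have "pi * (2 * norm c) ^ (2 * k + 2) * exp (- 2 * t) = c_ball CARD('n) * exp (- 2 * t) * Q" by (simp add: mult_ac)
    then have "ennreal (pi * (2 * norm c) ^ (2 * k + 2) * exp (- 2 * t)) = ennreal (c_ball CARD('n) * exp (- 2 * t)) * ennreal Q"
    proof (simp only:, intro ennreal_mult)
      show "0 \<le> c_ball CARD('n) * exp (- 2 * t)" by (simp add: c_ball_def)
      show "0 \<le> Q" by (simp add: Q_def)
    qed
    also have "\<dots> \<le> ennreal (c_ball CARD('n) * exp (- 2 * t)) * ?K" by (rule mult_left_mono[OF K]) simp
    finally show ?thesis using I by (rule order_trans[rotated])
  qed
qed

text \<open>Take the maximum point with the largest real part of one coordinate. In the interior,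
  touching a constant majorant would produce a maximum point further in that direction.\<close>

lemma lelong_class_max_on_sphere:
  fixes a :: "complex ^ 'n"
  assumes u: "u \<in> lelong_class" and r: "r > 0"
    and max: "x0 \<in> cball a r" "u x0 = ereal m" "\<And>w. w \<in> cball a r \<Longrightarrow> u w \<le> ereal m"
  obtains x where "dist a x = r" "u x = ereal m"
proof -
  fix i0 :: 'n
  define b where "b = (axis i0 1 :: complex ^ 'n)"
  have nb: "norm b = 1" by (simp add: b_def norm_axis_1)
  define K where "K = {w\<in>cball a r. ereal m \<le> u w}"
  have "compact K"
    unfolding K_def Collect_conj_eq Collect_mem_eq
    by (intro compact_Int_closed compact_cball upper_semicontinuous_closed_ge lelong_class_usc[OF u])
  moreover have "K \<noteq> {}" using max by (auto simp: K_def)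
  moreover have "continuous_on K (\<lambda>w. Re (w $ i0))" by (intro continuous_intros)
  ultimately obtain x where x: "x \<in> K" "\<And>w. w \<in> K \<Longrightarrow> Re (w $ i0) \<le> Re (x $ i0)"
    using continuous_attains_sup[of K "\<lambda>w. Re (w $ i0)"] by blast
  have ux: "u w = ereal m" if "w \<in> K" for w using that max(3) by (auto simp: K_def intro: antisym)
  have "dist a x = r"
  proof (rule ccontr)
    assume "dist a x \<noteq> r"
    then have "dist a x < r" using x(1) by (simp add: K_def)
    define \<delta> where "\<delta> = r - dist a x"
    have \<delta>: "\<delta> > 0" using \<open>dist a x < r\<close> by (simp add: \<delta>_def)
    have inb: "x + \<zeta> *s b \<in> cball a r" if "norm \<zeta> \<le> \<delta>" for \<zeta>
    proof -
      have "dist a (x + \<zeta> *s b) \<le> dist a x + dist x (x + \<zeta> *s b)" by (rule dist_triangle)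
      also have "dist x (x + \<zeta> *s b) = norm \<zeta>" by (simp add: dist_norm norm_vector_scalar_mult nb)
      finally show ?thesis using that by (simp add: \<delta>_def)
    qed
    have sub: "subharmonic_on UNIV (\<lambda>\<zeta>. u (x + \<zeta> *s b))"
      using lelong_class_line[OF u] by blast
    have "u (x + (0 + of_real (\<delta> / 2)) *s b) = ereal (Re (of_real m))"
    proof (rule subharmonic_touching_eq[OF sub, of "\<lambda>_. of_real m" 0 \<delta>])
      show "u (x + z *s b) \<le> ereal (Re (complex_of_real m))" if "z \<in> ball 0 \<delta>" for z
        using max(3)[OF inb[of z]] that by simp
      show "u (x + 0 *s b) = ereal (Re (complex_of_real m))" using ux[OF x(1)] by simp
    qed (use \<delta> in auto)
    then have "x + of_real (\<delta> / 2) *s b \<in> K"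
      using inb[of "of_real (\<delta> / 2)"] \<delta> by (simp add: K_def)
    from x(2)[OF this] show False using \<delta> by (simp add: b_def)
  qed
  then show ?thesis using that ux[OF x(1)] by blast
qed

text \<open>For \<open>t = 0\<close>, where the sublevel set is the whole ball, the decay estimate
  says just this; the line estimates need \<open>t > 0\<close> to keep the base point out of the
  sublevel set. It follows from \<open>2 * n choose n \<le> 4 ^ n\<close>.\<close>

lemma c_ball_ge_1: "1 \<le> c_ball n"
proof -
  have "(fact (2 * n - 1) :: nat) \<le> fact (2 * n)" by (intro fact_mono_nat) simp
  also have "(fact (2 * n) :: nat) = fact n * fact (2 * n - n) * (2 * n choose n)"
    by (rule binomial_fact_lemma[symmetric]) simp
  also have "\<dots> \<le> fact n * fact (2 * n - n) * 2 ^ (2 * n)"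
    by (intro mult_left_mono binomial_le_pow2) simp
  also have "\<dots> = 4 ^ n * (fact n)\<^sup>2" by (simp add: power2_eq_square power_mult)
  finally have "real (fact (2 * n - 1)) \<le> real (4 ^ n * (fact n)\<^sup>2)" by (simp only: of_nat_le_iff)
  then show ?thesis unfolding c_ball_def by (subst le_divide_eq_1_pos) simp_all
qed

section \<open>From lines to balls: decay of sublevel sets and the two integral estimates\<close>

lemma ereal_minus_ge_iff: "ereal t \<le> ereal m - x \<longleftrightarrow> x \<le> ereal (m - t)"
  by (cases x) auto

lemma ennreal_divide_le_of_le_mult:
  fixes X Y b :: ennreal
  assumes "X \<le> Y * b" "b \<noteq> \<infinity>"
  shows "X / b \<le> Y"
proof (cases "b = 0")
  case False
  have "X / b \<le> Y * b / b" by (rule divide_right_mono_ennreal[OF assms(1)])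
  also have "\<dots> = Y" using False assms(2) by (intro ennreal_mult_divide_eq) auto
  finally show ?thesis .
qed (use assms in auto)

text \<open>The given maximum point may be interior; it is exchanged for one on the sphere, which is
  translated to the origin so that the lines through it become lines through
  \<open>0\<close>.\<close>

lemma lelong_ball_sublevel:
  fixes a :: "complex ^ 'n"
  assumes u: "u \<in> lelong_class" and r: "r > 0" and t: "t \<ge> 0"
    and m: "(SUP w\<in>cball a r. u w) = ereal m" "x0 \<in> cball a r" "u x0 = ereal m"
  shows "emeasure lborel {z\<in>cball a r. u z \<le> ereal (m - t)}
    \<le> ennreal (c_ball CARD('n) * exp (- 2 * t)) * emeasure lborel (cball a r)"
proof (cases "t = 0")
  case True
  have "emeasure lborel {z\<in>cball a r. u z \<le> ereal (m - t)} \<le> 1 * emeasure lborel (cball a r)"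
    by (simp, intro emeasure_mono) auto
  also have "\<dots> \<le> ennreal (c_ball CARD('n) * exp (- 2 * t)) * emeasure lborel (cball a r)"
    using True c_ball_ge_1 by (intro mult_right_mono) auto
  finally show ?thesis .
next
  case False
  then have t: "t > 0" using t by simp
  have le: "u w \<le> ereal m" if "w \<in> cball a r" for w
    using SUP_upper[OF that, of u] m(1) by simp
  obtain x where x: "dist a x = r" "u x = ereal m"
    using lelong_class_max_on_sphere[OF u r m(2,3) le] by blast
  have [measurable]: "u \<in> borel_measurable borel" by (rule usc_borel_measurable[OF lelong_class_usc[OF u]])
  define A where "A = {y. x + y \<in> cball a r \<and> u (x + y) \<le> ereal (m - t)}"
  define B where "B = {y. x + y \<in> cball a r}"
  have shift: "emeasure lborel {y. x + y \<in> S} = emeasure lborel S" if S: "S \<in> sets borel" for S :: "(complex ^ 'n) set"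
  proof -
    have "emeasure lborel S = emeasure (distr lborel borel ((+) x)) S" by (simp add: lborel_distr_plus)
    also have "\<dots> = emeasure lborel ((+) x -` S \<inter> space lborel)" by (rule emeasure_distr) (use S in auto)
    finally show ?thesis by (simp add: vimage_def)
  qed
  define S where "S = {z\<in>cball a r. u z \<le> ereal (m - t)}"
  have [measurable]: "cball a r \<in> sets borel" by simp
  have Sm: "S \<in> sets borel" unfolding S_def by measurable
  have pre: "{y. x + y \<in> T} \<in> sets borel" if "T \<in> sets borel" for T
    using measurable_sets[of "(+) x" borel borel T] that by (simp add: vimage_def)
  have Am: "A \<in> sets borel" using pre[OF Sm] by (simp add: A_def S_def)
  have Bm: "B \<in> sets borel" unfolding B_def by (rule pre) simp
  have "emeasure lborel A \<le> ennreal (c_ball CARD('n) * exp (- 2 * t)) * emeasure lborel B"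
  proof (rule emeasure_le_of_complex_lines[OF Am _ Bm])
    show "0 \<notin> A" using x(2) t by (simp add: A_def)
    show "(\<integral>\<^sup>+\<zeta>. ennreal (norm \<zeta> ^ (2 * (CARD('n) - 1))) * indicator A (\<zeta> *s y) \<partial>lborel)
        \<le> ennreal (c_ball CARD('n) * exp (- 2 * t)) * (\<integral>\<^sup>+\<zeta>. ennreal (norm \<zeta> ^ (2 * (CARD('n) - 1))) * indicator B (\<zeta> *s y) \<partial>lborel)"
      if "y \<noteq> 0" for y
      unfolding A_def B_def by (rule complex_line_estimate[OF u x(2) t x(1) that])
  qed
  moreover have "emeasure lborel A = emeasure lborel {z\<in>cball a r. u z \<le> ereal (m - t)}"
    using shift[OF Sm] by (simp add: A_def S_def)
  moreover have "emeasure lborel B = emeasure lborel (cball a r)"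
    using shift[of "cball a r"] by (simp add: B_def)
  ultimately show ?thesis by simp
qed

text \<open>Rays from any maximum point meet the convex set \<open>B\<close> in segments, and
  translation by a point of \<open>G\<close> preserves its measure, so no particular position of the
  maximum is required.\<close>

lemma lelong_real_ball_sublevel:
  fixes a :: "complex ^ 'n"
  assumes u: "u \<in> lelong_class" and G: "generic_subspace G" and a: "a \<in> G" and t: "t \<ge> 0"
    and x: "x \<in> cball a r \<inter> G" "u x = ereal m"
    and C: "8 * real CARD('n) \<le> C"
  shows "emeasure (subspace_lborel G) {z\<in>cball a r \<inter> G. u z \<le> ereal (m - t)}
    \<le> ennreal (C * exp (- 1 * t)) * emeasure (subspace_lborel G) (cball a r \<inter> G)"
proof -
  have sG: "subspace G" using G by (simp add: generic_subspace_def)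
  obtain E where E: "orthonormal_basis_of G E"
    and \<mu>: "subspace_lborel G = distr (\<Pi>\<^sub>M e\<in>E. lborel) borel (\<lambda>x. \<Sum>e\<in>E. x e *\<^sub>R e)"
    using subspace_lborel_basis[OF sG] by blast
  let ?\<mu> = "subspace_lborel G"
  have sets[measurable_cong]: "sets ?\<mu> = sets borel" by (simp add: \<mu>)
  have [measurable]: "u \<in> borel_measurable borel" by (rule usc_borel_measurable[OF lelong_class_usc[OF u]])
  have "closed G" using sG by (rule closed_subspace)
  then have Gm[measurable]: "G \<in> sets borel" by simp
  define B where "B = cball a r \<inter> G"
  have Bm[measurable]: "B \<in> sets borel" by (simp add: B_def)
  define S where "S = {z\<in>B. u z \<le> ereal (m - t)}"
  have Sm[measurable]: "S \<in> sets borel" unfolding S_def by measurable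
  have "emeasure ?\<mu> S \<le> ennreal (C * exp (- 1 * t)) * emeasure ?\<mu> B"
  proof (cases "t = 0")
    case True
    have "1 \<le> 8 * real CARD('n)" using zero_less_card_finite[where 'a='n] by linarith
    then have "1 \<le> C" using C by linarith
    have "emeasure ?\<mu> S \<le> 1 * emeasure ?\<mu> B"
      using Bm by (simp, intro emeasure_mono) (auto simp: S_def sets)
    also have "\<dots> \<le> ennreal (C * exp (- 1 * t)) * emeasure ?\<mu> B"
      using True \<open>1 \<le> C\<close> by (intro mult_right_mono) auto
    finally show ?thesis .
  next
    case False
    then have t: "t > 0" using t by simp
    have xG: "x \<in> G" using x by simp
    define d where "d = card E"
    have d2: "d \<le> 2 * CARD('n)"
      using orthonormal_basis_of_finite(2)[OF E] by (simp add: d_def)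
    \<comment> \<open>\<open>G + J G\<close> is the whole nonzero space, so \<open>G\<close> is not
      \<open>{0}\<close> and the weight \<open>\<tau> ^ (d - 1)\<close> is the polar one.\<close>
    have d0: "0 < d"
    proof (rule ccontr)
      assume "\<not> 0 < d"
      then have "E = {}" using orthonormal_basis_of_finite(1)[OF E] by (simp add: d_def)
      then have "G = {0}" using E by (simp add: orthonormal_basis_of_def)
      then have "UNIV = {0 :: complex ^ 'n}" using G by (simp add: generic_subspace_def J_def)
      then have "(axis undefined 1 :: complex ^ 'n) = 0" by blast
      then show False by (simp add: axis_eq_0_iff)
    qed
    define Bs where "Bs = {y. x + y \<in> B}"
    define As where "As = {y\<in>Bs. u (x + y) \<le> ereal (m - t)}"
    have Bsm: "Bs \<in> sets borel" unfolding Bs_def by measurable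
    have Asm: "As \<in> sets borel" unfolding As_def Bs_def by measurable
    have Beq: "Bs = (+) (- x) ` B"
    proof (intro set_eqI iffI)
      show "y \<in> Bs" if "y \<in> (+) (- x) ` B" for y using that by (auto simp: Bs_def)
      show "y \<in> (+) (- x) ` B" if "y \<in> Bs" for y
        using that by (intro image_eqI[of _ _ "x + y"]) (auto simp: Bs_def)
    qed
    have "compact B" unfolding B_def using \<open>closed G\<close> by (intro compact_Int_closed) auto
    then have "compact Bs" unfolding Beq by (rule compact_translation)
    have "convex B" unfolding B_def using sG by (intro convex_Int convex_cball subspace_imp_convex)
    then have "convex Bs" unfolding Beq by (rule convex_translation)
    have Bs0: "0 \<in> Bs" using x by (simp add: Bs_def B_def)
    have shift: "emeasure ?\<mu> {y. x + y \<in> D} = emeasure ?\<mu> D" if D[measurable]: "D \<in> sets borel" for D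
    proof -
      have "{y. x + y \<in> D} \<in> sets borel" by measurable
      then have "emeasure ?\<mu> {y. x + y \<in> D} = (\<integral>\<^sup>+y. indicator {y. x + y \<in> D} y \<partial>?\<mu>)" by (simp add: sets)
      also have "\<dots> = ennreal (1 ^ card E) * (\<integral>\<^sup>+y. indicator D (x + 1 *\<^sub>R y) \<partial>?\<mu>)"
        by (simp add: indicator_def)
      also have "\<dots> = (\<integral>\<^sup>+y. indicator D y \<partial>?\<mu>)"
        by (rule nn_integral_subspace_affine[OF E \<mu> _ xG]) (use D in auto)
      also have "\<dots> = emeasure ?\<mu> D" using D by (simp add: sets)
      finally show ?thesis .
    qed
    have "emeasure ?\<mu> As \<le> ennreal (4 * real d * exp (- t)) * emeasure ?\<mu> Bs"
    proof (rule emeasure_le_of_rays[OF sigma_finite_subspace[OF E \<mu>] sets _ d0 Asm _ Bsm])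
      show "ennreal (\<tau> ^ d) * (\<integral>\<^sup>+y. f (\<tau> *\<^sub>R y) \<partial>?\<mu>) = (\<integral>\<^sup>+y. f y \<partial>?\<mu>)"
        if "0 < \<tau>" "f \<in> borel_measurable borel" for \<tau> f
        using nn_integral_subspace_affine[OF E \<mu> that(1) subspace_0[OF sG] that(2)] by (simp add: d_def)
      show "0 \<notin> As" using x(2) t by (simp add: As_def)
      show "(\<integral>\<^sup>+\<tau>\<in>{0<..}. ennreal (\<tau> ^ (d - 1)) * indicator As (\<tau> *\<^sub>R y) \<partial>lborel)
          \<le> ennreal (4 * real d * exp (- t)) * (\<integral>\<^sup>+\<tau>\<in>{0<..}. ennreal (\<tau> ^ (d - 1)) * indicator Bs (\<tau> *\<^sub>R y) \<partial>lborel)"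
        if "y \<noteq> 0" for y
        unfolding As_def by (rule real_ray_estimate[OF u x(2) t d0 \<open>compact Bs\<close> \<open>convex Bs\<close> Bs0 that])
    qed
    moreover have "emeasure ?\<mu> As = emeasure ?\<mu> S"
      using shift[OF Sm] by (simp add: As_def Bs_def S_def)
    moreover have "emeasure ?\<mu> Bs = emeasure ?\<mu> B" using shift[OF Bm] by (simp add: Bs_def)
    ultimately have "emeasure ?\<mu> S \<le> ennreal (4 * real d * exp (- t)) * emeasure ?\<mu> B" by simp
    also have "\<dots> \<le> ennreal (C * exp (- 1 * t)) * emeasure ?\<mu> B"
    proof (intro mult_right_mono ennreal_leI)
      have "real d \<le> 2 * real CARD('n)" using d2 by (metis of_nat_le_iff of_nat_mult of_nat_numeral)
      then have "4 * real d \<le> C" using C by linarith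
      then show "4 * real d * exp (- t) \<le> C * exp (- 1 * t)" by simp
    qed simp
    finally show ?thesis .
  qed
  then show ?thesis unfolding S_def B_def .
qed

theorem theorem5p1:
  fixes g :: "real \<Rightarrow> real"
  assumes "mono_on {0..} g" and "g 0 = 0" and "filterlim g at_top at_top"
  shows
    "(I_exp 2 g < \<infinity> \<longrightarrow>
       (\<forall>(a :: complex ^ 'n) r B u.
          r > 0 \<and> B = cball a r \<and> u \<in> lelong_class \<longrightarrow>
          (\<integral>\<^sup>+z\<in>B. extend_infty g ((SUP w\<in>B. u w) - u z) \<partial>lborel) / emeasure lborel B
            \<le> ennreal (c_ball CARD('n)) * I_exp 2 g))
     \<and>
     (I_exp 1 g < \<infinity> \<longrightarrow>
       (\<forall>(G :: (complex ^ 'n) set) m a r B u.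
          generic_subspace G \<and> complex_dim G = m \<and>
          a \<in> G \<and> r > 0 \<and> B = cball a r \<inter> G \<and> u \<in> lelong_class \<longrightarrow>
          (\<integral>\<^sup>+z\<in>B. extend_infty g ((SUP w\<in>B. u w) - u z) \<partial>subspace_lborel G)
              / emeasure (subspace_lborel G) B
            \<le> ennreal (8 * real (CARD('n) + m)) * I_exp 1 g))"
proof (intro conjI impI allI; elim conjE)
  fix a :: "complex ^ 'n" and r :: real and B and u :: "complex ^ 'n \<Rightarrow> ereal"
  assume I: "I_exp 2 g < \<infinity>" and r: "r > 0" and B: "B = cball a r" and u: "u \<in> lelong_class"
  have [measurable]: "u \<in> borel_measurable borel" by (rule usc_borel_measurable[OF lelong_class_usc[OF u]])
  have J0: "(0 :: complex ^ 'n) \<in> J ` UNIV" by (rule image_eqI[of _ _ 0]) (simp_all add: J_def)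
  \<comment> \<open>The whole space is generic, so the propagation of \<open>-\<infinity>\<close>
    also shows that the maximum over a complex ball is finite.\<close>
  have "generic_subspace (UNIV :: (complex ^ 'n) set)"
    unfolding generic_subspace_def
  proof (intro conjI set_eqI iffI subspace_UNIV UNIV_I CollectI)
    show "\<exists>x y. z = x + y \<and> x \<in> UNIV \<and> y \<in> J ` UNIV" for z :: "complex ^ 'n"
      using J0 by (intro exI[of _ z] exI[of _ 0]) simp
  qed
  from lelong_class_not_MInf_on_generic[OF u this _ r, of a]
  obtain z where z: "z \<in> cball a r" "u z \<noteq> - \<infinity>" by auto
  obtain x m where x: "x \<in> cball a r" "u x = ereal m" "(SUP w\<in>cball a r. u w) = ereal m"
    "\<And>w. w \<in> cball a r \<Longrightarrow> u w \<le> ereal m"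
    using lelong_class_attains_SUP[OF u compact_cball z] by blast
  have c: "0 \<le> c_ball CARD('n)" using c_ball_ge_1[of "CARD('n)"] by linarith
  have "(\<integral>\<^sup>+z\<in>B. extend_infty g ((SUP w\<in>B. u w) - u z) \<partial>lborel)
      \<le> ennreal (c_ball CARD('n)) * I_exp 2 g * emeasure lborel B"
    unfolding B x(3)
  proof (rule nn_integral_extend_infty_le[OF assms(1,2) _ c _ _ _ _ _ I])
    show "emeasure lborel (cball a r) < \<infinity>" by (rule emeasure_lborel_cball_finite)
    show "(\<lambda>z. ereal m - u z) \<in> borel_measurable lborel" by measurable
    show "0 \<le> ereal m - u z" if "z \<in> cball a r" for z
      using x(4)[OF that] ereal_minus_ge_iff[of 0 m "u z"] by (simp add: zero_ereal_def)
    show "emeasure lborel {z\<in>cball a r. ereal t \<le> ereal m - u z}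
        \<le> ennreal (c_ball CARD('n) * exp (- 2 * t)) * emeasure lborel (cball a r)" if "0 \<le> t" for t
      unfolding ereal_minus_ge_iff by (rule lelong_ball_sublevel[OF u r that x(3,1,2)])
  qed simp_all
  then show "(\<integral>\<^sup>+z\<in>B. extend_infty g ((SUP w\<in>B. u w) - u z) \<partial>lborel) / emeasure lborel B
      \<le> ennreal (c_ball CARD('n)) * I_exp 2 g"
    using emeasure_lborel_cball_finite[of a r] by (intro ennreal_divide_le_of_le_mult) (auto simp: B)
next
  fix G :: "(complex ^ 'n) set" and m :: nat and a r B and u :: "complex ^ 'n \<Rightarrow> ereal"
  assume I: "I_exp 1 g < \<infinity>" and G: "generic_subspace G" and a: "a \<in> G" and r: "r > 0"
    and B: "B = cball a r \<inter> G" and u: "u \<in> lelong_class"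
  have [measurable]: "u \<in> borel_measurable borel" by (rule usc_borel_measurable[OF lelong_class_usc[OF u]])
  let ?\<mu> = "subspace_lborel G"
  have sG: "subspace G" using G by (simp add: generic_subspace_def)
  obtain E where E: "orthonormal_basis_of G E"
    and \<mu>: "?\<mu> = distr (\<Pi>\<^sub>M e\<in>E. lborel) borel (\<lambda>x. \<Sum>e\<in>E. x e *\<^sub>R e)"
    using subspace_lborel_basis[OF sG] by blast
  have sets[measurable_cong]: "sets ?\<mu> = sets borel" by (simp add: \<mu>)
  have cG: "closed G" using sG by (rule closed_subspace)
  have Bm: "B \<in> sets borel" using cG by (simp add: B)
  have Bfin: "emeasure ?\<mu> B < \<infinity>"
    by (rule emeasure_subspace_bounded[OF E \<mu> _ Bm]) (simp add: B bounded_Int)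
  have "compact B" unfolding B using cG by (intro compact_Int_closed) auto
  obtain z where z: "z \<in> B" "u z \<noteq> - \<infinity>"
    using lelong_class_not_MInf_on_generic[OF u G a r] by (auto simp: B)
  obtain x k where x: "x \<in> B" "u x = ereal k" "(SUP w\<in>B. u w) = ereal k" "\<And>w. w \<in> B \<Longrightarrow> u w \<le> ereal k"
    using lelong_class_attains_SUP[OF u \<open>compact B\<close> z] by blast
  have "(\<integral>\<^sup>+z\<in>B. extend_infty g ((SUP w\<in>B. u w) - u z) \<partial>?\<mu>)
      \<le> ennreal (8 * real (CARD('n) + m)) * I_exp 1 g * emeasure ?\<mu> B"
    unfolding x(3)
  proof (rule nn_integral_extend_infty_le[OF assms(1,2) _ _ _ Bfin _ _ _ I])
    show "B \<in> sets ?\<mu>" using Bm sets by simp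
    show "(\<lambda>z. ereal k - u z) \<in> borel_measurable ?\<mu>" by measurable
    show "0 \<le> ereal k - u z" if "z \<in> B" for z
      using x(4)[OF that] ereal_minus_ge_iff[of 0 k "u z"] by (simp add: zero_ereal_def)
    show "emeasure ?\<mu> {z\<in>B. ereal t \<le> ereal k - u z}
        \<le> ennreal (8 * real (CARD('n) + m) * exp (- 1 * t)) * emeasure ?\<mu> B" if "0 \<le> t" for t
      unfolding ereal_minus_ge_iff B
      by (rule lelong_real_ball_sublevel[OF u G a that _ x(2)]) (use x(1) in \<open>auto simp: B\<close>)
  qed simp_all
  then show "(\<integral>\<^sup>+z\<in>B. extend_infty g ((SUP w\<in>B. u w) - u z) \<partial>?\<mu>) / emeasure ?\<mu> B
      \<le> ennreal (8 * real (CARD('n) + m)) * I_exp 1 g"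
    using Bfin by (intro ennreal_divide_le_of_le_mult) auto
qed

end
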